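(* Let $f,g\in\mathcal{K}_H^0$ and $0\le\alpha<1$. Then the harmonic convolution $f*g$ is univalent and fully starlike of order $\alpha$ in at least $|z|<r_0$, where $r_0=r_0(\alpha)$ is the real root of the equation $$2(1-\alpha)(1-r)^4+\alpha(1-r)^2-(r^2+r+1)=0$$ in $(0,1)$. In particular, $f*g$ is univalent and fully starlike in $|z|<r_0(0)\approx0.129831$.
   Context: Let $\mathbb{D}=\{z\in\mathbb{C}:|z|<1\}$. $\mathcal{S}_H$ is the class of univalent sense-preserving complex-valued harmonic functions $f=h+\overline{g}$ in $\mathbb{D}$, where $h(z)=z+\sum_{n\ge2}a_nz^n$ and $g(z)=\sum_{n\ge1}b_nz^n$ are analytic in $\mathbb{D}$ and $|g'(z)|<|h'(z)|$ in $\mathbb{D}$. $\mathcal{K}_H^0$ is the class of all $f\in\mathcal{S}_H$ such that $f(\mathbb{D})$ is convex and $f_{\bar z}(0)=0$ (i.e. $b_1=0$). For $f=z+\sum_{n\ge2}a_nz^n+\overline{\sum_{n\ge1}b_nz^n}$ and $F=z+\sum_{n\ge2}A_nz^n+\overline{\sum_{n\ge1}B_nz^n}$, the harmonic convolution is $f*F=z+\sum_{n\ge2}a_nA_nz^n+\overline{\sum_{n\ge1}b_nB_nz^n}$. A complex-valued harmonic function $f$ with $f(0)=0$ is said to be fully starlike of order $\alpha$ ($0\le\alpha<1$) in a disk $|z|<\rho$ if, for every $0<r<\rho$, $f$ maps the circle $|z|=r$ in a one-to-one manner onto a curve that bounds a domain starlike with respect to the origin and satisfies $\frac{\partial}{\partial\theta}\arg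 f(re^{i\theta})>\alpha$ for $0\le\theta\le2\pi$. Fully starlike means fully starlike of order $0$. *)

theory Defs
  imports "HOL-Complex_Analysis.Complex_Analysis"
begin

text \<open>
  A harmonic mapping of a disk is given by its values; \<open>h\<close> and \<open>g\<close> below are its analytic and
  co-analytic parts, unique once \<open>g 0 = 0\<close> is imposed (see \<open>harmonic_decomp_unique\<close>).
\<close>

definition harmonic_decomp ::
  "complex set \<Rightarrow> (complex \<Rightarrow> complex) \<Rightarrow> (complex \<Rightarrow> complex) \<Rightarrow> (complex \<Rightarrow> complex) \<Rightarrow> bool" where
  "harmonic_decomp S f h g \<longleftrightarrow>
     h holomorphic_on S \<and> g holomorphic_on S \<and> (\<forall>z\<in>S. f z = h z + cnj (g z))"

definition harmonic_in_disk :: "real \<Rightarrow> (complex \<Rightarrow> complex) \<Rightarrow> bool" where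
  "harmonic_in_disk \<rho> f \<longleftrightarrow> (\<exists>h g. harmonic_decomp (ball 0 \<rho>) f h g)"

definition analytic_coeff :: "(complex \<Rightarrow> complex) \<Rightarrow> nat \<Rightarrow> complex" where
  "analytic_coeff f n =
     (THE a. \<exists>h g. harmonic_decomp (ball 0 1) f h g \<and> g 0 = 0 \<and> a = (deriv ^^ n) h 0 / fact n)"

definition coanalytic_coeff :: "(complex \<Rightarrow> complex) \<Rightarrow> nat \<Rightarrow> complex" where
  "coanalytic_coeff f n =
     (THE b. \<exists>h g. harmonic_decomp (ball 0 1) f h g \<and> g 0 = 0 \<and> b = (deriv ^^ n) g 0 / fact n)"

lemma harmonic_decomp_unique:
  assumes 1: "harmonic_decomp (ball 0 1) f h1 g1" "g1 0 = 0"
    and 2: "harmonic_decomp (ball 0 1) f h2 g2" "g2 0 = 0"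
    and z: "z \<in> ball 0 1"
  shows "h1 z = h2 z" "g1 z = g2 z"
proof -
  define v where "v = (\<lambda>z. g2 z - g1 z)"
  have v: "v holomorphic_on ball 0 1"
    using 1 2 unfolding v_def harmonic_decomp_def by (intro holomorphic_intros) auto
  have hv: "(\<lambda>z. h1 z - h2 z) holomorphic_on ball 0 1"
    using 1 2 unfolding harmonic_decomp_def by (intro holomorphic_intros) auto
  have eq: "h1 z - h2 z = cnj (v z)" if "z \<in> ball 0 1" for z
    using 1 2 that by (auto simp: harmonic_decomp_def v_def algebra_simps)
  have dv: "(v has_field_derivative 0) (at z within ball 0 1)" if z: "z \<in> ball 0 1" for z
  proof -
    from v z obtain d where d: "(v has_field_derivative d) (at z)"
      by (metis holomorphic_derivI open_ball)
    from hv z obtain e where e: "((\<lambda>z. h1 z - h2 z) has_field_derivative e) (at z)"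
      by (metis holomorphic_derivI open_ball)
    have e': "((\<lambda>z. cnj (v z)) has_derivative (*) e) (at z)"
      using e[unfolded has_field_derivative_def] open_ball z eq
      by (rule has_derivative_transform_within_open)
    have d': "((\<lambda>z. cnj (v z)) has_derivative (\<lambda>w. cnj (d * w))) (at z)"
      using d by (intro has_derivative_cnj) (auto simp: has_field_derivative_def)
    have "(*) e = (\<lambda>w. cnj (d * w))"
      using has_derivative_unique[OF e' d'] .
    from fun_cong[OF this, of 1] fun_cong[OF this, of \<i>] have "d = 0"
      by (auto simp: complex_eq_iff)
    with d show ?thesis
      using DERIV_subset by blast
  qed
  have "\<exists>c. \<forall>x\<in>ball 0 1. v x = c"
    using dv by (intro has_field_derivative_zero_constant) auto
  then have "v z = v 0" using z by auto
  then have v0: "v z = 0" using 1 2 by (simp add: v_def)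
  then show "g1 z = g2 z" by (simp add: v_def)
  show "h1 z = h2 z" using eq[OF z] v0 by simp
qed

lemma
  assumes "harmonic_decomp (ball 0 1) f h g" "g 0 = 0"
  shows analytic_coeff_eq: "analytic_coeff f n = (deriv ^^ n) h 0 / fact n"
    and coanalytic_coeff_eq: "coanalytic_coeff f n = (deriv ^^ n) g 0 / fact n"
proof -
  have *: "(deriv ^^ n) h' 0 = (deriv ^^ n) h 0 \<and> (deriv ^^ n) g' 0 = (deriv ^^ n) g 0"
    if d: "harmonic_decomp (ball 0 1) f h' g'" "g' 0 = 0" for h' g'
  proof (intro conjI higher_deriv_cong_ev refl)
    show "\<forall>\<^sub>F x in nhds 0. h' x = h x" "\<forall>\<^sub>F x in nhds 0. g' x = g x"
      using harmonic_decomp_unique[OF d assms]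
      by (auto intro!: eventually_nhds_in_open[THEN eventually_mono, of "ball 0 1"])
  qed
  show "analytic_coeff f n = (deriv ^^ n) h 0 / fact n"
    unfolding analytic_coeff_def using assms by (intro the_equality) (auto dest: *)
  show "coanalytic_coeff f n = (deriv ^^ n) g 0 / fact n"
    unfolding coanalytic_coeff_def using assms by (intro the_equality) (auto dest: *)
qed

definition S_H :: "(complex \<Rightarrow> complex) set" where
  "S_H = {f. inj_on f (ball 0 1) \<and>
     (\<exists>h g. harmonic_decomp (ball 0 1) f h g \<and> h 0 = 0 \<and> deriv h 0 = 1 \<and> g 0 = 0 \<and>
        (\<forall>z\<in>ball 0 1. norm (deriv g z) < norm (deriv h z)))}"

text \<open>The condition on \<open>coanalytic_coeff f 1\<close> is $f_{\bar z}(0) = 0$, since $f_{\bar z} = \overline{g'}$.\<close>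

definition K_H0 :: "(complex \<Rightarrow> complex) set" where
  "K_H0 = {f \<in> S_H. convex (f ` ball 0 1) \<and> coanalytic_coeff f 1 = 0}"

definition harmonic_conv :: "(complex \<Rightarrow> complex) \<Rightarrow> (complex \<Rightarrow> complex) \<Rightarrow> complex \<Rightarrow> complex" where
  "harmonic_conv f F z =
     (\<Sum>n. analytic_coeff f n * analytic_coeff F n * z ^ n) +
     cnj (\<Sum>n. coanalytic_coeff f n * coanalytic_coeff F n * z ^ n)"

definition starlike_origin :: "complex set \<Rightarrow> bool" where
  "starlike_origin D \<longleftrightarrow> 0 \<in> D \<and> (\<forall>w\<in>D. closed_segment 0 w \<subseteq> D)"

definition bounds_domain :: "complex set \<Rightarrow> complex set \<Rightarrow> bool" where
  "bounds_domain C D \<longleftrightarrow> open D \<and> connected D \<and> D \<noteq> {} \<and> bounded D \<and> frontier D = C"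

text \<open>
  Here \<open>\<phi>\<close> is a continuous branch of the argument along the nonvanishing closed curve \<open>\<gamma>\<close>
  (continuity being implied by differentiability).  It is taken on all of \<open>\<real>\<close> rather than on
  \<open>{0..2 * pi}\<close> so that the derivatives at the two end points are two-sided; the curves considered
  are \<open>2 * pi\<close>-periodic.
\<close>

definition arg_deriv_gt :: "(real \<Rightarrow> complex) \<Rightarrow> real \<Rightarrow> bool" where
  "arg_deriv_gt \<gamma> \<alpha> \<longleftrightarrow>
     (\<forall>\<theta>. \<gamma> \<theta> \<noteq> 0) \<and>
     (\<exists>\<phi>. (\<forall>\<theta>. \<gamma> \<theta> = of_real (norm (\<gamma> \<theta>)) * cis (\<phi> \<theta>)) \<and>
          (\<forall>\<theta>. \<exists>d > \<alpha>. (\<phi> has_real_derivative d) (at \<theta>)))"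

definition fully_starlike :: "real \<Rightarrow> real \<Rightarrow> (complex \<Rightarrow> complex) \<Rightarrow> bool" where
  "fully_starlike \<alpha> \<rho> f \<longleftrightarrow>
     harmonic_in_disk \<rho> f \<and> f 0 = 0 \<and>
     (\<forall>r. 0 < r \<and> r < \<rho> \<longrightarrow>
        inj_on f (sphere 0 r) \<and>
        (\<exists>D. bounds_domain (f ` sphere 0 r) D \<and> starlike_origin D) \<and>
        arg_deriv_gt (\<lambda>\<theta>. f (of_real r * cis \<theta>)) \<alpha>)"

definition radius_eq :: "real \<Rightarrow> real \<Rightarrow> bool" where
  "radius_eq \<alpha> r \<longleftrightarrow>
     2 * (1 - \<alpha>) * (1 - r) ^ 4 + \<alpha> * (1 - r)\<^sup>2 - (r\<^sup>2 + r + 1) = 0"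

definition conv_radius_starlike :: "real \<Rightarrow> real" where
  "conv_radius_starlike \<alpha> = (THE r. 0 < r \<and> r < 1 \<and> radius_eq \<alpha> r)"

end

(*
  Let f = h + cnj g be convex with b_1 = 0.  If f is bounded, its cluster values on the unit circle
  do not alternate in any direction a more than a convex curve does: for w cluster values at four
  cyclically ordered points, Re (a w) cannot be > c, < c, > c, < c, because the two level sets
  {Re (a f) > c} and {Re (a f) < c} are connected and would contain crossing crosscuts of the disc.
  As a turns by pi the points where Re (a f) is maximal and minimal on the circle swap roles, so for
  some a they are antipodal, say at b and -b.  Then Re (a f) is monotone on both arcs between them,
  hence, by the maximum principle, monotone under the hyperbolic flow from -b to b.  Riemann maps of
  the preimages of large discs carry this over to unbounded f, and its infinitesimal form is
  Re (b (a h'(bz) + cnj a g'(bz)) (1 - z^2)) >= 0.  Together with the Schwarz lemma for the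
  dilatation g'/h' this gives the sharp bounds |a_n| <= (n + 1)/2 and |b_n| <= (n - 1)/2.

  For a convolution with coefficients A_n and B_n these bounds yield, for r below the root r_0,
  sum_{n >= 2} ((n - alpha) |A_n| + (n + alpha) |B_n|) r^(n - 1) < 1 - alpha,
  which forces univalence and full starlikeness of order alpha by direct estimates.
*)

theory Submission
  imports Defs
begin

section \<open>Crosscuts of the disc\<close>

text \<open>A convex univalent harmonic map need not extend continuously to the circle: it can
  collapse whole arcs to points and jump between them. Boundary behaviour is therefore read from the
  closure of the graph, one arbitrary cluster value is chosen at each dyadic multiple of pi, and the
  rotation argument runs on finite cyclic lists before a compactness limit. Antipodal extrema are
  wanted because any other position leaves a free parameter in the quadratic factor of the flow
  field. With fixed points 1 and -1 the factor is 1 - z^2, and dividing by it turns the coefficient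
  bound 2 for functions with nonnegative real part into n + 1. A further division by 1 + w, with w a
  unimodular multiple of the dilatation, multiplies by a series with coefficients at most 1; this
  gives (n + 1)(n + 2) / 2 for h'. For the radius, N((N + 1)^2 + (N - 1)^2) / 4 = N(N^2 + 1) / 2 has
  the generating function r(1 + r + r^2) / (1 - r)^4, and clearing this denominator gives the
  equation for r_0.\<close>

lemma half_plane_paths_cross:
  fixes p q :: "real \<Rightarrow> complex"
  assumes p: "path p" and q: "path q"
    and Im: "\<And>z. z \<in> path_image p \<union> path_image q \<Longrightarrow> 0 \<le> Im z"
    and ends: "Im (pathstart p) = 0" "Im (pathfinish p) = 0"
      "Im (pathstart q) = 0" "Im (pathfinish q) = 0"
    and ord: "Re (pathstart p) < Re (pathstart q)" "Re (pathstart q) < Re (pathfinish p)"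
      "Re (pathfinish p) < Re (pathfinish q)"
  shows "path_image p \<inter> path_image q \<noteq> {}"
proof -
  define V :: "complex \<Rightarrow> real^2" where "V z = (\<chi> i. if i = 1 then Re z else Im z)" for z
  have V1: "V z $ 1 = Re z" and V2: "V z $ 2 = Im z" for z by (auto simp: V_def)
  have contV: "continuous_on S V" for S
    unfolding V_def
    by (rule continuous_on_vec_lambda) (case_tac "i = 1", auto intro!: continuous_intros)
  have "bounded (path_image p \<union> path_image q)"
    using p q by (simp add: bounded_path_image)
  then obtain B where B: "\<And>z. z \<in> path_image p \<union> path_image q \<Longrightarrow> norm z \<le> B"
    by (meson bounded_iff)
  \<comment> \<open>The box [-B, B] x [0, B] contains both paths and has its lower edge on the real
    axis, so all four interlaced ends lie on one edge, as this form of the Fashoda meet theorem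
    requires.\<close>
  define a b :: "real^2" where "a = (\<chi> i. if i = 1 then - B else 0)" and "b = (\<chi> i. B)"
  have box: "V z \<in> cbox a b" if "z \<in> path_image p \<union> path_image q" for z
    using B[OF that] Im[OF that] abs_Re_le_cmod[of z] abs_Im_le_cmod[of z]
    by (auto simp: mem_box_cart a_def b_def forall_2 V1 V2)
  have "\<exists>z. z \<in> path_image (V \<circ> p) \<and> z \<in> path_image (V \<circ> q)"
    by (rule fashoda_interlace[of "V \<circ> p" "V \<circ> q" a b])
      (use ord ends box in \<open>auto simp: path_image_compose pathstart_compose pathfinish_compose
         V1 V2 a_def intro!: path_continuous_image p q contV\<close>)
  then obtain x y where xy: "x \<in> path_image p" "y \<in> path_image q" "V x = V y"
    by (auto simp: path_image_compose)
  then have "x = y" by (metis V1 V2 complex_eqI)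
  with xy show ?thesis by auto
qed

text \<open>Weaker than an arc ending at \<open>\<zeta>\<close>: each \<delta> has its own connected
  piece, which reaches moduli close to 1 but may approach any part of the circle inside the ball. A
  maximum principle supplies exactly this, and it suffices for crosscuts of slightly smaller
  discs.\<close>

definition accessible :: "complex set \<Rightarrow> complex \<Rightarrow> bool" where
  "accessible A \<zeta> \<longleftrightarrow> (\<forall>\<delta>>0. \<exists>U. U \<subseteq> A \<inter> ball \<zeta> \<delta> \<and> open U \<and> connected U \<and>
     (\<forall>R<1. \<exists>w\<in>U. R < norm w))"

text \<open>A path in the connected open piece, from a base point to a point beyond radius
  \<open>R\<close>, is cut where it first leaves \<open>cball 0 R\<close>. The base point does not
  depend on \<open>R\<close>, so the rays at two boundary points can share one connecting
  path.\<close>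

lemma accessible_ray:
  assumes "accessible A \<zeta>" and A: "A \<subseteq> ball 0 1" and "\<delta> > 0"
  obtains z where "z \<in> A" "z \<in> ball \<zeta> \<delta>"
    "\<And>R. norm z < R \<Longrightarrow> R < 1 \<Longrightarrow> \<exists>p. path p \<and> pathstart p = z \<and>
       path_image p \<subseteq> A \<inter> ball \<zeta> \<delta> \<inter> cball 0 R \<and> pathfinish p \<in> sphere 0 R"
proof -
  obtain U where U: "U \<subseteq> A \<inter> ball \<zeta> \<delta>" "open U" "connected U" "\<And>R. R < 1 \<Longrightarrow> \<exists>w\<in>U. R < norm w"
    using assms unfolding accessible_def by metis
  obtain z where z: "z \<in> U" using U(4)[of 0] by auto
  show ?thesis
  proof
    show "z \<in> A" "z \<in> ball \<zeta> \<delta>" using z U by auto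
    fix R assume R: "norm z < R" "R < 1"
    obtain w where w: "w \<in> U" "R < norm w" using U(4) R by blast
    have "path_connected U" using U connected_open_path_connected by blast
    then obtain g where g: "path g" "path_image g \<subseteq> U" "pathstart g = z" "pathfinish g = w"
      using z w unfolding path_connected_def by metis
    obtain h where h: "path h" "pathstart h = pathstart g" "path_image h \<subseteq> path_image g"
      "path_image h - {pathfinish h} \<subseteq> interior (cball 0 R)" "pathfinish h \<in> frontier (cball 0 R)"
      using exists_path_subpath_to_frontier[of g "cball 0 R"] g R w by auto
    have "0 < R" using R norm_ge_zero[of z] by linarith
    then have "pathfinish h \<in> sphere 0 R" using h by simp
    moreover have "path_image h \<subseteq> cball 0 R"
      using h(4) calculation by auto
    ultimately show "\<exists>p. path p \<and> pathstart p = z \<and>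
       path_image p \<subseteq> A \<inter> ball \<zeta> \<delta> \<inter> cball 0 R \<and> pathfinish p \<in> sphere 0 R"
      using h g U by (intro exI[of _ h]) auto
  qed
qed

text \<open>Outside the two small balls only the connecting path remains, and its compact image lies
  in a disc whose radius \<open>R0\<close> is fixed before \<open>R\<close>. Hence the crosscut of
  \<open>cball 0 R\<close> comes near the circle only near the two prescribed points.\<close>

lemma accessible_crosscut:
  assumes A: "open A" "connected A" "A \<subseteq> ball 0 1"
    and acc: "accessible A \<zeta>" "accessible A \<zeta>'" and "\<delta> > 0"
  obtains R0 where "R0 < 1" "0 < R0"
    "\<And>R. R0 < R \<Longrightarrow> R < 1 \<Longrightarrow> \<exists>p. path p \<and> path_image p \<subseteq> A \<inter> cball 0 R \<and>
       path_image p \<subseteq> cball 0 R0 \<union> ball \<zeta> \<delta> \<union> ball \<zeta>' \<delta> \<and>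
       pathstart p \<in> sphere 0 R \<inter> ball \<zeta> \<delta> \<and> pathfinish p \<in> sphere 0 R \<inter> ball \<zeta>' \<delta>"
proof -
  obtain z where z: "z \<in> A" "z \<in> ball \<zeta> \<delta>"
    "\<And>R. norm z < R \<Longrightarrow> R < 1 \<Longrightarrow> \<exists>p. path p \<and> pathstart p = z \<and>
       path_image p \<subseteq> A \<inter> ball \<zeta> \<delta> \<inter> cball 0 R \<and> pathfinish p \<in> sphere 0 R"
    using accessible_ray[OF acc(1) A(3) \<open>\<delta> > 0\<close>] by metis
  obtain z' where z': "z' \<in> A" "z' \<in> ball \<zeta>' \<delta>"
    "\<And>R. norm z' < R \<Longrightarrow> R < 1 \<Longrightarrow> \<exists>p. path p \<and> pathstart p = z' \<and>
       path_image p \<subseteq> A \<inter> ball \<zeta>' \<delta> \<inter> cball 0 R \<and> pathfinish p \<in> sphere 0 R"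
    using accessible_ray[OF acc(2) A(3) \<open>\<delta> > 0\<close>] by metis
  have "path_connected A" using A connected_open_path_connected by blast
  then obtain g where g: "path g" "path_image g \<subseteq> A" "pathstart g = z" "pathfinish g = z'"
    using z z' unfolding path_connected_def by metis
  have "compact (path_image g)" "path_image g \<noteq> {}" using g by auto
  then obtain y where y: "y \<in> path_image g" "\<And>x. x \<in> path_image g \<Longrightarrow> norm x \<le> norm y"
    using continuous_attains_sup[of "path_image g" norm] by (metis continuous_on_norm_id)
  have y1: "norm y < 1" using y g A by auto
  define R0 where "R0 = (norm y + 1) / 2"
  have R0: "R0 < 1" "0 < R0" "norm y < R0"
    using y1 norm_ge_zero[of y] unfolding R0_def by (auto simp: add_nonneg_pos)
  have gR0: "path_image g \<subseteq> cball 0 R0" using y R0 by force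
  show ?thesis
  proof
    show "R0 < 1" "0 < R0" by fact+
    fix R assume R: "R0 < R" "R < 1"
    have "z \<in> path_image g" "z' \<in> path_image g" using g by auto
    then have "norm z < R" "norm z' < R" using y R0 R by force+
    then obtain p p' where p: "path p" "pathstart p = z"
       "path_image p \<subseteq> A \<inter> ball \<zeta> \<delta> \<inter> cball 0 R" "pathfinish p \<in> sphere 0 R"
      and p': "path p'" "pathstart p' = z'"
       "path_image p' \<subseteq> A \<inter> ball \<zeta>' \<delta> \<inter> cball 0 R" "pathfinish p' \<in> sphere 0 R"
      using z(3) z'(3) R by metis
    let ?P = "reversepath p +++ g +++ p'"
    have im: "path_image ?P = path_image p \<union> path_image g \<union> path_image p'"
      using p p' g by (simp add: path_image_join Un_assoc)
    have "pathfinish p \<in> path_image p" "pathfinish p' \<in> path_image p'" by auto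
    then have "pathfinish p \<in> ball \<zeta> \<delta>" "pathfinish p' \<in> ball \<zeta>' \<delta>" using p p' by auto
    moreover have "path ?P" using p p' g by auto
    moreover have "path_image ?P \<subseteq> A \<inter> cball 0 R"
      unfolding im using p p' g gR0 R by auto
    moreover have "path_image ?P \<subseteq> cball 0 R0 \<union> ball \<zeta> \<delta> \<union> ball \<zeta>' \<delta>"
      unfolding im using p p' g gR0 R by blast
    ultimately show "\<exists>p. path p \<and> path_image p \<subseteq> A \<inter> cball 0 R \<and>
       path_image p \<subseteq> cball 0 R0 \<union> ball \<zeta> \<delta> \<union> ball \<zeta>' \<delta> \<and>
       pathstart p \<in> sphere 0 R \<inter> ball \<zeta> \<delta> \<and> pathfinish p \<in> sphere 0 R \<inter> ball \<zeta>' \<delta>"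
      using p p' g by (intro exI[of _ ?P]) auto
  qed
qed

lemma cot_half_strict_antimono:
  assumes "0 < s" "s < s'" "s' < 2 * pi"
  shows "cot (s' / 2) < cot (s / 2)"
proof -
  have "sin (s / 2) > 0" "sin (s' / 2) > 0" using assms by (auto intro!: sin_gt_zero)
  moreover have "sin (s' / 2 - s / 2) > 0" using assms by (intro sin_gt_zero) auto
  then have "cos (s' / 2) * sin (s / 2) < cos (s / 2) * sin (s' / 2)"
    by (simp only: sin_diff) (simp add: mult.commute)
  ultimately show ?thesis
    by (simp add: cot_def divide_simps)
qed

lemma Im_cayley:
  "Im (\<i> * (\<kappa> + z) / (\<kappa> - z)) = ((norm \<kappa>)\<^sup>2 - (norm z)\<^sup>2) / (norm (\<kappa> - z))\<^sup>2"
proof -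
  have "\<i> * (\<kappa> + z) / (\<kappa> - z) = \<i> * (\<kappa> + z) * cnj (\<kappa> - z) / of_real ((norm (\<kappa> - z))\<^sup>2)"
    by (subst complex_div_cnj) simp
  then show ?thesis
    by (simp only: Im_divide_of_real) (simp add: cmod_power2, simp add: algebra_simps power2_eq_square)
qed

text \<open>Division by \<open>cis \<tau>\<close> leaves a function of \<open>s\<close> alone. Since
  - cot (s / 2) increases on (0, 2 pi), the circle without the pole is laid out on the real line in
  the order of the angle, and interlacing is preserved.\<close>

lemma Re_cayley_cis:
  assumes "0 < s" "s < 2 * pi"
  shows "Re (\<i> * (cis \<tau> + cis (\<tau> + s)) / (cis \<tau> - cis (\<tau> + s))) = - cot (s / 2)"
proof -
  have "sin (s / 2) > 0" using assms by (auto intro!: sin_gt_zero)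
  have "\<i> * (cis \<tau> + cis (\<tau> + s)) / (cis \<tau> - cis (\<tau> + s)) = \<i> * (1 + cis s) / (1 - cis s)"
  proof -
    have "cis \<tau> + cis (\<tau> + s) = cis \<tau> * (1 + cis s)" "cis \<tau> - cis (\<tau> + s) = cis \<tau> * (1 - cis s)"
      by (simp_all add: cis_mult[symmetric] algebra_simps)
    then show ?thesis by simp
  qed
  also have "\<dots> = - of_real (cot (s / 2))"
  proof -
    define u where "u = s / 2"
    have s: "s = 2 * u" by (simp add: u_def)
    have pos: "sin u > 0" using \<open>sin (s / 2) > 0\<close> by (simp add: u_def)
    have "1 - cis s \<noteq> 0"
    proof
      assume "1 - cis s = 0"
      then have "cos (2 * u) = 1" using s by (simp add: complex_eq_iff)
      then show False using pos by (simp add: cos_double_sin)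
    qed
    moreover have "\<i> * (1 + cis s) = - of_real (cos u / sin u) * (1 - cis s)"
    proof -
      have "cos u * (1 - cos s) = sin u * sin s" "sin u * (1 + cos s) = cos u * sin s"
        using cos_double_sin[of u] cos_double_cos[of u]
        by (simp_all add: s sin_double power2_eq_square)
      then show ?thesis
        using pos by (simp add: complex_eq_iff field_simps)
    qed
    ultimately show ?thesis
      by (simp add: s cot_def divide_simps)
  qed
  finally show ?thesis by simp
qed

text \<open>
  The Cayley transform \<open>\<i> * (\<kappa> + z) / (\<kappa> - z)\<close>, with its pole \<open>\<kappa>\<close> on the arc from the fourth to
  the first point, carries crosscuts of a slightly smaller disc to paths in the upper half-plane.
\<close>

lemma interlaced_accessible:
  assumes t: "t1 < t2" "t2 < t3" "t3 < t4" "t4 < t1 + 2 * pi"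
    and A: "open A" "connected A" "A \<subseteq> ball 0 1"
    and B: "open B" "connected B" "B \<subseteq> ball 0 1"
    and "A \<inter> B = {}"
    and acc: "accessible A (cis t1)" "accessible B (cis t2)" "accessible A (cis t3)"
      "accessible B (cis t4)"
  shows False
proof -
  define \<tau> where "\<tau> = (t4 - 2 * pi + t1) / 2"
  have \<tau>: "t4 - 2 * pi < \<tau>" "\<tau> < t1" using t by (auto simp: \<tau>_def)
  define \<kappa> where "\<kappa> = cis \<tau>"
  define m where "m z = \<i> * (\<kappa> + z) / (\<kappa> - z)" for z
  define x where "x t = - cot ((t - \<tau>) / 2)" for t
  have mono: "x t < x t'" if "\<tau> < t" "t < t'" "t' < \<tau> + 2 * pi" for t t'
    using cot_half_strict_antimono[of "t - \<tau>" "t' - \<tau>"] that by (simp add: x_def)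
  have mx: "Re (m (cis t)) = x t" if "\<tau> < t" "t < \<tau> + 2 * pi" for t
    using Re_cayley_cis[of "t - \<tau>" \<tau>] that by (simp add: m_def \<kappa>_def x_def)
  have ne: "cis t \<noteq> \<kappa>" if "\<tau> < t" "t < \<tau> + 2 * pi" for t
  proof
    assume "cis t = \<kappa>"
    then have "cis (t - \<tau>) = 1" by (simp add: \<kappa>_def cis_divide[symmetric])
    then have c: "cos (t - \<tau>) = 1" by (metis cis.simps(1) one_complex.sel(1))
    have "sin ((t - \<tau>) / 2) > 0" using that by (intro sin_gt_zero) auto
    moreover have "cos (t - \<tau>) = 1 - 2 * (sin ((t - \<tau>) / 2))\<^sup>2"
      using cos_double_sin[of "(t - \<tau>) / 2"] by (metis nonzero_mult_div_cancel_left times_divide_eq_right zero_neq_numeral)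
    ultimately show False using c by simp
  qed
  have cont: "isCont m z" if "z \<noteq> \<kappa>" for z
    unfolding m_def using that by (intro continuous_intros) auto
  have near: "\<exists>d>0. \<forall>z\<in>ball (cis t) d. z \<noteq> \<kappa> \<and> lo < Re (m z) \<and> Re (m z) < hi"
    if t: "\<tau> < t" "t < \<tau> + 2 * pi" and lh: "lo < x t" "x t < hi" for t lo hi
  proof -
    have lim: "((\<lambda>z. Re (m z)) \<longlongrightarrow> x t) (nhds (cis t))"
      using cont[OF ne[OF t]] mx[OF t] tendsto_Re[of m "m (cis t)" "nhds (cis t)"]
      by (simp add: isCont_def tendsto_at_iff_tendsto_nhds)
    have "\<forall>\<^sub>F z in nhds (cis t). z \<noteq> \<kappa>"
      using ne[OF t] t1_space_nhds by blast
    then have "\<forall>\<^sub>F z in nhds (cis t). z \<noteq> \<kappa> \<and> lo < Re (m z) \<and> Re (m z) < hi"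
      using order_tendstoD[OF lim] lh by (simp add: eventually_conj_iff)
    then show ?thesis unfolding eventually_nhds_metric by (metis dist_commute mem_ball)
  qed
  \<comment> \<open>Midpoints between consecutive images separate the four neighbourhoods, so the
    ends of the crosscuts interlace wherever they lie in the small balls.\<close>
  define c12 c23 c34 where "c12 = (x t1 + x t2) / 2" and "c23 = (x t2 + x t3) / 2" and "c34 = (x t3 + x t4) / 2"
  have xs: "x t1 < x t2" "x t2 < x t3" "x t3 < x t4" using mono t \<tau> by auto
  obtain d1 where d1: "d1 > 0" "\<forall>z\<in>ball (cis t1) d1. z \<noteq> \<kappa> \<and> x t1 - 1 < Re (m z) \<and> Re (m z) < c12"
    using near[of t1 "x t1 - 1" c12] t \<tau> xs by (auto simp: c12_def)
  obtain d2 where d2: "d2 > 0" "\<forall>z\<in>ball (cis t2) d2. z \<noteq> \<kappa> \<and> c12 < Re (m z) \<and> Re (m z) < c23"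
    using near[of t2 c12 c23] t \<tau> xs by (auto simp: c12_def c23_def)
  obtain d3 where d3: "d3 > 0" "\<forall>z\<in>ball (cis t3) d3. z \<noteq> \<kappa> \<and> c23 < Re (m z) \<and> Re (m z) < c34"
    using near[of t3 c23 c34] t \<tau> xs by (auto simp: c23_def c34_def)
  obtain d4 where d4: "d4 > 0" "\<forall>z\<in>ball (cis t4) d4. z \<noteq> \<kappa> \<and> c34 < Re (m z) \<and> Re (m z) < x t4 + 1"
    using near[of t4 c34 "x t4 + 1"] t \<tau> xs by (auto simp: c34_def)
  define d where "d = Min {d1, d2, d3, d4}"
  have d: "d > 0" "d \<le> d1" "d \<le> d2" "d \<le> d3" "d \<le> d4" using d1 d2 d3 d4 by (auto simp: d_def)
  obtain RA where RA: "RA < 1" "0 < RA"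
    "\<And>R. RA < R \<Longrightarrow> R < 1 \<Longrightarrow> \<exists>p. path p \<and> path_image p \<subseteq> A \<inter> cball 0 R \<and>
       path_image p \<subseteq> cball 0 RA \<union> ball (cis t1) (d/2) \<union> ball (cis t3) (d/2) \<and>
       pathstart p \<in> sphere 0 R \<inter> ball (cis t1) (d/2) \<and> pathfinish p \<in> sphere 0 R \<inter> ball (cis t3) (d/2)"
    using accessible_crosscut[OF A acc(1,3), of "d/2"] d by auto
  obtain RB where RB: "RB < 1" "0 < RB"
    "\<And>R. RB < R \<Longrightarrow> R < 1 \<Longrightarrow> \<exists>p. path p \<and> path_image p \<subseteq> B \<inter> cball 0 R \<and>
       path_image p \<subseteq> cball 0 RB \<union> ball (cis t2) (d/2) \<union> ball (cis t4) (d/2) \<and>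
       pathstart p \<in> sphere 0 R \<inter> ball (cis t2) (d/2) \<and> pathfinish p \<in> sphere 0 R \<inter> ball (cis t4) (d/2)"
    using accessible_crosscut[OF B acc(2,4), of "d/2"] d by auto
  \<comment> \<open>The condition 1 - d/2 < R makes the rescaling of \<open>cball 0 R\<close> to the
    unit disc move points by less than d/2; points within d/2 of a marked point then stay within d
    of it.\<close>
  define R where "R = (Max {RA, RB, 1 - d / 2} + 1) / 2"
  have R: "RA < R" "RB < R" "1 - d / 2 < R" "R < 1" "0 < R"
    using RA RB d by (auto simp: R_def max_def)
  obtain p where p: "path p" "path_image p \<subseteq> A \<inter> cball 0 R"
    "path_image p \<subseteq> cball 0 RA \<union> ball (cis t1) (d/2) \<union> ball (cis t3) (d/2)"
    "pathstart p \<in> sphere 0 R \<inter> ball (cis t1) (d/2)" "pathfinish p \<in> sphere 0 R \<inter> ball (cis t3) (d/2)"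
    using RA(3)[of R] R by auto
  obtain q where q: "path q" "path_image q \<subseteq> B \<inter> cball 0 R"
    "path_image q \<subseteq> cball 0 RB \<union> ball (cis t2) (d/2) \<union> ball (cis t4) (d/2)"
    "pathstart q \<in> sphere 0 R \<inter> ball (cis t2) (d/2)" "pathfinish q \<in> sphere 0 R \<inter> ball (cis t4) (d/2)"
    using RB(3)[of R] R by auto
  have scale: "y / of_real R \<in> ball \<zeta> d" if "y \<in> cball 0 R" "y \<in> ball \<zeta> (d/2)" for y \<zeta> :: complex
  proof -
    have "norm (y / of_real R - y) = norm (y / of_real R) * (1 - R)"
    proof -
      have "y / of_real R - y = (y / of_real R) * of_real (1 - R)" using R by (simp add: field_simps)
      then have "norm (y / of_real R - y) = norm (y / of_real R) * \<bar>1 - R\<bar>"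
        by (simp only: norm_mult norm_of_real)
      then show ?thesis using R by simp
    qed
    also have "\<dots> \<le> 1 * (1 - R)"
      using that R by (intro mult_right_mono) (auto simp: norm_divide)
    finally have "dist (y / of_real R) y < d / 2" using R by (simp add: dist_norm)
    then show ?thesis using that dist_triangle_half_l[of \<zeta> y d "y / of_real R"]
      by (simp add: dist_commute)
  qed
  define M where "M y = m (y / of_real R)" for y
  have ImM: "Im (M y) \<ge> 0" if "y \<in> cball 0 R" for y
  proof -
    have "norm (y / of_real R) \<le> 1" using that R by (simp add: norm_divide)
    then show ?thesis unfolding M_def m_def Im_cayley
      by (simp add: \<kappa>_def power_le_one)
  qed
  have ImM0: "Im (M y) = 0" if "y \<in> sphere 0 R" for y
    using that R unfolding M_def m_def Im_cayley by (simp add: \<kappa>_def norm_divide)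
  have contM: "continuous_on S M" if "\<And>y. y \<in> S \<Longrightarrow> y / of_real R \<noteq> \<kappa>" for S
    unfolding M_def m_def
  proof (intro continuous_intros ballI)
    fix y assume "y \<in> S"
    then show "\<kappa> - y / of_real R \<noteq> 0" using that by fastforce
  qed (use R in auto)
  have nk: "y / of_real R \<noteq> \<kappa>" if "y \<in> cball 0 r" "r < R" for y r
  proof -
    have "norm (y / of_real R) < 1" using that R by (simp add: norm_divide)
    then show ?thesis by (auto simp: \<kappa>_def)
  qed
  \<comment> \<open>After rescaling, a point of the path either has norm below 1 or lies in one of
    the neighbourhoods that exclude the pole.\<close>
  have kp: "y / of_real R \<noteq> \<kappa>" if "y \<in> path_image p" for y
  proof -
    have "y \<in> cball 0 R" "y \<in> cball 0 RA \<union> ball (cis t1) (d/2) \<union> ball (cis t3) (d/2)" using that p by auto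
    then show ?thesis using nk[of y RA] R scale[of y "cis t1"] scale[of y "cis t3"] d1 d3 d by force
  qed
  have kq: "y / of_real R \<noteq> \<kappa>" if "y \<in> path_image q" for y
  proof -
    have "y \<in> cball 0 R" "y \<in> cball 0 RB \<union> ball (cis t2) (d/2) \<union> ball (cis t4) (d/2)" using that q by auto
    then show ?thesis using nk[of y RB] R scale[of y "cis t2"] scale[of y "cis t4"] d2 d4 d by force
  qed
  have e: "Re (M (pathstart p)) < c12" "c12 < Re (M (pathstart q))" "Re (M (pathstart q)) < c23"
    "c23 < Re (M (pathfinish p))" "Re (M (pathfinish p)) < c34" "c34 < Re (M (pathfinish q))"
    using d1(2) d2(2) d3(2) d4(2) scale[of "pathstart p" "cis t1"] scale[of "pathfinish p" "cis t3"]
      scale[of "pathstart q" "cis t2"] scale[of "pathfinish q" "cis t4"] p(4,5) q(4,5) d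
    by (force simp: M_def)+
  have "path_image (M \<circ> p) \<inter> path_image (M \<circ> q) \<noteq> {}"
  proof (rule half_plane_paths_cross)
    show "path (M \<circ> p)" "path (M \<circ> q)"
      using kp kq by (auto intro!: path_continuous_image p q contM)
  qed (use e ImM ImM0 p q in \<open>auto simp: path_image_compose pathstart_compose pathfinish_compose\<close>)
  then obtain y y' where y: "y \<in> path_image p" "y' \<in> path_image q" "M y = M y'"
    by (auto simp: path_image_compose)
  have inj: "u = v" if "m u = m v" "u \<noteq> \<kappa>" "v \<noteq> \<kappa>" for u v
  proof -
    have "(\<kappa> + u) * (\<kappa> - v) = (\<kappa> + v) * (\<kappa> - u)"
      using that by (simp add: m_def field_simps)
    then have "2 * \<kappa> * (u - v) = 0" by (simp add: algebra_simps)
    then show ?thesis by (simp add: \<kappa>_def)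
  qed
  have "y = y'" using inj[of "y / of_real R" "y' / of_real R"] y kp kq R by (auto simp: M_def)
  then show False using y p q \<open>A \<inter> B = {}\<close> by auto
qed

section \<open>Boundary cluster values of a bounded convex harmonic map\<close>

text \<open>
  Near an exceptional boundary point, where nothing but boundedness is known, the factor \<open>e\<close> vanishes;
  raising \<open>exp \<Psi>\<close> to a high power removes its influence inside.
\<close>

lemma Re_le_0_by_boundary_limits:
  fixes \<Psi> e :: "complex \<Rightarrow> complex"
  assumes hol: "\<Psi> holomorphic_on ball 0 1" "e holomorphic_on UNIV"
    and bd: "\<And>z. z \<in> ball 0 1 \<Longrightarrow> \<bar>Re (\<Psi> z)\<bar> \<le> B"
    and e: "\<And>z. norm z \<le> 1 \<Longrightarrow> norm (e z) \<le> 2" "\<And>z. z \<in> ball 0 1 \<Longrightarrow> e z \<noteq> 0"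
    and lim: "\<And>z \<zeta> L. (\<And>n::nat. z n \<in> ball 0 1) \<Longrightarrow> z \<longlonglongrightarrow> \<zeta> \<Longrightarrow> norm \<zeta> = 1 \<Longrightarrow> e \<zeta> \<noteq> 0 \<Longrightarrow>
      (\<lambda>n. Re (\<Psi> (z n))) \<longlonglongrightarrow> L \<Longrightarrow> L \<le> 0"
    and z0: "z0 \<in> ball 0 1"
  shows "Re (\<Psi> z0) \<le> 0"
proof -
  have conte: "continuous_on UNIV e" using hol holomorphic_on_imp_continuous_on by blast
  \<comment> \<open>At every boundary limit the modulus is at most 2: the exponential is at most 1
    where \<open>e\<close> does not vanish, and the product is 0 where it does. The value 3 leaves
    room for a boundary layer, and the bound is independent of \<open>n\<close>, so large
    \<open>n\<close> forces a nonpositive real part.\<close>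
  have key: "exp (real n * Re (\<Psi> z0)) * norm (e z0) \<le> 3" for n :: nat
  proof -
    define G where "G z = exp (of_nat n * \<Psi> z) * e z" for z
    have normG: "norm (G z) = exp (real n * Re (\<Psi> z)) * norm (e z)" for z
      by (simp add: G_def norm_mult)
    have holG: "G holomorphic_on ball 0 1"
      unfolding G_def by (intro holomorphic_intros hol holomorphic_on_subset[OF hol(2)]) auto
    have "\<exists>R0<1. \<forall>z. R0 < norm z \<longrightarrow> norm z < 1 \<longrightarrow> norm (G z) \<le> 3"
    proof (rule ccontr)
      assume "\<not> ?thesis"
      then have "\<forall>k. \<exists>z. 1 - 1 / real (Suc k) < norm z \<and> norm z < 1 \<and> norm (G z) > 3"
        by (force simp: not_le)
      then obtain z where z: "\<And>k. 1 - 1 / real (Suc k) < norm (z k)" "\<And>k. norm (z k) < 1"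
        "\<And>k. norm (G (z k)) > 3" by metis
      \<comment> \<open>Compactness is applied to pairs, so that the points and the real parts
        converge along the same subsequence, as \<open>lim\<close> demands.\<close>
      have "bounded (range (\<lambda>k. (z k, Re (\<Psi> (z k)))))"
      proof (rule boundedI)
        fix p assume "p \<in> range (\<lambda>k. (z k, Re (\<Psi> (z k))))"
        then obtain k where "p = (z k, Re (\<Psi> (z k)))" by auto
        then show "norm p \<le> 1 + B"
          using norm_Pair_le[of "z k" "Re (\<Psi> (z k))"] z(2)[of k] bd[of "z k"] by auto
      qed
      then obtain l r where r: "strict_mono r" and l: "((\<lambda>k. (z k, Re (\<Psi> (z k)))) \<circ> r) \<longlonglongrightarrow> l"
        using bounded_imp_convergent_subsequence by blast
      obtain \<zeta> L where "l = (\<zeta>, L)" by fastforce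
      then have z\<zeta>: "(\<lambda>k. z (r k)) \<longlonglongrightarrow> \<zeta>" and zL: "(\<lambda>k. Re (\<Psi> (z (r k)))) \<longlonglongrightarrow> L"
        using tendsto_fst[OF l] tendsto_snd[OF l] by (auto simp: o_def)
      have nz: "(\<lambda>k. norm (z k)) \<longlonglongrightarrow> 1"
      proof (rule tendsto_sandwich)
        show "(\<lambda>k. 1 - 1 / real (Suc k)) \<longlonglongrightarrow> 1"
          using tendsto_diff[OF tendsto_const LIMSEQ_inverse_real_of_nat, of 1] by (simp add: inverse_eq_divide)
        show "(\<lambda>k. 1::real) \<longlonglongrightarrow> 1" by simp
      qed (use z in \<open>auto intro!: always_eventually less_imp_le\<close>)
      have n\<zeta>: "norm \<zeta> = 1"
        using LIMSEQ_unique[OF tendsto_norm[OF z\<zeta>] LIMSEQ_subseq_LIMSEQ[OF nz r, unfolded o_def]] .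
      have "(\<lambda>k. e (z (r k))) \<longlonglongrightarrow> e \<zeta>"
        using continuous_on_tendsto_compose[OF conte z\<zeta>] by simp
      then have "(\<lambda>k. norm (G (z (r k)))) \<longlonglongrightarrow> exp (real n * L) * norm (e \<zeta>)"
        unfolding normG by (intro tendsto_intros zL)
      then have "3 \<le> exp (real n * L) * norm (e \<zeta>)"
        using z(3) by (intro LIMSEQ_le_const) (auto intro!: exI[of _ 0] less_imp_le)
      moreover have "exp (real n * L) * norm (e \<zeta>) \<le> 2"
      proof (cases "e \<zeta> = 0")
        case False
        then have "L \<le> 0" using lim[of "\<lambda>k. z (r k)" \<zeta> L] z z\<zeta> zL n\<zeta> by auto
        then have "exp (real n * L) \<le> 1" by (simp add: mult_nonneg_nonpos)
        then have "exp (real n * L) * norm (e \<zeta>) \<le> 1 * 2" using e n\<zeta> by (intro mult_mono) auto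
        then show ?thesis by simp
      qed simp
      ultimately show False by simp
    qed
    then obtain R0 where R0: "R0 < 1" "\<And>z. R0 < norm z \<Longrightarrow> norm z < 1 \<Longrightarrow> norm (G z) \<le> 3" by auto
    define R where "R = (max R0 (norm z0) + 1) / 2"
    have R: "R0 < R" "norm z0 < R" "R < 1" using R0 z0 by (auto simp: R_def max_def)
    then have R_pos: "0 < R" using norm_ge_zero[of z0] by linarith
    have "norm (G z0) \<le> 3"
    proof (rule maximum_modulus_frontier[of G "ball 0 R"])
      show "G holomorphic_on interior (ball 0 R)"
        using R by (intro holomorphic_on_subset[OF holG]) auto
      show "continuous_on (closure (ball 0 R)) G"
        using R R_pos holomorphic_on_imp_continuous_on[OF holG] by (auto intro: continuous_on_subset)
    qed (use R R_pos R0 in auto)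
    then show ?thesis by (simp add: normG)
  qed
  show ?thesis
  proof (rule ccontr)
    assume "\<not> ?thesis"
    then have pos: "Re (\<Psi> z0) > 0" by simp
    have ne: "norm (e z0) > 0" using e z0 by simp
    obtain n where n: "real n * (Re (\<Psi> z0) * norm (e z0)) > 3"
      using reals_Archimedean3 pos ne by (metis mult_pos_pos)
    have "real n * Re (\<Psi> z0) \<le> exp (real n * Re (\<Psi> z0))"
      using exp_ge_add_one_self[of "real n * Re (\<Psi> z0)"] by linarith
    then have "real n * Re (\<Psi> z0) * norm (e z0) \<le> exp (real n * Re (\<Psi> z0)) * norm (e z0)"
      using ne by (intro mult_right_mono) auto
    then show False using key[of n] n by (simp add: mult.assoc)
  qed
qed

locale bounded_convex_harmonic =
  fixes f h g :: "complex \<Rightarrow> complex" and K :: real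
  assumes decomp: "harmonic_decomp (ball 0 1) f h g"
    and inj: "inj_on f (ball 0 1)"
    and conv: "convex (f ` ball 0 1)"
    and bound: "\<And>z. z \<in> ball 0 1 \<Longrightarrow> norm (f z) \<le> K"
begin

text \<open>The fibre over a point of the unit circle is the cluster set of \<open>f\<close> there;
  it replaces boundary values, which need not exist.\<close>

definition cluster :: "(complex \<times> complex) set" where
  "cluster = closure ((\<lambda>z. (z, f z)) ` ball 0 1)"

text \<open>A holomorphic function with the same real part as \<open>a * f\<close>, because
  conjugation does not change Re (a * cnj g). It makes the maximum modulus principle available for
  linear functionals of \<open>f\<close>.\<close>

definition part :: "complex \<Rightarrow> complex \<Rightarrow> complex" where
  "part a z = a * h z + cnj a * g z"

lemma hol: "h holomorphic_on ball 0 1" "g holomorphic_on ball 0 1"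
  using decomp by (auto simp: harmonic_decomp_def)

lemma holomorphic_part: "part a holomorphic_on ball 0 1"
  unfolding part_def by (intro holomorphic_intros hol)

lemma Re_part: "z \<in> ball 0 1 \<Longrightarrow> Re (part a z) = Re (a * f z)"
  using decomp by (auto simp: harmonic_decomp_def part_def algebra_simps)

lemma cont: "continuous_on (ball 0 1) f"
proof -
  have "continuous_on (ball 0 1) (\<lambda>z. h z + cnj (g z))"
    by (intro continuous_intros holomorphic_on_imp_continuous_on hol)
  then show ?thesis
    by (rule continuous_on_eq) (use decomp in \<open>auto simp: harmonic_decomp_def\<close>)
qed

lemma Re_bound: "norm a = 1 \<Longrightarrow> norm w \<le> K \<Longrightarrow> \<bar>Re (a * w)\<bar> \<le> K"
  using abs_Re_le_cmod[of "a * w"] by (simp add: norm_mult)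

lemma clusterI:
  assumes "\<And>n::nat. z n \<in> ball 0 1" "z \<longlonglongrightarrow> \<zeta>" "(\<lambda>n. f (z n)) \<longlonglongrightarrow> w"
  shows "(\<zeta>, w) \<in> cluster"
  unfolding cluster_def closure_sequential
  using assms by (intro exI[of _ "\<lambda>n. (z n, f (z n))"]) (auto intro: tendsto_Pair)

lemma clusterE:
  assumes "(\<zeta>, w) \<in> cluster"
  obtains z where "\<And>n::nat. z n \<in> ball 0 1" "z \<longlonglongrightarrow> \<zeta>" "(\<lambda>n. f (z n)) \<longlonglongrightarrow> w"
proof -
  obtain p where p: "\<And>n. p n \<in> (\<lambda>z. (z, f z)) ` ball 0 1" "p \<longlonglongrightarrow> (\<zeta>, w)"
    using assms unfolding cluster_def closure_sequential by blast
  have "snd (p n) = f (fst (p n))" "fst (p n) \<in> ball 0 1" for n using p(1)[of n] by auto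
  then show ?thesis
    using that[of "\<lambda>n. fst (p n)"] tendsto_fst[OF p(2)] tendsto_snd[OF p(2)] by simp
qed

lemma cluster_subseq:
  assumes z: "\<And>n::nat. z n \<in> ball 0 1"
  obtains r w where "strict_mono (r :: nat \<Rightarrow> nat)" "(\<lambda>n. f (z (r n))) \<longlonglongrightarrow> w"
proof -
  have "bounded (range (\<lambda>n. f (z n)))" using bound z by (auto intro!: boundedI[of _ K])
  then show ?thesis
    using bounded_imp_convergent_subsequence that by (fastforce simp: o_def)
qed

lemma cluster_exists:
  assumes "norm \<zeta> = 1"
  obtains w where "(\<zeta>, w) \<in> cluster"
proof -
  define z where "z n = of_real (1 - inverse (real (Suc n))) * \<zeta>" for n
  have z1: "z n \<in> ball 0 1" for n
  proof -
    have "norm (z n) = \<bar>1 - inverse (real (Suc n))\<bar>"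
      unfolding z_def norm_mult norm_of_real using assms by simp
    moreover have "0 < inverse (real (Suc n))" "inverse (real (Suc n)) \<le> 1"
      by (simp_all add: divide_simps)
    ultimately show ?thesis by simp
  qed
  have "(\<lambda>n. 1 - inverse (real (Suc n))) \<longlonglongrightarrow> 1 - 0"
    by (rule tendsto_diff[OF tendsto_const LIMSEQ_inverse_real_of_nat])
  then have "z \<longlonglongrightarrow> of_real (1 - 0) * \<zeta>" unfolding z_def
    by (intro tendsto_mult tendsto_of_real tendsto_const)
  then have lim: "z \<longlonglongrightarrow> \<zeta>" by simp
  obtain r w where r: "strict_mono (r :: nat \<Rightarrow> nat)" "(\<lambda>n. f (z (r n))) \<longlonglongrightarrow> w"
    using cluster_subseq z1 by blast
  show ?thesis
    using that clusterI[of "\<lambda>n. z (r n)" \<zeta> w] z1 r LIMSEQ_subseq_LIMSEQ[OF lim r(1)] by (simp add: o_def)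
qed

section \<open>Level sets of Re (a f) and their access to the circle\<close>

definition superlevel :: "complex \<Rightarrow> real \<Rightarrow> complex set" where
  "superlevel a c = {z \<in> ball 0 1. c < Re (a * f z)}"

lemma superlevel_subset: "superlevel a c \<subseteq> ball 0 1"
  by (auto simp: superlevel_def)

lemma open_superlevel: "open (superlevel a c)"
proof -
  have "superlevel a c = ball 0 1 \<inter> (\<lambda>z. Re (a * f z)) -` {c<..}"
    by (auto simp: superlevel_def)
  then show ?thesis
    by (simp only:) (intro continuous_open_preimage open_ball open_greaterThan continuous_intros cont)
qed

text \<open>Convexity and univalence enter here: the image meets a half-plane in a convex set, and
  by invariance of domain the inverse of \<open>f\<close> carries this set back
  continuously.\<close>

lemma connected_superlevel: "connected (superlevel a c)"
proof -
  obtain k where k: "homeomorphism (ball 0 1) (f ` ball 0 1) f k"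
    using invariance_of_domain_homeomorphism[OF open_ball cont _ inj] by auto
  define H where "H = f ` ball 0 1 \<inter> {w. inner (cnj a) w > c}"
  have "connected H"
    unfolding H_def by (intro convex_connected convex_Int conv convex_halfspace_gt)
  moreover have "continuous_on H k"
    using k by (auto simp: homeomorphism_def H_def intro: continuous_on_subset)
  moreover have "superlevel a c = k ` H"
  proof -
    have Re: "Re (a * w) = inner (cnj a) w" for w by (simp add: inner_complex_def)
    have kf: "k (f z) = z" if "z \<in> ball 0 1" for z using homeomorphism_apply1[OF k that] .
    have "superlevel a c = k ` f ` superlevel a c"
      using kf by (force simp: superlevel_def image_image)
    also have "f ` superlevel a c = H" unfolding superlevel_def H_def Re by auto
    finally show ?thesis .
  qed
  ultimately show ?thesis using connected_continuous_image by metis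
qed

text \<open>A component of the level set inside the \<delta>-ball that stayed away from the circle
  would have Re (a f) at most c on its frontier, except where it leaves the ball. Subtracting a
  harmonic penalty that vanishes at \<open>cis t\<close> and is large at distance \<delta> removes
  the exception; the maximum principle then contradicts a value above c close to
  \<open>cis t\<close>.\<close>

lemma accessible_superlevel:
  assumes a: "norm a = 1" and w: "(cis t, w) \<in> cluster" "c < Re (a * w)"
  shows "accessible (superlevel a c) (cis t)"
  unfolding accessible_def
proof (intro allI impI)
  fix \<delta> :: real assume \<delta>: "\<delta> > 0"
  define \<zeta> where "\<zeta> = cis t"
  define K' where "K' = max K \<bar>c\<bar>"
  \<comment> \<open>On the disc |z - \<zeta>|^2 is at most 2(1 - Re (z cnj \<zeta>)), so at distance
    \<delta> or more the penalty \<open>\<beta>\<close> is at least 2K'. There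
    \<open>v - \<beta>\<close> is at most K - 2K', hence at most c, by the choice of K'.\<close>
  define k where "k = 4 * K' / \<delta>\<^sup>2"
  have K': "K \<le> K'" "-K' \<le> c" "K' \<ge> 0" by (auto simp: K'_def)
  have k: "k \<ge> 0" using K' by (simp add: k_def)
  define v where "v z = Re (a * f z)" for z
  define \<beta> where "\<beta> z = k * (1 - Re (z * cnj \<zeta>))" for z
  obtain z where z: "\<And>n::nat. z n \<in> ball 0 1" "z \<longlonglongrightarrow> \<zeta>" "(\<lambda>n. f (z n)) \<longlonglongrightarrow> w"
    using clusterE w unfolding \<zeta>_def by blast
  have "(\<lambda>n. \<beta> (z n)) \<longlonglongrightarrow> k * (1 - Re (\<zeta> * cnj \<zeta>))"
    unfolding \<beta>_def by (intro tendsto_intros z)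
  moreover have "\<zeta> * cnj \<zeta> = 1" by (simp add: \<zeta>_def cis_cnj cis_mult)
  ultimately have b0: "(\<lambda>n. \<beta> (z n)) \<longlonglongrightarrow> 0" by (simp only: one_complex.sel) simp
  have "(\<lambda>n. v (z n) - \<beta> (z n)) \<longlonglongrightarrow> Re (a * w) - 0"
    unfolding v_def by (intro tendsto_intros z b0)
  then have "\<forall>\<^sub>F n in sequentially. c < v (z n) - \<beta> (z n)"
    using w by (intro order_tendstoD) auto
  moreover have "\<forall>\<^sub>F n in sequentially. dist (z n) \<zeta> < \<delta>" using z \<delta> tendstoD by blast
  ultimately have "\<forall>\<^sub>F n in sequentially. c < v (z n) - \<beta> (z n) \<and> dist (z n) \<zeta> < \<delta>"
    by (rule eventually_conj)
  then obtain n where n: "c < v (z n) - \<beta> (z n)" "dist (z n) \<zeta> < \<delta>"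
    using eventually_happens'[OF sequentially_bot] by blast
  define z0 where "z0 = z n"
  have Re1: "Re (p * cnj \<zeta>) \<le> 1" if "norm p \<le> 1" for p
    using complex_Re_le_cmod[of "p * cnj \<zeta>"] that by (simp add: norm_mult \<zeta>_def)
  have \<beta>: "\<beta> p \<ge> 0" if "norm p \<le> 1" for p
    unfolding \<beta>_def using Re1[OF that] k by (intro mult_nonneg_nonneg) linarith+
  have z0: "z0 \<in> ball 0 1" "c < v z0 - \<beta> z0" "dist z0 \<zeta> < \<delta>" using z n by (auto simp: z0_def)
  define S where "S = superlevel a c \<inter> ball \<zeta> \<delta>"
  define U where "U = connected_component_set S z0"
  have "open S" unfolding S_def by (intro open_Int open_superlevel open_ball)
  then have oU: "open U" unfolding U_def by (rule open_connected_component)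
  have US: "U \<subseteq> S" unfolding U_def by (rule connected_component_subset)
  have cU: "connected U" unfolding U_def by (rule connected_connected_component)
  have Sv: "p \<in> S \<longleftrightarrow> p \<in> ball 0 1 \<and> c < v p \<and> dist p \<zeta> < \<delta>" for p
    by (simp add: S_def superlevel_def v_def dist_commute del: times_complex.sel)
  have "z0 \<in> S" using z0 \<beta>[of z0] by (simp add: Sv)
  then have z0U: "z0 \<in> U" by (simp add: U_def)
  have "\<exists>w\<in>U. R < norm w" if "R < 1" for R
  proof (rule ccontr)
    assume "\<not> ?thesis"
    then have UR: "U \<subseteq> cball 0 R" by force
    then have clU: "closure U \<subseteq> cball 0 R" by (simp add: closure_minimal)
    define G where "G z = exp (part a z - of_real k * (1 - z * cnj \<zeta>))" for z
    have normG: "norm (G p) = exp (v p - \<beta> p)" if "p \<in> ball 0 1" for p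
    proof -
      have "Re (of_real k * u) = k * Re u" for u by simp
      then show ?thesis
        unfolding G_def norm_exp_eq_Re minus_complex.sel Re_part[OF that] v_def \<beta>_def
        by (simp only: minus_complex.sel one_complex.sel)
    qed
    have holG: "G holomorphic_on ball 0 1"
      unfolding G_def by (intro holomorphic_intros holomorphic_part)
    have "norm (G z0) \<le> exp c"
    proof (rule maximum_modulus_frontier[of G U])
      show "G holomorphic_on interior U"
        using US interior_subset[of U] superlevel_subset[of a c] unfolding S_def
        by (intro holomorphic_on_subset[OF holG]) blast
      show "continuous_on (closure U) G"
        using clU \<open>R < 1\<close>
        by (intro continuous_on_subset[OF holomorphic_on_imp_continuous_on[OF holG]]) auto
      show "bounded U" using UR bounded_subset bounded_cball by blast
      show "z0 \<in> U" by fact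
      fix p assume "p \<in> frontier U"
      then have p: "p \<in> closure U" "p \<notin> U" using oU by (auto simp: frontier_def interior_open)
      then have p1: "p \<in> ball 0 1" using clU \<open>R < 1\<close> by force
      have "p \<notin> S"
      proof
        assume "p \<in> S"
        have "connected (insert p U)"
          by (rule connected_intermediate_closure[OF cU]) (use p closure_subset in auto)
        then have "insert p U \<subseteq> connected_component_set S z0"
          using z0U US \<open>p \<in> S\<close> by (intro connected_component_maximal) auto
        then show False using p by (simp add: U_def)
      qed
      then consider "v p \<le> c" | "dist p \<zeta> \<ge> \<delta>"
        using p1 Sv[of p] not_less by blast
      then have "v p - \<beta> p \<le> c"
      proof cases
        case 1
        then show ?thesis using \<beta>[of p] p1 by simp
      next
        case 2
        have "\<delta>\<^sup>2 \<le> (dist p \<zeta>)\<^sup>2" using 2 \<delta> by (intro power_mono) auto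
        also have "\<dots> = (norm p)\<^sup>2 + (norm \<zeta>)\<^sup>2 - 2 * Re (p * cnj \<zeta>)"
          unfolding dist_norm cmod_power2 by (simp add: power2_eq_square algebra_simps)
        also have "\<dots> \<le> 2 * (1 - Re (p * cnj \<zeta>))"
          using p1 by (simp add: \<zeta>_def power_le_one)
        finally have "k * \<delta>\<^sup>2 \<le> k * (2 * (1 - Re (p * cnj \<zeta>)))" using k by (rule mult_left_mono)
        then have "k * \<delta>\<^sup>2 \<le> 2 * \<beta> p" unfolding \<beta>_def by (simp only: mult.left_commute)
        then have "\<beta> p \<ge> 2 * K'" using \<delta> by (simp add: k_def)
        moreover have "v p \<le> K" using Re_bound[OF a bound[OF p1]] by (simp add: v_def)
        ultimately show ?thesis using K' by linarith
      qed
      then show "norm (G p) \<le> exp c" using normG[OF p1] by simp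
    qed
    then show False using normG[OF z0(1)] z0 by simp
  qed
  then show "\<exists>U\<subseteq>superlevel a c \<inter> ball (cis t) \<delta>. open U \<and> connected U \<and> (\<forall>R<1. \<exists>w\<in>U. R < norm w)"
    using US oU cU unfolding S_def \<zeta>_def by blast
qed

text \<open>The set where Re (a f) is below c is the superlevel set for -a at -c, so one notion of
  accessibility serves both sides.\<close>

lemma no_alternation:
  assumes a: "norm a = 1"
    and t: "t1 < t2" "t2 < t3" "t3 < t4" "t4 < t1 + 2 * pi"
    and w: "(cis t1, w1) \<in> cluster" "(cis t2, w2) \<in> cluster"
      "(cis t3, w3) \<in> cluster" "(cis t4, w4) \<in> cluster"
    and c: "c < Re (a * w1)" "Re (a * w2) < c" "c < Re (a * w3)" "Re (a * w4) < c"
  shows False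
proof -
  have neg: "Re (- a * w) = - Re (a * w)" for w by simp
  have c': "- c < Re (- a * w2)" "- c < Re (- a * w4)" using c unfolding neg by simp_all
  have a': "norm (- a) = 1" using a by simp
  have "superlevel a c \<inter> superlevel (- a) (- c) = {}"
    unfolding superlevel_def neg by auto
  then show False
    by (rule interlaced_accessible[OF t open_superlevel connected_superlevel superlevel_subset
          open_superlevel connected_superlevel superlevel_subset _ accessible_superlevel[OF a w(1) c(1)]
          accessible_superlevel[OF a' w(2) c'(1)] accessible_superlevel[OF a w(3) c(3)]
          accessible_superlevel[OF a' w(4) c'(2)]])
qed

text \<open>One boundary point cannot carry all values above c: with the factor
  \<open>\<zeta> - z\<close> the boundary principle disregards that point and would give Re (a f) at
  most c throughout the disc. The extra point later completes an alternating quadruple.\<close>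

lemma second_cluster_point:
  assumes a: "norm a = 1" and w: "(\<zeta>, w) \<in> cluster" "c < Re (a * w)" and \<zeta>: "norm \<zeta> = 1"
  obtains \<zeta>' w' where "norm \<zeta>' = 1" "\<zeta>' \<noteq> \<zeta>" "(\<zeta>', w') \<in> cluster" "c < Re (a * w')"
proof (rule ccontr)
  assume "\<not> thesis"
  then have "\<not> (norm \<zeta>' = 1 \<and> \<zeta>' \<noteq> \<zeta> \<and> (\<zeta>', w') \<in> cluster \<and> c < Re (a * w'))" for \<zeta>' w'
    using that by blast
  then have le: "Re (a * w') \<le> c" if "norm \<zeta>' = 1" "\<zeta>' \<noteq> \<zeta>" "(\<zeta>', w') \<in> cluster" for \<zeta>' w'
    using that not_le by blast
  have "Re (a * f z) \<le> c" if z: "z \<in> ball 0 1" for z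
  proof -
    have "Re (part a z - of_real c) \<le> 0"
    proof (rule Re_le_0_by_boundary_limits[where \<Psi> = "\<lambda>z. part a z - of_real c" and e = "\<lambda>z. \<zeta> - z" and B = "K + \<bar>c\<bar>"])
      show "(\<lambda>z. part a z - of_real c) holomorphic_on ball 0 1"
        by (intro holomorphic_intros holomorphic_part)
      show "\<bar>Re (part a z - of_real c)\<bar> \<le> K + \<bar>c\<bar>" if "z \<in> ball 0 1" for z
        using Re_bound[OF a bound[OF that]] unfolding minus_complex.sel Re_part[OF that] Re_complex_of_real
        by linarith
      show "norm (\<zeta> - z) \<le> 2" if "norm z \<le> 1" for z
        using norm_triangle_ineq4[of \<zeta> z] \<zeta> that by simp
      fix x \<xi> L
      assume x: "\<And>n::nat. x n \<in> ball 0 1" "x \<longlonglongrightarrow> \<xi>" "norm \<xi> = 1" "\<zeta> - \<xi> \<noteq> 0"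
        "(\<lambda>n. Re (part a (x n) - of_real c)) \<longlonglongrightarrow> L"
      obtain r w' where r: "strict_mono (r :: nat \<Rightarrow> nat)" "(\<lambda>n. f (x (r n))) \<longlonglongrightarrow> w'"
        using cluster_subseq x(1) by blast
      have "(\<xi>, w') \<in> cluster"
        using clusterI[of "\<lambda>n. x (r n)"] x r LIMSEQ_subseq_LIMSEQ[OF x(2) r(1)] by (simp add: o_def)
      then have "Re (a * w') \<le> c" using le x by auto
      moreover have "(\<lambda>n. Re (a * f (x (r n))) - c) \<longlonglongrightarrow> Re (a * w') - c"
        by (intro tendsto_intros r)
      moreover have "(\<lambda>n. Re (a * f (x (r n))) - c) \<longlonglongrightarrow> L"
        using LIMSEQ_subseq_LIMSEQ[OF x(5) r(1)]
        by (simp only: o_def minus_complex.sel Re_part[OF x(1)] Re_complex_of_real)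
      ultimately show "L \<le> 0" using LIMSEQ_unique by (metis diff_le_0_iff_le)
    next
      show "(\<lambda>z. \<zeta> - z) holomorphic_on UNIV" by (intro holomorphic_intros)
      show "\<zeta> - z \<noteq> 0" if "z \<in> ball 0 1" for z using \<zeta> that by auto
    qed (rule z)
    then show ?thesis unfolding minus_complex.sel Re_part[OF z] Re_complex_of_real by linarith
  qed
  moreover obtain x where x: "\<And>n::nat. x n \<in> ball 0 1" "(\<lambda>n. f (x n)) \<longlonglongrightarrow> w"
    using clusterE w by blast
  have "(\<lambda>n. Re (a * f (x n))) \<longlonglongrightarrow> Re (a * w)" by (intro tendsto_intros x)
  ultimately have "Re (a * w) \<le> c" using x(1) by (meson Lim_bounded)
  then show False using w by simp
qed

end

section \<open>Antipodal extrema\<close>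

lemma periodic_int_multiple:
  fixes F :: "int \<Rightarrow> 'a" and p :: int
  assumes per: "\<And>i. F (i + p) = F i"
  shows "F (i + p * m) = F i"
proof (induction m rule: int_induct[where k = 0])
  case (step1 m)
  then show ?case using per[of "i + p * m"] by (simp add: algebra_simps)
next
  case (step2 m)
  then show ?case using per[of "i + p * (m - 1)"] by (simp add: algebra_simps)
qed simp

text \<open>Suppose no maximal index faces a minimal one. Let \<open>P\<close> and \<open>Q\<close>
  be the sets of directions in which some minimal index follows a maximal one by at most,
  respectively at least, half a turn. Both are closed, they cover the line, and turning by pi
  exchanges them; so they meet. In a common direction any two maximal indices are joined by a run of
  maximal ones, likewise for minimal ones, and moving along the runs would have to pass an offset 0
  or n modulo 2n, both excluded.\<close>

lemma antipodal_extrema: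
  fixes F :: "int \<Rightarrow> complex" and n :: int
  assumes n: "n > 0" and per: "\<And>i. F (i + 2 * n) = F i"
    and alt: "\<And>a c i1 i2 i3 i4. norm a = 1 \<Longrightarrow> i1 < i2 \<Longrightarrow> i2 < i3 \<Longrightarrow> i3 < i4 \<Longrightarrow> i4 < i1 + 2 * n \<Longrightarrow>
      c < Re (a * F i1) \<Longrightarrow> Re (a * F i2) < c \<Longrightarrow> c < Re (a * F i3) \<Longrightarrow> Re (a * F i4) < c \<Longrightarrow> False"
  obtains a i where "norm a = 1" "\<And>k. Re (a * F k) \<le> Re (a * F i)" "\<And>k. Re (a * F (i + n)) \<le> Re (a * F k)"
proof (rule ccontr)
  assume "\<not> thesis"
  then have none: "\<not> (norm a = 1 \<and> (\<forall>k. Re (a * F k) \<le> Re (a * F i)) \<and> (\<forall>k. Re (a * F (i + n)) \<le> Re (a * F k)))" for a i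
    using that by blast
  define X where "X \<alpha> = {i. \<forall>k. Re (cis \<alpha> * F k) \<le> Re (cis \<alpha> * F i)}" for \<alpha>
  define Y where "Y \<alpha> = {i. \<forall>k. Re (cis \<alpha> * F i) \<le> Re (cis \<alpha> * F k)}" for \<alpha>
  have XY: "X (\<alpha> + pi) = Y \<alpha>" "Y (\<alpha> + pi) = X \<alpha>" for \<alpha>
    by (auto simp: X_def Y_def cis_mult[symmetric] simp del: times_complex.sel)
  have per': "F (i + 2 * n * m) = F i" for i m
    by (rule periodic_int_multiple) (rule per)
  have Xper: "i + 2 * n * m \<in> X \<alpha> \<longleftrightarrow> i \<in> X \<alpha>" for i m \<alpha> by (simp add: X_def per')
  have Yper: "i + 2 * n * m \<in> Y \<alpha> \<longleftrightarrow> i \<in> Y \<alpha>" for i m \<alpha> by (simp add: Y_def per')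
  have anti: "i + n \<notin> Y \<alpha>" if "i \<in> X \<alpha>" for i \<alpha>
    using none[of "cis \<alpha>" i] that unfolding X_def Y_def mem_Collect_eq norm_cis by blast
  \<comment> \<open>An index both maximal and minimal makes the real part constant, and then its
    antipode is minimal too.\<close>
  have disj: "i \<notin> Y \<alpha>" if "i \<in> X \<alpha>" for i \<alpha>
  proof
    assume "i \<in> Y \<alpha>"
    then have e: "Re (cis \<alpha> * F k) = Re (cis \<alpha> * F i)" for k
      using that unfolding X_def Y_def by (simp add: order_antisym del: times_complex.sel)
    have "Re (cis \<alpha> * F (i + n)) \<le> Re (cis \<alpha> * F k)" for k
      using e[of k] e[of "i + n"] by linarith
    then have "i + n \<in> Y \<alpha>" unfolding Y_def by blast
    then show False using anti that by blast
  qed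
  \<comment> \<open>Otherwise both arcs between i and j contain a nonmaximal index, and these two
    alternate with i and j about a level just below the maximum.\<close>
  have arc: "{i..j} \<subseteq> X \<alpha> \<or> {j..i + 2 * n} \<subseteq> X \<alpha>" if ij: "i \<in> X \<alpha>" "j \<in> X \<alpha>" "i \<le> j" "j \<le> i + 2 * n" for i j \<alpha>
  proof (rule ccontr)
    assume "\<not> ?thesis"
    then obtain p q where pq: "p \<in> {i..j}" "p \<notin> X \<alpha>" "q \<in> {j..i + 2 * n}" "q \<notin> X \<alpha>" by blast
    define v where "v k = Re (cis \<alpha> * F k)" for k
    have vi: "v k \<le> v i" for k using ij by (simp add: X_def v_def del: times_complex.sel)
    have vj: "v j = v i" using ij vi[of j] unfolding X_def v_def by (simp add: order_antisym del: times_complex.sel)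
    have lt: "v k < v i" if "k \<notin> X \<alpha>" for k
    proof (rule ccontr)
      assume "\<not> v k < v i"
      then have "v l \<le> v k" for l using vi[of l] by linarith
      then show False using that by (simp add: X_def v_def del: times_complex.sel)
    qed
    have "i + 2 * n \<in> X \<alpha>" using Xper[of i 1] ij by simp
    then have ne: "p \<noteq> i" "p \<noteq> j" "q \<noteq> j" "q \<noteq> i + 2 * n" using pq ij by auto
    define c where "c = (max (v p) (v q) + v i) / 2"
    have "v p < c" "v q < c" "c < v i" using lt[OF pq(2)] lt[OF pq(4)] by (auto simp: c_def)
    then show False
      using alt[of "cis \<alpha>" i p j q c] pq ne vj unfolding v_def by auto
  qed
  \<comment> \<open>The run may wrap around the period; the translate of j is chosen so that the run
    is the integer interval between the two indices.\<close>
  have path: "\<exists>m. {min i (j + 2 * n * m)..max i (j + 2 * n * m)} \<subseteq> X \<alpha>"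
    if ij: "i \<in> X \<alpha>" "j \<in> X \<alpha>" for i j \<alpha>
  proof -
    define m where "m = - ((j - i) div (2 * n))"
    define j' where "j' = j + 2 * n * m"
    have "j' - i = (j - i) mod (2 * n)" unfolding j'_def m_def
      using minus_div_mult_eq_mod[of "j - i" "2 * n"] by (simp add: algebra_simps)
    then have b: "i \<le> j'" "j' < i + 2 * n"
      using pos_mod_sign[of "2 * n" "j - i"] pos_mod_bound[of "2 * n" "j - i"] n by linarith+
    have "j' \<in> X \<alpha>" using Xper ij by (simp add: j'_def)
    then consider "{i..j'} \<subseteq> X \<alpha>" | "{j'..i + 2 * n} \<subseteq> X \<alpha>" using arc[OF ij(1) _ b(1)] b by auto
    then show ?thesis
    proof cases
      case 1
      then show ?thesis using b by (intro exI[of _ m]) (simp add: j'_def)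
    next
      case 2
      have eq: "j + 2 * n * (m - 1) = j' - 2 * n" by (simp add: j'_def algebra_simps)
      have "{j' - 2 * n..i} \<subseteq> X \<alpha>"
      proof
        fix k assume "k \<in> {j' - 2 * n..i}"
        then have "k + 2 * n * 1 \<in> X \<alpha>" using 2 by auto
        then show "k \<in> X \<alpha>" using Xper by blast
      qed
      then show ?thesis using b unfolding eq[symmetric]
        by (intro exI[of _ "m - 1"]) (simp add: eq min_def max_def)
    qed
  qed
  have pathY: "\<exists>m. {min i (j + 2 * n * m)..max i (j + 2 * n * m)} \<subseteq> Y \<alpha>"
    if "i \<in> Y \<alpha>" "j \<in> Y \<alpha>" for i j \<alpha>
    using path[of i "\<alpha> + pi" j] that by (simp add: XY)
  have Xne: "X \<alpha> \<noteq> {}" for \<alpha>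
  proof -
    have ne: "(\<lambda>k. Re (cis \<alpha> * F k)) ` {0..<2 * n} \<noteq> {}" using n by auto
    then obtain i where i: "i \<in> {0..<2 * n}"
      "Re (cis \<alpha> * F i) = Max ((\<lambda>k. Re (cis \<alpha> * F k)) ` {0..<2 * n})"
      using Max_in[OF _ ne] by (metis (no_types, lifting) finite_atLeastLessThan_int finite_imageI imageE)
    have "Re (cis \<alpha> * F k) \<le> Re (cis \<alpha> * F i)" for k
    proof -
      have "F k = F (k mod (2 * n))" using per'[of "k mod (2 * n)" "k div (2 * n)"] by simp
      then show ?thesis unfolding i(2) using n by (simp del: times_complex.sel)
    qed
    then show ?thesis by (auto simp: X_def simp del: times_complex.sel)
  qed
  have Yne: "Y \<alpha> \<noteq> {}" for \<alpha> using Xne[of "\<alpha> + pi"] by (simp add: XY)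
  define P where "P = {\<alpha>. \<exists>i\<in>X \<alpha>. \<exists>j\<in>Y \<alpha>. i \<le> j \<and> j \<le> i + n}"
  define Q where "Q = {\<alpha>. \<exists>i\<in>X \<alpha>. \<exists>j\<in>Y \<alpha>. i + n \<le> j \<and> j \<le> i + 2 * n}"
  have PQ: "P \<union> Q = UNIV"
  proof -
    have "\<alpha> \<in> P \<union> Q" for \<alpha>
    proof -
      obtain i j where ij: "i \<in> X \<alpha>" "j \<in> Y \<alpha>" using Xne Yne by blast
      define j' where "j' = j + 2 * n * (- ((j - i) div (2 * n)))"
      have "j' \<in> Y \<alpha>" using Yper ij unfolding j'_def by blast
      moreover have "j' - i = (j - i) mod (2 * n)" unfolding j'_def
        using minus_div_mult_eq_mod[of "j - i" "2 * n"] by (simp add: algebra_simps)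
      then have "i \<le> j'" "j' < i + 2 * n"
        using pos_mod_sign[of "2 * n" "j - i"] pos_mod_bound[of "2 * n" "j - i"] n by linarith+
      moreover have "j' \<le> i + n \<or> i + n \<le> j'" by linarith
      ultimately show ?thesis using ij unfolding P_def Q_def
        by (blast intro: less_imp_le)
    qed
    then show ?thesis by blast
  qed
  have swap: "\<alpha> \<in> P \<Longrightarrow> \<alpha> + pi \<in> Q" "\<alpha> \<in> Q \<Longrightarrow> \<alpha> + pi \<in> P" for \<alpha>
  proof -
    have sh: "i + 2 * n \<in> X \<alpha>" if "i \<in> X \<alpha>" for i using Xper[of i 1] that by simp
    show "\<alpha> \<in> P \<Longrightarrow> \<alpha> + pi \<in> Q" "\<alpha> \<in> Q \<Longrightarrow> \<alpha> + pi \<in> P"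
      unfolding P_def Q_def mem_Collect_eq XY using sh
      by (elim bexE conjE, rule_tac x = j in bexI, rule_tac x = "i + 2 * n" in bexI; auto)+
  qed
  have closed_XY: "closed {\<alpha>. i \<in> X \<alpha> \<and> j \<in> Y \<alpha>}" for i j
    unfolding X_def Y_def mem_Collect_eq
    by (intro closed_Collect_conj closed_Collect_all closed_Collect_le continuous_intros)
  have "closed P"
  proof -
    \<comment> \<open>Translation by multiples of 2n brings i into one period, which leaves a finite
      union of closed sets.\<close>
    have "P = (\<Union>i\<in>{0..<2 * n}. \<Union>j\<in>{i..i + n}. {\<alpha>. i \<in> X \<alpha> \<and> j \<in> Y \<alpha>})" (is "_ = ?R")
    proof (intro equalityI subsetI)
      fix \<alpha> assume "\<alpha> \<in> P"
      then obtain i j where ij: "i \<in> X \<alpha>" "j \<in> Y \<alpha>" "i \<le> j" "j \<le> i + n" unfolding P_def by blast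
      define m where "m = - (i div (2 * n))"
      have i': "i + 2 * n * m = i mod (2 * n)" unfolding m_def
        using minus_div_mult_eq_mod[of i "2 * n"] by (simp add: algebra_simps)
      have "i + 2 * n * m \<in> {0..<2 * n}" unfolding i' using n by simp
      moreover have "j + 2 * n * m \<in> {i + 2 * n * m..(i + 2 * n * m) + n}" using ij by auto
      moreover have "i + 2 * n * m \<in> X \<alpha>" "j + 2 * n * m \<in> Y \<alpha>" using Xper Yper ij by blast+
      ultimately show "\<alpha> \<in> ?R" by blast
    next
      fix \<alpha> assume "\<alpha> \<in> ?R"
      then obtain i j where "i \<in> X \<alpha>" "j \<in> Y \<alpha>" "i \<le> j" "j \<le> i + n" by auto
      then show "\<alpha> \<in> P" unfolding P_def by blast
    qed
    then show ?thesis using closed_XY by (auto intro!: closed_UN)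
  qed
  moreover have "closed Q"
  proof -
    have "Q = (\<lambda>\<alpha>. \<alpha> + pi) -` P"
    proof (intro equalityI subsetI)
      fix \<alpha> assume "\<alpha> \<in> (\<lambda>\<alpha>. \<alpha> + pi) -` P"
      then have "\<alpha> + pi \<in> P" by simp
      then have "\<alpha> + pi + pi \<in> Q" by (rule swap(1))
      then show "\<alpha> \<in> Q" unfolding Q_def by (simp only: mem_Collect_eq XY)
    qed (use swap in auto)
    then show ?thesis using \<open>closed P\<close> by (auto intro!: closed_vimage continuous_intros)
  qed
  moreover have "P \<noteq> {}" "Q \<noteq> {}" using PQ swap by blast+
  ultimately have "P \<inter> Q \<noteq> {}"
    using connected_UNIV[where 'a = real] PQ unfolding connected_closed by auto
  then obtain \<alpha> where "\<alpha> \<in> P" "\<alpha> \<in> Q" by blast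
  then obtain i1 j1 i2 j2 where
    1: "i1 \<in> X \<alpha>" "j1 \<in> Y \<alpha>" "i1 \<le> j1" "j1 \<le> i1 + n" and
    2: "i2 \<in> X \<alpha>" "j2 \<in> Y \<alpha>" "i2 + n \<le> j2" "j2 \<le> i2 + 2 * n"
    unfolding P_def Q_def by blast
  have "j1 \<noteq> i1" "j1 \<noteq> i1 + n" using 1 anti[of i1 \<alpha>] disj[of i1 \<alpha>] by auto
  then have o1: "i1 < j1" "j1 < i1 + n" using 1 by linarith+
  have "i2 + 2 * n \<in> X \<alpha>" using Xper[of i2 1] 2 by simp
  then have "j2 \<noteq> i2 + n" "j2 \<noteq> i2 + 2 * n" using 2 anti[of i2 \<alpha>] disj[of "i2 + 2 * n" \<alpha>] by auto
  then have o2: "i2 + n < j2" "j2 < i2 + 2 * n" using 2 by linarith+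
  obtain m where m: "{min i1 (i2 + 2 * n * m)..max i1 (i2 + 2 * n * m)} \<subseteq> X \<alpha>" using path 1 2 by blast
  obtain m' where m': "{min j1 (j2 + 2 * n * m')..max j1 (j2 + 2 * n * m')} \<subseteq> Y \<alpha>" using pathY 1 2 by blast
  define i j where "i = i2 + 2 * n * m" and "j = j2 + 2 * n * m'"
  have iX: "k \<in> X \<alpha>" if "min i1 i \<le> k" "k \<le> max i1 i" for k using m that by (auto simp: i_def)
  have jY: "k \<in> Y \<alpha>" if "min j1 j \<le> k" "k \<le> max j1 j" for k using m' that by (auto simp: j_def)
  \<comment> \<open>The maximal index moves from i1 to i with j1 fixed, and afterwards the minimal
    one from j1 to j with i fixed. The offset starts strictly between 0 and n and can reach neither,
    yet its final value is congruent modulo 2n to j2 - i2, which lies strictly between n and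
    2n.\<close>
  have a: "i < j1"
  proof (rule ccontr)
    assume "\<not> ?thesis"
    then have "j1 \<in> X \<alpha>" using iX[of j1] o1 by auto
    then show False using disj 1 by blast
  qed
  have b: "j1 < i + n"
  proof (rule ccontr)
    assume "\<not> ?thesis"
    then have "j1 - n \<in> X \<alpha>" using iX[of "j1 - n"] o1 by auto
    then show False using anti[of "j1 - n" \<alpha>] 1 by simp
  qed
  have c: "i < j"
  proof (rule ccontr)
    assume "\<not> ?thesis"
    then have "i \<in> Y \<alpha>" using jY[of i] a by auto
    then show False using disj[of i \<alpha>] iX[of i] by simp
  qed
  have d: "j < i + n"
  proof (rule ccontr)
    assume "\<not> ?thesis"
    then have "i + n \<in> Y \<alpha>" using jY[of "i + n"] b by auto
    then show False using anti[of i \<alpha>] iX[of i] by simp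
  qed
  have "(j2 - i2) - (j - i) = 2 * n * (m - m')" by (simp add: i_def j_def algebra_simps)
  moreover have "0 < (j2 - i2) - (j - i)" "(j2 - i2) - (j - i) < 2 * n * 1" using o2 c d by linarith+
  ultimately have "0 < 2 * n * (m - m')" "2 * n * (m - m') < 2 * n * 1" by linarith+
  then have "0 < m - m'" "m - m' < 1"
    using n by (simp_all only: zero_less_mult_iff mult_less_cancel_left_pos) auto
  then show False by linarith
qed

text \<open>Each level is invariant under adding pi, so modulo 2 pi it is a cyclic list of even
  length in which antipodes make sense. The levels are nested with dense union, which permits the
  limit over m.\<close>

definition dyadic_angles :: "nat \<Rightarrow> real set" where
  "dyadic_angles m = range (\<lambda>k::int. pi * of_int k / 2 ^ m)"

lemma dyadic_angles_mono: "m \<le> m' \<Longrightarrow> dyadic_angles m \<subseteq> dyadic_angles m'"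
proof
  fix x assume "m \<le> m'" "x \<in> dyadic_angles m"
  then obtain k d where "x = pi * of_int k / 2 ^ m" "m' = m + d"
    by (auto simp: dyadic_angles_def le_iff_add)
  then have "x = pi * of_int (k * 2 ^ d) / 2 ^ m'" by (simp add: power_add)
  then show "x \<in> dyadic_angles m'" unfolding dyadic_angles_def by blast
qed

lemma dyadic_angles_dense:
  assumes "x < y"
  obtains u m where "u \<in> dyadic_angles m" "x < u" "u < y"
proof -
  obtain m where m: "(1/2::real) ^ m < (y - x) / pi"
    using real_arch_pow_inv[of "(y - x) / pi" "1/2"] assms by auto
  define \<delta> where "\<delta> = pi / 2 ^ m"
  have \<delta>: "0 < \<delta>" "\<delta> < y - x" using m assms by (auto simp: \<delta>_def field_simps)
  define k where "k = \<lfloor>x / \<delta>\<rfloor> + 1"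
  have "x / \<delta> < of_int k" "of_int k \<le> x / \<delta> + 1" unfolding k_def by linarith+
  then have "x < \<delta> * of_int k" "\<delta> * of_int k \<le> x + \<delta>" using \<delta> by (auto simp: field_simps)
  moreover have "\<delta> * of_int k \<in> dyadic_angles m" unfolding dyadic_angles_def \<delta>_def by auto
  ultimately show ?thesis using that \<delta> by fastforce
qed

context bounded_convex_harmonic
begin

text \<open>The choice depends on t only through \<open>cis t\<close>, hence is 2 pi-periodic; no
  continuity in t is available.\<close>

definition bval :: "real \<Rightarrow> complex" where
  "bval t = (SOME w. (cis t, w) \<in> cluster)"

lemma bval: "(cis t, bval t) \<in> cluster"
  unfolding bval_def by (rule someI_ex) (metis cluster_exists norm_cis)

lemma bval_cong: "cis s = cis t \<Longrightarrow> bval s = bval t"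
  by (simp add: bval_def)

lemma cis_periodic: "cis (t + 2 * pi) = cis t"
  by (simp flip: cis_mult)

text \<open>The interval is open so that the property survives a limit in which its ends move: x and
  y strictly inside the limit interval are eventually inside the approximating ones.\<close>

definition decreasing_on :: "complex \<Rightarrow> real set \<Rightarrow> real \<Rightarrow> real \<Rightarrow> bool" where
  "decreasing_on a E p q \<longleftrightarrow>
     (\<forall>x\<in>E. \<forall>y\<in>E. p < x \<longrightarrow> x < y \<longrightarrow> y < q \<longrightarrow> Re (a * bval y) \<le> Re (a * bval x))"

text \<open>Let i be maximal and i + n minimal. An ascent from k to l on the arc between them gives,
  at the mean level, the forbidden pattern above, below, above, below at i, k, l, i + n; the other
  arc is symmetric.\<close>

lemma discrete_antipodal:
  obtains a t where "norm a = 1" "0 \<le> t" "t \<le> 2 * pi"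
    "decreasing_on a (dyadic_angles m) t (t + pi)"
    "decreasing_on (- a) (dyadic_angles m) (t + pi) (t + 2 * pi)"
proof -
  define n :: int where "n = 2 ^ m"
  have n: "n > 0" by (simp add: n_def)
  define A where "A k = pi * of_int k / of_int n" for k
  have A: "dyadic_angles m = range A" by (simp add: dyadic_angles_def A_def n_def)
  have A_less: "A i < A j \<longleftrightarrow> i < j" for i j using n by (simp add: A_def divide_less_cancel)
  have A_add: "A (i + n) = A i + pi" "A (i + 2 * n) = A i + 2 * pi" for i
    using n by (simp_all add: A_def field_simps)
  define F where "F k = bval (A k)" for k
  have Fper: "F (i + 2 * n) = F i" for i
    unfolding F_def A_add by (rule bval_cong[OF cis_periodic])
  have alt: False if "norm a = 1" "i1 < i2" "i2 < i3" "i3 < i4" "i4 < i1 + 2 * n"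
    "c < Re (a * F i1)" "Re (a * F i2) < c" "c < Re (a * F i3)" "Re (a * F i4) < c" for a c i1 i2 i3 i4
  proof -
    have "A i1 < A i2" "A i2 < A i3" "A i3 < A i4" "A i4 < A i1 + 2 * pi"
      using that by (simp_all add: A_less flip: A_add)
    then show False
      using no_alternation[OF that(1), of "A i1" "A i2" "A i3" "A i4"] that bval unfolding F_def by blast
  qed
  obtain a i0 where a: "norm a = 1" and max0: "\<And>k. Re (a * F k) \<le> Re (a * F i0)"
    and min0: "\<And>k. Re (a * F (i0 + n)) \<le> Re (a * F k)"
    by (rule antipodal_extrema[where F = F and n = n]) (rule n Fper | erule (8) alt | blast)+
  \<comment> \<open>Reduction modulo the period keeps the angle in [0, 2 pi], which the compactness
    argument over all levels needs.\<close>
  define i where "i = i0 mod (2 * n)"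
  have per': "F (i + 2 * n * k) = F i" for i k
    by (rule periodic_int_multiple) (rule Fper)
  have i0: "i0 = i + 2 * n * (i0 div (2 * n))" by (simp add: i_def)
  have Fi: "F i = F i0" "F (i + n) = F (i0 + n)"
  proof -
    have "i0 + n = i + n + 2 * n * (i0 div (2 * n))" using i0 by linarith
    then show "F (i + n) = F (i0 + n)" using per'[of "i + n" "i0 div (2 * n)"] by metis
    show "F i = F i0" using per'[of i "i0 div (2 * n)"] i0 by metis
  qed
  have max: "Re (a * F k) \<le> Re (a * F i)" and min: "Re (a * F (i + n)) \<le> Re (a * F k)" for k
    using max0[of k] min0[of k] unfolding Fi by auto
  have i: "0 \<le> i" "i < 2 * n" using n by (auto simp: i_def)
  have desc: "Re (a * F l) \<le> Re (a * F k)" if "i < k" "k < l" "l < i + n" for k l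
  proof (rule ccontr)
    assume nt: "\<not> ?thesis"
    define c where "c = (Re (a * F l) + Re (a * F k)) / 2"
    have "Re (a * F k) < c" "c < Re (a * F l)" using nt unfolding c_def by (simp_all del: times_complex.sel)
    then show False using alt[OF a, of i k l "i + n" c] that max[of l] min[of k] n by (auto simp del: times_complex.sel)
  qed
  have asc: "Re (a * F k) \<le> Re (a * F l)" if "i + n < k" "k < l" "l < i + 2 * n" for k l
  proof (rule ccontr)
    assume nt: "\<not> ?thesis"
    define c where "c = (Re (a * F l) + Re (a * F k)) / 2"
    have "Re (a * F l) < c" "c < Re (a * F k)" using nt unfolding c_def by (simp_all del: times_complex.sel)
    then show False using alt[OF a, of i "i + n" k l c] that max[of k] min[of l] n by (auto simp del: times_complex.sel)
  qed
  show ?thesis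
  proof
    show "norm a = 1" by fact
    show "0 \<le> A i" "A i \<le> 2 * pi" using i n by (auto simp: A_def field_simps)
    show "decreasing_on a (dyadic_angles m) (A i) (A i + pi)"
      unfolding decreasing_on_def A using desc
      by (auto simp: A_less F_def simp del: times_complex.sel simp flip: A_add)
    have "Re (- a * w) = - Re (a * w)" for w by simp
    then show "decreasing_on (- a) (dyadic_angles m) (A i + pi) (A i + 2 * pi)"
      unfolding decreasing_on_def A using asc
      by (auto simp: A_less F_def simp del: times_complex.sel simp flip: A_add)
  qed
qed

text \<open>The pairs of direction and angle lie in a compact set. Since the grids are nested, two
  fixed grid points belong to every sufficiently fine grid, so the inequality between them passes to
  the limit.\<close>

lemma dense_antipodal:
  obtains a t where "norm a = 1"
    "decreasing_on a (\<Union>m. dyadic_angles m) t (t + pi)"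
    "decreasing_on (- a) (\<Union>m. dyadic_angles m) (t + pi) (t + 2 * pi)"
proof -
  have "\<exists>p::complex \<times> real. norm (fst p) = 1 \<and> 0 \<le> snd p \<and> snd p \<le> 2 * pi \<and>
      decreasing_on (fst p) (dyadic_angles m) (snd p) (snd p + pi) \<and>
      decreasing_on (- fst p) (dyadic_angles m) (snd p + pi) (snd p + 2 * pi)" for m
    by (rule discrete_antipodal[of m]) auto
  then obtain p :: "nat \<Rightarrow> complex \<times> real" where p: "\<And>m. norm (fst (p m)) = 1"
      "\<And>m. 0 \<le> snd (p m)" "\<And>m. snd (p m) \<le> 2 * pi"
      "\<And>m. decreasing_on (fst (p m)) (dyadic_angles m) (snd (p m)) (snd (p m) + pi)"
      "\<And>m. decreasing_on (- fst (p m)) (dyadic_angles m) (snd (p m) + pi) (snd (p m) + 2 * pi)"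
    by metis
  have "p m \<in> sphere 0 1 \<times> {0..2 * pi}" for m using p[of m] by (auto simp: mem_Times_iff)
  moreover have "seq_compact (sphere (0::complex) 1 \<times> {0..2 * pi})"
    by (intro compact_imp_seq_compact compact_Times) auto
  ultimately obtain l r where l: "l \<in> sphere 0 1 \<times> {0..2 * pi}" and r: "strict_mono (r :: nat \<Rightarrow> nat)"
    and lim: "(p \<circ> r) \<longlonglongrightarrow> l"
    unfolding seq_compact_def by meson
  obtain a t where at: "l = (a, t)" by fastforce
  have lima: "(\<lambda>j. fst (p (r j))) \<longlonglongrightarrow> a" and limt: "(\<lambda>j. snd (p (r j))) \<longlonglongrightarrow> t"
    using tendsto_fst[OF lim] tendsto_snd[OF lim] by (simp_all add: at o_def)
  have *: "decreasing_on (\<sigma> * a) (\<Union>m. dyadic_angles m) (t + u) (t + v)"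
    if dec: "\<And>m. decreasing_on (\<sigma> * fst (p m)) (dyadic_angles m) (snd (p m) + u) (snd (p m) + v)" for \<sigma> u v
    unfolding decreasing_on_def
  proof (intro ballI impI)
    fix x y assume xy: "x \<in> (\<Union>m. dyadic_angles m)" "y \<in> (\<Union>m. dyadic_angles m)" "t + u < x" "x < y" "y < t + v"
    then obtain m1 m2 where m: "x \<in> dyadic_angles m1" "y \<in> dyadic_angles m2" by blast
    have e1: "\<forall>\<^sub>F j in sequentially. snd (p (r j)) + u < x"
      using xy by (intro order_tendstoD(2)[OF tendsto_add[OF limt tendsto_const]])
    have e2: "\<forall>\<^sub>F j in sequentially. y < snd (p (r j)) + v"
      using xy by (intro order_tendstoD(1)[OF tendsto_add[OF limt tendsto_const]])
    have e3: "\<forall>\<^sub>F j in sequentially. max m1 m2 \<le> r j"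
      using filterlim_subseq[OF r] unfolding filterlim_at_top by blast
    have "\<forall>\<^sub>F j in sequentially. Re (\<sigma> * fst (p (r j)) * bval y) \<le> Re (\<sigma> * fst (p (r j)) * bval x)"
      using e1 e2 e3
    proof eventually_elim
      case (elim j)
      have "x \<in> dyadic_angles (r j)" "y \<in> dyadic_angles (r j)"
        using m elim dyadic_angles_mono[of m1 "r j"] dyadic_angles_mono[of m2 "r j"] by auto
      then show ?case using dec[of "r j"] xy elim unfolding decreasing_on_def by blast
    qed
    then show "Re (\<sigma> * a * bval y) \<le> Re (\<sigma> * a * bval x)"
      by (rule tendsto_le[OF sequentially_bot, rotated 2]) (intro tendsto_intros lima)+
  qed
  show ?thesis
  proof
    show "norm a = 1" using l at by auto
    show "decreasing_on a (\<Union>m. dyadic_angles m) t (t + pi)" using *[of 1 0 pi] p by simp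
    show "decreasing_on (- a) (\<Union>m. dyadic_angles m) (t + pi) (t + 2 * pi)"
      using *[of "-1" pi "2 * pi"] p by simp
  qed
qed

text \<open>A cluster value below c at x brings a second boundary point with a value below c. Grid
  points with values above c just before and just after x then separate these two low points, which
  is an alternation.\<close>

lemma cluster_ge:
  assumes a: "norm a = 1" and x: "p < x" "x < q" "(cis x, w) \<in> cluster"
    and gt: "\<And>u m. u \<in> dyadic_angles m \<Longrightarrow> p < u \<Longrightarrow> u < q \<Longrightarrow> c < Re (a * bval u)"
  shows "c \<le> Re (a * w)"
proof (rule ccontr)
  have neg: "Re (- a * w) = - Re (a * w)" for w by simp
  assume "\<not> ?thesis"
  then have lt: "Re (a * w) < c" by simp
  then have "- c < Re (- a * w)" unfolding neg by simp
  then obtain \<zeta> w' where \<zeta>: "norm \<zeta> = 1" "\<zeta> \<noteq> cis x" "(\<zeta>, w') \<in> cluster" "- c < Re (- a * w')"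
    using second_cluster_point[of "- a" "cis x" w "- c"] a x by auto
  \<comment> \<open>The second point is written with its angle in (x, x + 2 pi), so that the cyclic
    order becomes a linear one.\<close>
  define z where "z = x + Arg2pi (\<zeta> / cis x)"
  have "\<zeta> / cis x = cis (Arg2pi (\<zeta> / cis x))"
    using Arg2pi_eq[of "\<zeta> / cis x"] \<zeta> by (simp add: norm_divide cis_conv_exp)
  then have "\<zeta> = cis x * cis (Arg2pi (\<zeta> / cis x))" by (metis cis_neq_zero nonzero_eq_divide_eq mult.commute)
  then have "\<zeta> = cis z" by (simp add: z_def cis_mult)
  moreover have "z \<noteq> x" using \<zeta> \<open>\<zeta> = cis z\<close> by auto
  ultimately have z: "x < z" "z < x + 2 * pi" "(cis z, w') \<in> cluster" "Re (a * w') < c"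
    using Arg2pi[of "\<zeta> / cis x"] \<zeta> unfolding neg by (auto simp: z_def order_less_le)
  \<comment> \<open>The bound z - 2 pi < u1 is the closing inequality of the cyclic quadruple u1, x,
    u2, z.\<close>
  obtain u1 m1 where u1: "u1 \<in> dyadic_angles m1" "max p (z - 2 * pi) < u1" "u1 < x"
    using dyadic_angles_dense[of "max p (z - 2 * pi)" x] x z by auto
  obtain u2 m2 where u2: "u2 \<in> dyadic_angles m2" "x < u2" "u2 < min q z"
    using dyadic_angles_dense[of x "min q z"] x z by auto
  show False
    using no_alternation[OF a, of u1 x u2 z "bval u1" w "bval u2" w' c] u1 u2 x z lt bval
      gt[OF u1(1)] gt[OF u2(1)] by auto
qed

text \<open>A dyadic angle u between x and y mediates: its selected value bounds every cluster value
  at x from below and every one at y from above. The slack e makes the grid inequalities strict, as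
  \<open>cluster_ge\<close> asks.\<close>

lemma decreasing_cluster:
  assumes a: "norm a = 1" and dec: "decreasing_on a (\<Union>m. dyadic_angles m) p q"
    and xy: "p < x" "x < y" "y < q" "(cis x, w) \<in> cluster" "(cis y, w') \<in> cluster"
  shows "Re (a * w') \<le> Re (a * w)"
proof -
  have neg: "Re (- a * w) = - Re (a * w)" for w by simp
  obtain u m where u: "u \<in> dyadic_angles m" "x < u" "u < y" using dyadic_angles_dense xy by blast
  have "Re (a * bval u) - e \<le> Re (a * w)" if "e > 0" for e
  proof (rule cluster_ge[OF a xy(1) u(2) xy(4)])
    fix v k assume "v \<in> dyadic_angles k" "p < v" "v < u"
    then have "Re (a * bval u) \<le> Re (a * bval v)"
      using dec u xy unfolding decreasing_on_def by (meson UNIV_I UN_I order.strict_trans)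
    then show "Re (a * bval u) - e < Re (a * bval v)" using that by linarith
  qed
  then have 1: "Re (a * bval u) \<le> Re (a * w)" by (meson diff_le_eq field_le_epsilon)
  have "Re (- a * bval u) - e \<le> Re (- a * w')" if "e > 0" for e
  proof (rule cluster_ge[OF _ u(3) xy(3,5)])
    fix v k assume "v \<in> dyadic_angles k" "u < v" "v < q"
    then have "Re (a * bval v) \<le> Re (a * bval u)"
      using dec u xy unfolding decreasing_on_def by (meson UNIV_I UN_I order.strict_trans)
    then show "Re (- a * bval u) - e < Re (- a * bval v)" using that unfolding neg by linarith
  qed (use a in simp)
  then have "Re (- a * bval u) \<le> Re (- a * w')" by (meson diff_le_eq field_le_epsilon)
  then show ?thesis using 1 unfolding neg by linarith
qed

end

section \<open>Monotonicity under the hyperbolic flow\<close>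

text \<open>For 0 < s < 1 this is the hyperbolic automorphism of the disc with repelling fixed point
  -1 and attracting fixed point 1. Its derivative in s at 0 is 1 - z^2.\<close>

definition hyperbolic_flow :: "real \<Rightarrow> complex \<Rightarrow> complex" where
  "hyperbolic_flow s z = (z + of_real s) / (1 + of_real s * z)"

lemma flow_denom_nonzero:
  fixes z :: complex
  assumes "0 < s" "s < 1" "norm z \<le> 1"
  shows "1 + of_real s * z \<noteq> 0"
proof
  assume "1 + of_real s * z = 0"
  then have "of_real s * z = -1" using add_eq_0_iff by blast
  then have "norm (of_real s * z) = 1" by (metis norm_minus_cancel norm_one)
  then have "s * norm z = 1" using assms by (simp add: norm_mult)
  moreover have "s * norm z \<le> s * 1" using assms by (intro mult_left_mono) auto
  ultimately show False using assms by simp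
qed

text \<open>One identity yields both that the disc is mapped into itself and that the circle is
  preserved.\<close>

lemma flow_norm_identity:
  fixes z :: complex
  shows "(norm (1 + of_real s * z))\<^sup>2 - (norm (z + of_real s))\<^sup>2 = (1 - s\<^sup>2) * (1 - (norm z)\<^sup>2)"
  unfolding cmod_power2 by (simp add: power2_eq_square algebra_simps)

lemma hyperbolic_flow_in_ball:
  assumes "0 < s" "s < 1" "z \<in> ball 0 1"
  shows "hyperbolic_flow s z \<in> ball 0 1"
proof -
  have ne: "1 + of_real s * z \<noteq> 0" by (rule flow_denom_nonzero) (use assms in auto)
  have "(1 - s\<^sup>2) * (1 - (norm z)\<^sup>2) > 0"
    using assms power_strict_mono[of s 1 2] power_strict_mono[of "norm z" 1 2]
    by (intro mult_pos_pos) simp_all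
  then have "(norm (z + of_real s))\<^sup>2 < (norm (1 + of_real s * z))\<^sup>2"
    using flow_norm_identity[of s z] by linarith
  then have "norm (z + of_real s) < norm (1 + of_real s * z)"
    by (rule power_less_imp_less_base) simp
  then show ?thesis using ne by (simp add: hyperbolic_flow_def norm_divide)
qed

text \<open>With d = |1 + s z|^2 = 1 + 2 s Re z + s^2, the imaginary part is multiplied by the
  positive number (1 - s^2) / d and the real part grows by 2 s (1 - (Re z)^2) / d. So points move
  towards 1 within their own open semicircle.\<close>

lemma hyperbolic_flow_on_circle:
  assumes s: "0 < s" "s < 1" and z: "norm z = 1" "Im z \<noteq> 0"
  shows "norm (hyperbolic_flow s z) = 1" "sgn (Im (hyperbolic_flow s z)) = sgn (Im z)"
    "Re z < Re (hyperbolic_flow s z)"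
proof -
  have ne: "1 + of_real s * z \<noteq> 0" by (rule flow_denom_nonzero) (use assms in auto)
  define d where "d = (norm (1 + of_real s * z))\<^sup>2"
  have d: "d > 0" using ne by (simp add: d_def)
  have xy: "(Re z)\<^sup>2 + (Im z)\<^sup>2 = 1" using z(1) cmod_power2[of z] by simp
  have dd: "d = 1 + 2 * s * Re z + s\<^sup>2"
  proof -
    have "d = (1 + s * Re z)\<^sup>2 + (s * Im z)\<^sup>2" unfolding d_def cmod_power2 by simp
    also have "\<dots> = 1 + 2 * s * Re z + s\<^sup>2 * ((Re z)\<^sup>2 + (Im z)\<^sup>2)"
      by (simp add: power2_eq_square algebra_simps)
    finally show ?thesis by (simp add: xy)
  qed
  have fl: "hyperbolic_flow s z = (z + of_real s) * cnj (1 + of_real s * z) / of_real d"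
    unfolding hyperbolic_flow_def d_def by (subst complex_div_cnj) simp
  have I: "Im (hyperbolic_flow s z) = (1 - s\<^sup>2) * Im z / d"
    unfolding fl Im_divide_of_real by (simp add: power2_eq_square algebra_simps)
  have "Re ((z + of_real s) * cnj (1 + of_real s * z)) =
      (1 + s\<^sup>2) * Re z + s + s * ((Re z)\<^sup>2 + (Im z)\<^sup>2)"
    by (simp add: power2_eq_square algebra_simps)
  then have R: "Re (hyperbolic_flow s z) = ((1 + s\<^sup>2) * Re z + 2 * s) / d"
    unfolding fl Re_divide_of_real xy by simp
  show "norm (hyperbolic_flow s z) = 1"
  proof -
    have "norm (z + of_real s) = norm (1 + of_real s * z)"
      using flow_norm_identity[of s z] z by simp
    then show ?thesis using ne by (simp add: hyperbolic_flow_def norm_divide)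
  qed
  have "(1 - s\<^sup>2) > 0" using s power_strict_mono[of s 1 2] by simp
  then show "sgn (Im (hyperbolic_flow s z)) = sgn (Im z)"
    unfolding I using d by (simp add: sgn_divide sgn_mult)
  have "(Re z)\<^sup>2 < 1" using xy z(2) by (smt (verit) zero_less_power2)
  then have "2 * s * (1 - (Re z)\<^sup>2) > 0" using s by simp
  then have "Re z * d < (1 + s\<^sup>2) * Re z + 2 * s"
    unfolding dd by (simp add: power2_eq_square algebra_simps)
  then show "Re z < Re (hyperbolic_flow s z)" unfolding R using d by (simp add: less_divide_eq)
qed

lemma hyperbolic_flow_holomorphic:
  assumes "0 < s" "s < 1"
  shows "hyperbolic_flow s holomorphic_on ball 0 1"
  unfolding hyperbolic_flow_def[abs_def]
  by (intro holomorphic_intros flow_denom_nonzero) (use assms in auto)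

lemma circle_angle:
  assumes "norm \<xi> = 1" "Im \<xi> \<noteq> 0"
  obtains x where "\<xi> = cis x" "0 < x" "x < 2 * pi" "Im \<xi> > 0 \<Longrightarrow> x < pi" "Im \<xi> < 0 \<Longrightarrow> pi < x"
proof
  define x where "x = Arg2pi \<xi>"
  show \<xi>: "\<xi> = cis x" using Arg2pi_eq[of \<xi>] assms by (simp add: x_def cis_conv_exp)
  have "x \<noteq> 0" using assms \<xi> by auto
  then show x: "0 < x" "x < 2 * pi" using Arg2pi[of \<xi>] by (auto simp: x_def order_less_le)
  show "x < pi" if "Im \<xi> > 0"
    using that sin_le_zero[of x] x \<xi> by (force simp: not_less)
  show "pi < x" if "Im \<xi> < 0"
    using that sin_ge_zero[of x] x \<xi> by (force simp: not_less)
qed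

context bounded_convex_harmonic
begin

text \<open>After rotation by b the two monotone arcs are the open upper and lower semicircles, and
  the flow moves every point of either in the direction in which Re (a f) does not decrease. The
  comparison of cluster values is then carried into the disc.\<close>

lemma flow_monotone:
  obtains a b where "norm a = 1" "norm b = 1"
    "\<And>s z. 0 < s \<Longrightarrow> s < 1 \<Longrightarrow> z \<in> ball 0 1 \<Longrightarrow>
      Re (a * f (b * z)) \<le> Re (a * f (b * hyperbolic_flow s z))"
proof -
  obtain a t where a: "norm a = 1"
    and dec: "decreasing_on a (\<Union>m. dyadic_angles m) t (t + pi)"
    and inc: "decreasing_on (- a) (\<Union>m. dyadic_angles m) (t + pi) (t + 2 * pi)"
    by (rule dense_antipodal)
  define b where "b = cis t"
  have neg: "Re (- a * w) = - Re (a * w)" for w by simp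
  have b: "b * z \<in> ball 0 1" if "z \<in> ball 0 1" for z using that by (simp add: b_def norm_mult)
  have bdry: "Re (a * w) \<le> Re (a * w')"
    if s: "0 < s" "s < 1" and \<xi>: "norm \<xi> = 1" "Im \<xi> \<noteq> 0"
      and w: "(b * \<xi>, w) \<in> cluster" "(b * hyperbolic_flow s \<xi>, w') \<in> cluster" for s \<xi> w w'
  proof -
    define \<eta> where "\<eta> = hyperbolic_flow s \<xi>"
    have \<eta>: "norm \<eta> = 1" "sgn (Im \<eta>) = sgn (Im \<xi>)" "Re \<xi> < Re \<eta>"
      using hyperbolic_flow_on_circle[OF s \<xi>] by (simp_all add: \<eta>_def)
    then have \<eta>0: "Im \<eta> \<noteq> 0" using \<xi> by (auto simp: sgn_0_0)
    obtain x where x: "\<xi> = cis x" "0 < x" "x < 2 * pi" "Im \<xi> > 0 \<Longrightarrow> x < pi" "Im \<xi> < 0 \<Longrightarrow> pi < x"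
      using circle_angle[OF \<xi>] by blast
    obtain y where y: "\<eta> = cis y" "0 < y" "y < 2 * pi" "Im \<eta> > 0 \<Longrightarrow> y < pi" "Im \<eta> < 0 \<Longrightarrow> pi < y"
      using circle_angle[OF \<eta>(1) \<eta>0] by blast
    have cos: "cos x < cos y" using \<eta>(3) x y by simp
    have cl: "(cis (t + x), w) \<in> cluster" "(cis (t + y), w') \<in> cluster"
    proof -
      have "b * \<xi> = cis (t + x)" by (simp add: b_def x(1) cis_mult)
      moreover have "b * hyperbolic_flow s \<xi> = cis (t + y)"
        using y(1) by (simp add: b_def \<eta>_def cis_mult)
      ultimately show "(cis (t + x), w) \<in> cluster" "(cis (t + y), w') \<in> cluster"
        using w by (simp_all only:)
    qed
    show ?thesis
    proof (cases "Im \<xi> > 0")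
      case True
      then have "Im \<eta> > 0" using \<eta>(2) by (metis sgn_greater)
      then have "x < pi" "y < pi" using True x y by auto
      then have "y < x" using cos x y by (subst (asm) cos_mono_less_eq) auto
      then show ?thesis
        using decreasing_cluster[OF a dec _ _ _ cl(2,1)] x y \<open>x < pi\<close> by simp
    next
      case False
      then have I: "Im \<xi> < 0" using \<xi> by simp
      then have "Im \<eta> < 0" using \<eta>(2) by (metis sgn_less)
      then have pi: "pi < x" "pi < y" using I x y by auto
      have "cos (2 * pi - x) < cos (2 * pi - y)" using cos by (simp add: cos_diff)
      then have "x < y" using x y pi by (subst (asm) cos_mono_less_eq) auto
      then have "Re (- a * w') \<le> Re (- a * w)"
        using decreasing_cluster[OF _ inc _ _ _ cl] a x y pi by simp
      then show ?thesis unfolding neg by simp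
    qed
  qed
  show ?thesis
  proof
    show "norm a = 1" by fact
    show "norm b = 1" by (simp add: b_def)
    fix s :: real and z :: complex assume s: "0 < s" "s < 1" and z: "z \<in> ball 0 1"
    define T where "T = hyperbolic_flow s"
    have T: "T z \<in> ball 0 1" if "z \<in> ball 0 1" for z
      using hyperbolic_flow_in_ball[OF s that] by (simp add: T_def)
    define \<Psi> where "\<Psi> z = part a (b * z) - part a (b * T z)" for z
    have Re\<Psi>: "Re (\<Psi> z) = Re (a * f (b * z)) - Re (a * f (b * T z))" if "z \<in> ball 0 1" for z
      unfolding \<Psi>_def minus_complex.sel Re_part[OF b[OF that]] Re_part[OF b[OF T[OF that]]] ..
    have "Re (\<Psi> z) \<le> 0"
    \<comment> \<open>The factor 1 - z^2 vanishes exactly at the fixed points of the flow, the only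
      boundary points not covered by \<open>bdry\<close>.\<close>
    proof (rule Re_le_0_by_boundary_limits[where \<Psi> = \<Psi> and e = "\<lambda>z. 1 - z\<^sup>2" and B = "2 * K"])
      have "part a \<circ> (\<lambda>z. b * z) holomorphic_on ball 0 1"
        by (rule holomorphic_on_compose_gen[OF _ holomorphic_part]) (use b in \<open>auto intro!: holomorphic_intros\<close>)
      moreover have "part a \<circ> (\<lambda>z. b * T z) holomorphic_on ball 0 1"
        by (rule holomorphic_on_compose_gen[OF _ holomorphic_part])
          (use b T hyperbolic_flow_holomorphic[OF s] in \<open>auto intro!: holomorphic_intros simp: T_def\<close>)
      ultimately show "\<Psi> holomorphic_on ball 0 1"
        unfolding \<Psi>_def o_def by (intro holomorphic_intros)
      show "\<bar>Re (\<Psi> z)\<bar> \<le> 2 * K" if "z \<in> ball 0 1" for z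
        using Re\<Psi>[OF that] Re_bound[OF a bound[OF b[OF that]]] Re_bound[OF a bound[OF b[OF T[OF that]]]]
        by linarith
      show "(\<lambda>z. 1 - z\<^sup>2) holomorphic_on UNIV" by (intro holomorphic_intros)
      show "norm (1 - z\<^sup>2) \<le> 2" if "norm z \<le> 1" for z :: complex
        using norm_triangle_ineq4[of 1 "z\<^sup>2"] that power_le_one[of "norm z" 2] by (simp add: norm_power)
      show "1 - z\<^sup>2 \<noteq> 0" if "z \<in> ball 0 1" for z :: complex
        using that by (auto simp: power2_eq_1_iff)
      fix x \<xi> L
      assume x: "\<And>n::nat. x n \<in> ball 0 1" "x \<longlonglongrightarrow> \<xi>" "norm \<xi> = 1" "1 - \<xi>\<^sup>2 \<noteq> 0"
        "(\<lambda>n. Re (\<Psi> (x n))) \<longlonglongrightarrow> L"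
      have "Im \<xi> \<noteq> 0"
      proof
        assume "Im \<xi> = 0"
        then have "(Re \<xi>)\<^sup>2 = 1" using x(3) cmod_power2[of \<xi>] by simp
        then have "\<xi>\<^sup>2 = 1" using \<open>Im \<xi> = 0\<close> by (simp add: complex_eq_iff power2_eq_square)
        then show False using x by simp
      qed
      \<comment> \<open>Two successive subsequences make the values at the points and at their
        images under the flow converge simultaneously.\<close>
      obtain r w where r: "strict_mono (r :: nat \<Rightarrow> nat)" "(\<lambda>n. f (b * x (r n))) \<longlonglongrightarrow> w"
        using cluster_subseq[of "\<lambda>n. b * x n"] b x(1) by blast
      obtain r' w' where r': "strict_mono (r' :: nat \<Rightarrow> nat)" "(\<lambda>n. f (b * T (x (r (r' n))))) \<longlonglongrightarrow> w'"
        using cluster_subseq[of "\<lambda>n. b * T (x (r n))"] b T x(1) by blast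
      define y where "y n = x (r (r' n))" for n
      have y: "\<And>n. y n \<in> ball 0 1" using x by (simp add: y_def)
      have y\<xi>: "y \<longlonglongrightarrow> \<xi>"
        using LIMSEQ_subseq_LIMSEQ[OF LIMSEQ_subseq_LIMSEQ[OF x(2) r(1)] r'(1)]
        by (simp add: y_def[abs_def] o_def)
      have yL: "(\<lambda>n. Re (\<Psi> (y n))) \<longlonglongrightarrow> L"
        using LIMSEQ_subseq_LIMSEQ[OF LIMSEQ_subseq_LIMSEQ[OF x(5) r(1)] r'(1)]
        by (simp add: y_def[abs_def] o_def)
      have yw: "(\<lambda>n. f (b * y n)) \<longlonglongrightarrow> w"
        using LIMSEQ_subseq_LIMSEQ[OF r(2) r'(1)] by (simp add: y_def[abs_def] o_def)
      have yw': "(\<lambda>n. f (b * T (y n))) \<longlonglongrightarrow> w'" using r'(2) by (simp add: y_def)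
      have "1 + of_real s * \<xi> \<noteq> 0" by (rule flow_denom_nonzero[OF s]) (simp add: x(3))
      then have "(\<lambda>n. b * T (y n)) \<longlonglongrightarrow> b * T \<xi>"
        unfolding T_def hyperbolic_flow_def by (intro tendsto_intros y\<xi>)
      then have "(b * T \<xi>, w') \<in> cluster" using clusterI[of "\<lambda>n. b * T (y n)"] b T y yw' by blast
      moreover have "(b * \<xi>, w) \<in> cluster"
        using clusterI[of "\<lambda>n. b * y n" "b * \<xi>" w] b y yw tendsto_mult_left[OF y\<xi>] by blast
      ultimately have "Re (a * w) \<le> Re (a * w')"
        using bdry[OF s x(3) \<open>Im \<xi> \<noteq> 0\<close>] by (simp add: T_def del: times_complex.sel)
      moreover have "(\<lambda>n. Re (a * f (b * y n)) - Re (a * f (b * T (y n)))) \<longlonglongrightarrow> Re (a * w) - Re (a * w')"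
        by (intro tendsto_intros yw yw')
      then have "(\<lambda>n. Re (\<Psi> (y n))) \<longlonglongrightarrow> Re (a * w) - Re (a * w')"
        unfolding Re\<Psi>[OF y] .
      then have "L = Re (a * w) - Re (a * w')" using LIMSEQ_unique yL by blast
      ultimately show "L \<le> 0" by linarith
    qed (rule z)
    then show "Re (a * f (b * z)) \<le> Re (a * f (b * hyperbolic_flow s z))"
      using Re\<Psi>[OF z] unfolding T_def by linarith
  qed
qed

end

section \<open>Exhaustion of the disc for unbounded maps\<close>

lemma normalized_Riemann_map:
  assumes S: "open S" "simply_connected S" "0 \<in> S" "S \<noteq> UNIV"
  obtains \<psi> \<omega> where "\<psi> holomorphic_on ball 0 1" "\<omega> holomorphic_on S" "\<psi> 0 = 0" "\<omega> 0 = 0"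
    "\<And>z. z \<in> ball 0 1 \<Longrightarrow> \<psi> z \<in> S" "\<And>z. z \<in> ball 0 1 \<Longrightarrow> \<omega> (\<psi> z) = z"
    "\<And>z. z \<in> S \<Longrightarrow> \<omega> z \<in> ball 0 1" "\<And>z. z \<in> S \<Longrightarrow> \<psi> (\<omega> z) = z"
proof -
  obtain F G where F: "F holomorphic_on S" and G: "G holomorphic_on ball 0 1"
    and FG: "\<forall>z\<in>S. F z \<in> ball 0 1 \<and> G (F z) = z" and GF: "\<forall>z\<in>ball 0 1. G z \<in> S \<and> F (G z) = z"
    using Riemann_mapping_theorem[of S] S by auto
  have "F 0 \<in> ball 0 1" using FG S by blast
  obtain p q where p: "p (F 0) = 0" "p holomorphic_on ball 0 1" "p ` ball 0 1 \<subseteq> ball 0 1"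
    and q: "q holomorphic_on ball 0 1" "q ` ball 0 1 \<subseteq> ball 0 1"
    and pq: "\<And>z. z \<in> ball 0 1 \<Longrightarrow> p (q z) = z" "\<And>z. z \<in> ball 0 1 \<Longrightarrow> q (p z) = z"
    using ball_biholomorphism_exists[OF \<open>F 0 \<in> ball 0 1\<close>] by blast
  have q0: "q 0 = F 0" using pq(2)[OF \<open>F 0 \<in> ball 0 1\<close>] p(1) by simp
  show ?thesis
  proof
    show "G \<circ> q holomorphic_on ball 0 1" using q G by (intro holomorphic_on_compose_gen)
    show "p \<circ> F holomorphic_on S" using F p FG by (intro holomorphic_on_compose_gen) auto
    show "(G \<circ> q) 0 = 0" using q0 FG S by simp
    show "(p \<circ> F) 0 = 0" using p by simp
    fix z :: complex assume z: "z \<in> ball 0 1"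
    then have "q z \<in> ball 0 1" using q by blast
    then show "(G \<circ> q) z \<in> S" "(p \<circ> F) ((G \<circ> q) z) = z"
      using GF pq(1)[OF z] by (simp_all add: o_def)
  next
    fix z assume z: "z \<in> S"
    then have "F z \<in> ball 0 1" using FG by blast
    then show "(p \<circ> F) z \<in> ball 0 1" "(G \<circ> q) ((p \<circ> F) z) = z"
      using FG z subsetD[OF p(3) imageI[of "F z"]] pq(2)[of "F z"] by (simp_all add: o_def)
  qed
qed

text \<open>The Schwarz lemma for \<open>\<psi>\<close> gives the upper bound. Applied to the
  inverse restricted to \<open>ball 0 \<rho>\<close> and rescaled, it bounds the inverse derivative
  by 1 / \<rho>; the two derivatives have product 1.\<close>

lemma deriv_normalized_Riemann_map:
  assumes \<psi>: "\<psi> holomorphic_on ball 0 1" "\<psi> 0 = 0" and \<omega>: "\<omega> holomorphic_on S" "\<omega> 0 = 0"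
    and inv: "\<And>z. z \<in> ball 0 1 \<Longrightarrow> \<psi> z \<in> S" "\<And>z. z \<in> S \<Longrightarrow> \<omega> z \<in> ball 0 1" "\<And>z. z \<in> S \<Longrightarrow> \<psi> (\<omega> z) = z"
    and S: "open S" "S \<subseteq> ball 0 1" and \<rho>: "0 < \<rho>" "ball 0 \<rho> \<subseteq> S"
  shows "\<rho> \<le> norm (deriv \<psi> 0)" "norm (deriv \<psi> 0) \<le> 1"
proof -
  have 0: "0 \<in> S" using \<rho> by auto
  show "norm (deriv \<psi> 0) \<le> 1"
    using Schwarz_Lemma(2)[OF \<psi>, of 0] inv(1) S by force
  define k where "k z = \<omega> (of_real \<rho> * z)" for z
  have m: "of_real \<rho> * z \<in> S" if "norm z < 1" for z
    using that \<rho> by (intro subsetD[OF \<rho>(2)]) (simp add: norm_mult)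
  have "\<omega> \<circ> (\<lambda>z. of_real \<rho> * z) holomorphic_on ball 0 1"
    using m by (intro holomorphic_on_compose_gen[OF _ \<omega>(1)] holomorphic_intros) auto
  then have hol: "k holomorphic_on ball 0 1" by (simp add: k_def[abs_def] o_def)
  have "norm (deriv k 0) \<le> 1"
    using Schwarz_Lemma(2)[OF hol, of 0] m inv(2) \<omega> by (force simp: k_def)
  moreover have d\<omega>: "(\<omega> has_field_derivative deriv \<omega> 0) (at 0)"
    using holomorphic_derivI[OF \<omega>(1) S(1) 0] .
  have "(k has_field_derivative deriv \<omega> 0 * (of_real \<rho> * 1)) (at 0)"
    unfolding k_def using d\<omega> by (intro DERIV_chain2[of \<omega>] derivative_eq_intros) auto
  then have "deriv k 0 = deriv \<omega> 0 * of_real \<rho>" by (simp add: DERIV_imp_deriv)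
  ultimately have le: "norm (deriv \<omega> 0) * \<rho> \<le> 1" using \<rho> by (simp add: norm_mult)
  have d\<psi>: "(\<psi> has_field_derivative deriv \<psi> 0) (at 0)"
    using holomorphic_derivI[OF \<psi>(1) open_ball, of 0] by simp
  then have "((\<lambda>z. \<psi> (\<omega> z)) has_field_derivative deriv \<psi> 0 * deriv \<omega> 0) (at 0)"
    using d\<omega> \<omega>(2) by (intro DERIV_chain2[of \<psi>]) auto
  moreover have "((\<lambda>z. \<psi> (\<omega> z)) has_field_derivative 1) (at 0)"
    using DERIV_ident S(1) 0 by (rule has_field_derivative_transform_within_open) (use inv in auto)
  ultimately have "deriv \<psi> 0 * deriv \<omega> 0 = 1" by (rule DERIV_unique)
  then have "norm (deriv \<psi> 0) * norm (deriv \<omega> 0) = 1" by (metis norm_mult norm_one)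
  moreover have "norm (deriv \<psi> 0) * (norm (deriv \<omega> 0) * \<rho>) \<le> norm (deriv \<psi> 0) * 1"
    using le by (intro mult_left_mono) auto
  ultimately show "\<rho> \<le> norm (deriv \<psi> 0)" by (simp add: mult.assoc[symmetric])
qed

text \<open>By Montel a subsequence converges locally uniformly, and the limit fixes 0 with
  derivative of modulus 1 there; the equality case of the Schwarz lemma makes it a rotation.\<close>

lemma Schwarz_limit:
  assumes hol: "\<And>n. \<psi> n holomorphic_on ball 0 1" and 0: "\<And>n. \<psi> n 0 = 0"
    and le: "\<And>n z. z \<in> ball 0 1 \<Longrightarrow> norm (\<psi> n z) < 1"
    and d: "(\<lambda>n. norm (deriv (\<psi> n) 0)) \<longlonglongrightarrow> 1"
  obtains r \<kappa> where "strict_mono (r :: nat \<Rightarrow> nat)" "norm \<kappa> = 1"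
    "\<And>K. compact K \<Longrightarrow> K \<subseteq> ball 0 1 \<Longrightarrow> uniform_limit K (\<lambda>n. \<psi> (r n)) (\<lambda>z. \<kappa> * z) sequentially"
proof -
  obtain G r where G: "G holomorphic_on ball 0 1" "strict_mono (r :: nat \<Rightarrow> nat)"
    "\<And>x. x \<in> ball 0 1 \<Longrightarrow> (\<lambda>n. \<psi> (r n) x) \<longlonglongrightarrow> G x"
    "\<And>K. compact K \<Longrightarrow> K \<subseteq> ball 0 1 \<Longrightarrow> uniform_limit K (\<psi> \<circ> r) G sequentially"
  proof (rule Montel[of "ball 0 1" "range \<psi>" \<psi>])
    fix K :: "complex set" assume K: "compact K" "K \<subseteq> ball 0 1"
    then show "\<exists>B. \<forall>h\<in>range \<psi>. \<forall>z\<in>K. norm (h z) \<le> B"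
      using le by (intro exI[of _ 1] ballI) (metis imageE less_imp_le subsetD)
  qed (use hol in auto)
  have "(\<lambda>n. (deriv ^^ 1) ((\<psi> \<circ> r) n) 0) \<longlonglongrightarrow> (deriv ^^ 1) G 0"
  proof (rule higher_deriv_complex_uniform_limit)
    show "uniform_limit (ball 0 (1/2)) (\<psi> \<circ> r) G sequentially"
      by (rule uniform_limit_on_subset[OF G(4)[of "cball 0 (1/2)"]]) auto
    show "\<forall>\<^sub>F n in sequentially. (\<psi> \<circ> r) n holomorphic_on ball 0 (1/2)"
      unfolding o_def by (intro always_eventually allI holomorphic_on_subset[OF hol]) auto
  qed auto
  then have "(\<lambda>n. norm (deriv (\<psi> (r n)) 0)) \<longlonglongrightarrow> norm (deriv G 0)"
    by (intro tendsto_norm) simp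
  moreover have "(\<lambda>n. norm (deriv (\<psi> (r n)) 0)) \<longlonglongrightarrow> 1"
    using LIMSEQ_subseq_LIMSEQ[OF d G(2)] by (simp add: o_def)
  ultimately have dG: "norm (deriv G 0) = 1" by (rule LIMSEQ_unique)
  have G0: "G 0 = 0" using G(3)[of 0] 0 LIMSEQ_unique[OF _ tendsto_const] by fastforce
  have Gle: "norm (G z) \<le> 1" if "z \<in> ball 0 1" for z
    by (rule Lim_bounded[OF tendsto_norm[OF G(3)[OF that]], of 0]) (use le that in \<open>auto intro: less_imp_le\<close>)
  \<comment> \<open>Limits only keep the weak inequality. Equality at an interior point would make
    the limit constant, contradicting its value 0 at the origin.\<close>
  have Glt: "norm (G z) < 1" if z: "norm z < 1" for z
  proof (rule ccontr)
    assume "\<not> ?thesis"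
    then have "norm (G z) = 1" using Gle[of z] z by simp
    then have "G constant_on ball 0 1"
      using maximum_modulus_principle[OF G(1) open_ball _ open_ball, of 0 1 z] Gle z by auto
    then have "G z = G 0" using z unfolding constant_on_def by auto
    then show False using \<open>norm (G z) = 1\<close> G0 by simp
  qed
  then obtain \<kappa> where \<kappa>: "\<And>z. norm z < 1 \<Longrightarrow> G z = \<kappa> * z" "norm \<kappa> = 1"
    using Schwarz_Lemma(3)[OF G(1) G0 Glt, of 0] dG by auto
  show ?thesis
  proof
    fix K :: "complex set" assume K: "compact K" "K \<subseteq> ball 0 1"
    show "uniform_limit K (\<lambda>n. \<psi> (r n)) (\<lambda>z. \<kappa> * z) sequentially"
      using G(4)[OF K] \<kappa>(1) K unfolding uniform_limit_iff o_def by (simp add: subset_eq)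
  qed (use G \<kappa> in auto)
qed

text \<open>Intersecting the image with a large disc keeps it convex, and its preimage
  \<open>D n\<close> is simply connected because it is homeomorphic to a convex set. As the
  \<open>D n\<close> swallow every compact part of the disc, their Riemann maps tend to a rotation
  along a subsequence; this rotation is absorbed into b.\<close>

theorem convex_harmonic_flow:
  assumes decomp: "harmonic_decomp (ball 0 1) f h g"
    and inj: "inj_on f (ball 0 1)" and conv: "convex (f ` ball 0 1)"
  obtains a b where "norm a = 1" "norm b = 1"
    "\<And>s z. 0 < s \<Longrightarrow> s < 1 \<Longrightarrow> z \<in> ball 0 1 \<Longrightarrow>
      Re (a * f (b * z)) \<le> Re (a * f (b * hyperbolic_flow s z))"
proof -
  have hol: "h holomorphic_on ball 0 1" "g holomorphic_on ball 0 1"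
    and fhg: "\<And>z. z \<in> ball 0 1 \<Longrightarrow> f z = h z + cnj (g z)"
    using decomp by (auto simp: harmonic_decomp_def)
  have "continuous_on (ball 0 1) (\<lambda>z. h z + cnj (g z))"
    by (intro continuous_intros holomorphic_on_imp_continuous_on hol)
  then have cont: "continuous_on (ball 0 1) f" by (rule continuous_on_eq) (use fhg in auto)
  \<comment> \<open>A radius above |f 0| puts the origin into every \<open>D n\<close>, so that all
    Riemann maps can be normalized there.\<close>
  define c where "c n = norm (f 0) + 1 + real n" for n
  define D where "D n = ball 0 1 \<inter> f -` ball 0 (c n)" for n
  have oD: "open (D n)" for n
    unfolding D_def by (intro continuous_open_preimage cont open_ball)
  have D1: "D n \<subseteq> ball 0 1" for n by (auto simp: D_def)
  have injD: "inj_on f (D n)" for n using inj D1 by (rule inj_on_subset)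
  have fD: "f ` D n = f ` ball 0 1 \<inter> ball 0 (c n)" for n by (auto simp: D_def)
  have convD: "convex (f ` D n)" for n unfolding fD by (intro convex_Int conv convex_ball)
  have scD: "simply_connected (D n)" for n
  proof -
    have "D n homeomorphic f ` D n"
      using invariance_of_domain_homeomorphic[OF oD continuous_on_subset[OF cont D1] _ injD] by auto
    then show ?thesis
      using homeomorphic_simply_connected_eq convex_imp_simply_connected[OF convD] by blast
  qed
  have D0: "0 \<in> D n" for n by (auto simp: D_def c_def)
  have DU: "D n \<noteq> UNIV" for n
    using D1[of n] by (metis UNIV_I dist_0_norm less_irrefl mem_ball norm_one subsetD)
  have "\<exists>\<psi> \<omega>. \<psi> holomorphic_on ball 0 1 \<and> \<omega> holomorphic_on D n \<and> \<psi> 0 = 0 \<and> \<omega> 0 = 0 \<and>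
    (\<forall>z\<in>ball 0 1. \<psi> z \<in> D n \<and> \<omega> (\<psi> z) = z) \<and> (\<forall>z\<in>D n. \<omega> z \<in> ball 0 1 \<and> \<psi> (\<omega> z) = z)" for n
    using normalized_Riemann_map[OF oD scD D0 DU, of n] by metis
  then obtain \<psi> \<omega> where
    \<psi>: "\<And>n. \<psi> n holomorphic_on ball 0 1" "\<And>n. \<psi> n 0 = 0" and
    \<omega>: "\<And>n. \<omega> n holomorphic_on D n" "\<And>n. \<omega> n 0 = 0" and
    inv: "\<And>n z. z \<in> ball 0 1 \<Longrightarrow> \<psi> n z \<in> D n" "\<And>n z. z \<in> ball 0 1 \<Longrightarrow> \<omega> n (\<psi> n z) = z"
      "\<And>n z. z \<in> D n \<Longrightarrow> \<omega> n z \<in> ball 0 1" "\<And>n z. z \<in> D n \<Longrightarrow> \<psi> n (\<omega> n z) = z"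
    by metis
  have \<psi>1: "\<psi> n z \<in> ball 0 1" if "z \<in> ball 0 1" for n z using inv(1)[OF that] D1 by blast
  have "\<exists>a b. norm a = 1 \<and> norm b = 1 \<and> (\<forall>s z. 0 < s \<longrightarrow> s < 1 \<longrightarrow> z \<in> ball 0 1 \<longrightarrow>
      Re (a * f (\<psi> n (b * z))) \<le> Re (a * f (\<psi> n (b * hyperbolic_flow s z))))" for n
  proof -
    interpret bounded_convex_harmonic "\<lambda>z. f (\<psi> n z)" "\<lambda>z. h (\<psi> n z)" "\<lambda>z. g (\<psi> n z)" "c n"
    proof
      have "h \<circ> \<psi> n holomorphic_on ball 0 1" "g \<circ> \<psi> n holomorphic_on ball 0 1"
        using holomorphic_on_compose_gen[OF \<psi>(1) hol(1), of n] holomorphic_on_compose_gen[OF \<psi>(1) hol(2), of n] \<psi>1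
        by blast+
      then show "harmonic_decomp (ball 0 1) (\<lambda>z. f (\<psi> n z)) (\<lambda>z. h (\<psi> n z)) (\<lambda>z. g (\<psi> n z))"
        using fhg \<psi>1 by (auto simp: harmonic_decomp_def o_def)
      show "inj_on (\<lambda>z. f (\<psi> n z)) (ball 0 1)"
      proof (rule inj_onI)
        fix x y assume xy: "x \<in> ball 0 1" "y \<in> ball 0 1" "f (\<psi> n x) = f (\<psi> n y)"
        then have "\<psi> n x = \<psi> n y" using inj_onD[OF inj] \<psi>1 by blast
        then show "x = y" using inv(2) xy by metis
      qed
      have "\<psi> n ` ball 0 1 = D n" using inv by (force simp: image_iff)
      then have "(\<lambda>z. f (\<psi> n z)) ` ball 0 1 = f ` D n" by (metis image_image)
      then show "convex ((\<lambda>z. f (\<psi> n z)) ` ball 0 1)" using convD by simp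
      show "norm (f (\<psi> n z)) \<le> c n" if "z \<in> ball 0 1" for z
        using inv(1)[OF that, of n] by (simp add: D_def)
    qed
    show ?thesis by (rule flow_monotone) blast
  qed
  then obtain A B where A: "\<And>n. norm (A n) = 1" and B: "\<And>n. norm (B n) = 1"
    and AB: "\<And>n s z. 0 < s \<Longrightarrow> s < 1 \<Longrightarrow> z \<in> ball 0 1 \<Longrightarrow>
      Re (A n * f (\<psi> n (B n * z))) \<le> Re (A n * f (\<psi> n (B n * hyperbolic_flow s z)))"
    by metis
  have limd: "(\<lambda>n. norm (deriv (\<psi> n) 0)) \<longlonglongrightarrow> 1"
  proof (rule LIMSEQ_I)
    fix e :: real assume e: "e > 0"
    define \<rho> where "\<rho> = max (1/2) (1 - e / 2)"
    have \<rho>: "0 < \<rho>" "\<rho> < 1" "1 - e < \<rho>" using e by (auto simp: \<rho>_def max_def)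
    have "compact (f ` cball 0 \<rho>)"
      using \<rho> by (intro compact_continuous_image continuous_on_subset[OF cont]) auto
    then obtain M where M: "\<And>z. z \<in> cball 0 \<rho> \<Longrightarrow> norm (f z) \<le> M"
      using compact_imp_bounded bounded_iff by (metis imageI)
    obtain N where N: "M < real N" using reals_Archimedean2 by blast
    have "norm (norm (deriv (\<psi> n) 0) - 1) < e" if "N \<le> n" for n
    proof -
      have "real N \<le> real n" using that by simp
      then have "M < c n" using N norm_ge_zero[of "f 0"] unfolding c_def by linarith
      have "ball 0 \<rho> \<subseteq> D n"
      proof
        fix z :: complex assume "z \<in> ball 0 \<rho>"
        then show "z \<in> D n" using M[of z] \<rho> \<open>M < c n\<close> by (simp add: D_def)
      qed
      from deriv_normalized_Riemann_map[OF \<psi>(1) \<psi>(2) \<omega>(1) \<omega>(2) inv(1,3,4) oD D1 \<rho>(1) this]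
      show ?thesis using \<rho> by simp
    qed
    then show "\<exists>N. \<forall>n\<ge>N. norm (norm (deriv (\<psi> n) 0) - 1) < e" by blast
  qed
  have \<psi>lt: "norm (\<psi> n z) < 1" if "z \<in> ball 0 1" for n z using \<psi>1[OF that] by simp
  obtain r \<kappa> where r: "strict_mono (r :: nat \<Rightarrow> nat)" and \<kappa>: "norm \<kappa> = 1"
    and unif: "\<And>K. compact K \<Longrightarrow> K \<subseteq> ball 0 1 \<Longrightarrow> uniform_limit K (\<lambda>n. \<psi> (r n)) (\<lambda>z. \<kappa> * z) sequentially"
    using Schwarz_limit[OF \<psi> \<psi>lt limd] by blast
  have "(A (r n), B (r n)) \<in> sphere 0 1 \<times> sphere 0 1" for n using A B by simp
  moreover have "seq_compact (sphere (0::complex) 1 \<times> sphere (0::complex) 1)"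
    by (intro compact_imp_seq_compact compact_Times) auto
  ultimately obtain l q where l: "l \<in> sphere 0 1 \<times> sphere 0 1" and q: "strict_mono (q :: nat \<Rightarrow> nat)"
    and lim: "((\<lambda>n. (A (r n), B (r n))) \<circ> q) \<longlonglongrightarrow> l"
    unfolding seq_compact_def by meson
  obtain a b where ab: "l = (a, b)" by fastforce
  have lima: "(\<lambda>n. A (r (q n))) \<longlonglongrightarrow> a" and limb: "(\<lambda>n. B (r (q n))) \<longlonglongrightarrow> b"
    using tendsto_fst[OF lim] tendsto_snd[OF lim] by (simp_all add: ab o_def)
  have nab: "norm a = 1" "norm b = 1" using l ab by auto
  \<comment> \<open>The argument of the Riemann map moves with n because \<open>B\<close> does, so
    uniform convergence on the disc of radius |z| is used rather than pointwise convergence.\<close>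
  have limf: "(\<lambda>n. f (\<psi> (r (q n)) (B (r (q n)) * z))) \<longlonglongrightarrow> f (\<kappa> * b * z)" if z: "z \<in> ball 0 1" for z
  proof -
    have mem: "B n * z \<in> cball 0 (norm z)" for n using B by (simp add: norm_mult)
    have "uniform_limit (cball 0 (norm z)) (\<lambda>n. \<psi> (r n)) (\<lambda>z. \<kappa> * z) sequentially"
      using z by (intro unif) auto
    then have ul: "uniform_limit (cball 0 (norm z)) (\<lambda>n. \<psi> (r (q n))) (\<lambda>z. \<kappa> * z) sequentially"
      by (rule filterlim_compose[OF _ filterlim_subseq[OF q]])
    have "(\<lambda>n. \<psi> (r (q n)) (B (r (q n)) * z) - \<kappa> * (B (r (q n)) * z)) \<longlonglongrightarrow> 0"
    proof (rule tendstoI)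
      fix e :: real assume "e > 0"
      from uniform_limitD[OF ul this]
      show "\<forall>\<^sub>F n in sequentially. dist (\<psi> (r (q n)) (B (r (q n)) * z) - \<kappa> * (B (r (q n)) * z)) 0 < e"
      proof eventually_elim
        case (elim n)
        then show ?case using mem[of "r (q n)"] by (simp add: dist_norm)
      qed
    qed
    moreover have "(\<lambda>n. \<kappa> * (B (r (q n)) * z)) \<longlonglongrightarrow> \<kappa> * (b * z)" by (intro tendsto_intros limb)
    ultimately have "(\<lambda>n. \<psi> (r (q n)) (B (r (q n)) * z) - \<kappa> * (B (r (q n)) * z) + \<kappa> * (B (r (q n)) * z))
        \<longlonglongrightarrow> 0 + \<kappa> * (b * z)" by (rule tendsto_add)
    then have "(\<lambda>n. \<psi> (r (q n)) (B (r (q n)) * z)) \<longlonglongrightarrow> \<kappa> * b * z" by (simp add: mult.assoc)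
    moreover have "B n * z \<in> ball 0 1" for n using z B by (simp add: norm_mult)
    ultimately show ?thesis
      using z \<kappa> nab \<psi>1 by (intro continuous_on_tendsto_compose[OF cont]) (auto simp: norm_mult)
  qed
  show ?thesis
  proof
    show "norm a = 1" "norm (\<kappa> * b) = 1" using nab \<kappa> by (simp_all add: norm_mult)
    fix s :: real and z :: complex assume s: "0 < s" "s < 1" and z: "z \<in> ball 0 1"
    show "Re (a * f (\<kappa> * b * z)) \<le> Re (a * f (\<kappa> * b * hyperbolic_flow s z))"
    proof (rule tendsto_le[OF sequentially_bot])
      show "(\<lambda>n. Re (A (r (q n)) * f (\<psi> (r (q n)) (B (r (q n)) * z)))) \<longlonglongrightarrow> Re (a * f (\<kappa> * b * z))"
        by (intro tendsto_intros lima limf z)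
      show "(\<lambda>n. Re (A (r (q n)) * f (\<psi> (r (q n)) (B (r (q n)) * hyperbolic_flow s z))))
          \<longlonglongrightarrow> Re (a * f (\<kappa> * b * hyperbolic_flow s z))"
        by (intro tendsto_intros lima limf hyperbolic_flow_in_ball s z)
    qed (use AB[OF s z] in \<open>intro always_eventually allI\<close>)
  qed
qed

section \<open>Coefficient bounds\<close>

definition taylor :: "(complex \<Rightarrow> complex) \<Rightarrow> nat \<Rightarrow> complex" where
  "taylor f n = (deriv ^^ n) f 0 / fact n"

lemma taylor_0 [simp]: "taylor f 0 = f 0"
  by (simp add: taylor_def)

lemma taylor_mult:
  assumes "f holomorphic_on ball 0 1" "g holomorphic_on ball 0 1"
  shows "taylor (\<lambda>z. f z * g z) n = (\<Sum>i=0..n. taylor f i * taylor g (n - i))"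
proof -
  have exp: "F has_fps_expansion fps_expansion F 0" if "F holomorphic_on ball 0 1" for F
    by (rule has_fps_expansion_fps_expansion[OF _ _ that]) auto
  have nth: "fps_nth (fps_expansion F 0) k = taylor F k" if "F holomorphic_on ball 0 1" for F k
    using fps_nth_fps_expansion[OF exp[OF that]] by (simp add: taylor_def)
  have "taylor (\<lambda>z. f z * g z) n = fps_nth (fps_expansion f 0 * fps_expansion g 0) n"
    using fps_nth_fps_expansion[OF has_fps_expansion_mult[OF exp exp]] assms by (simp add: taylor_def)
  then show ?thesis using assms by (simp add: fps_mult_nth nth)
qed

lemma taylor_cmult:
  assumes "f holomorphic_on ball 0 1"
  shows "taylor (\<lambda>z. c * f z) n = c * taylor f n"
  using higher_deriv_cmult[OF assms _ open_ball, of 0 n c] by (simp add: taylor_def)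

lemma taylor_cong:
  assumes "\<And>z. z \<in> ball 0 1 \<Longrightarrow> f z = g z"
  shows "taylor f n = taylor g n"
proof -
  have "\<forall>\<^sub>F z in nhds 0. f z = g z"
    using eventually_nhds_in_open[OF open_ball, of "0::complex" 0 1] assms by (auto elim!: eventually_mono)
  then show ?thesis unfolding taylor_def by (simp add: higher_deriv_cong_ev)
qed

text \<open>Caratheodory's bound. The integral of p u^n over a circle parameter vanishes; its
  conjugate, added to the Cauchy formula, replaces p by 2 Re p. Nonnegativity then lets the mean
  value Re (p 0) bound the modulus, and r tends to 1.\<close>

lemma taylor_bound_Re_nonneg:
  assumes hol: "p holomorphic_on ball 0 1" and pos: "\<And>z. z \<in> ball 0 1 \<Longrightarrow> 0 \<le> Re (p z)"
    and n: "n \<ge> 1"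
  shows "norm (taylor p n) \<le> 2 * Re (p 0)"
proof -
  have key: "norm (taylor p n) * r ^ n \<le> 2 * Re (p 0)" if r: "0 < r" "r < 1" for r :: real
  proof -
    define \<gamma> where "\<gamma> = circlepath 0 r"
    have \<gamma>: "\<gamma> t = of_real r * exp (2 * of_real pi * \<i> * of_real t)" for t
      by (simp add: \<gamma>_def circlepath)
    have n\<gamma>: "norm (\<gamma> t) = r" for t using r by (simp add: \<gamma> norm_mult)
    have \<gamma>0: "\<gamma> t \<noteq> 0" for t using n\<gamma>[of t] r by auto
    have d\<gamma>: "vector_derivative \<gamma> (at t) = 2 * pi * \<i> * \<gamma> t" for t
      unfolding \<gamma>_def vector_derivative_circlepath by (simp add: circlepath)
    have coeff: "((\<lambda>t. p (\<gamma> t) / \<gamma> t ^ k) has_integral taylor p k) {0..1}" for k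
    proof -
      have "((\<lambda>u. p u / (u - 0) ^ Suc k) has_contour_integral (2 * pi * \<i>) / fact k * (deriv ^^ k) p 0) \<gamma>"
        unfolding \<gamma>_def using r
        by (intro Cauchy_has_contour_integral_higher_derivative_circlepath holomorphic_on_subset[OF hol]
            continuous_on_subset[OF holomorphic_on_imp_continuous_on[OF hol]]) auto
      then have "((\<lambda>t. p (\<gamma> t) / \<gamma> t ^ Suc k * (2 * pi * \<i> * \<gamma> t)) has_integral
          (2 * pi * \<i>) * taylor p k) {0..1}"
        by (simp add: has_contour_integral d\<gamma> taylor_def)
      then have "((\<lambda>t. (1 / (2 * pi * \<i>)) * (p (\<gamma> t) / \<gamma> t ^ Suc k * (2 * pi * \<i> * \<gamma> t))) has_integral
          (1 / (2 * pi * \<i>)) * ((2 * pi * \<i>) * taylor p k)) {0..1}"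
        by (rule has_integral_mult_right)
      then show ?thesis using \<gamma>0 by simp
    qed
    have "((\<lambda>u. p u * u ^ (n - 1)) has_contour_integral 0) \<gamma>"
      unfolding \<gamma>_def
    proof (rule Cauchy_theorem_convex_simple[of _ "ball 0 1"])
      show "(\<lambda>u. p u * u ^ (n - 1)) holomorphic_on ball 0 1" by (intro holomorphic_intros hol)
      show "path_image (circlepath 0 r) \<subseteq> ball 0 1" using r by auto
    qed auto
    then have "((\<lambda>t. p (\<gamma> t) * \<gamma> t ^ (n - 1) * (2 * pi * \<i> * \<gamma> t)) has_integral 0) {0..1}"
      by (simp add: has_contour_integral d\<gamma>)
    then have "((\<lambda>t. (1 / (2 * pi * \<i>)) * (p (\<gamma> t) * \<gamma> t ^ (n - 1) * (2 * pi * \<i> * \<gamma> t))) has_integral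
        (1 / (2 * pi * \<i>)) * 0) {0..1}"
      by (rule has_integral_mult_right)
    moreover have "(1 / (2 * pi * \<i>)) * (p (\<gamma> t) * \<gamma> t ^ (n - 1) * (2 * pi * \<i> * \<gamma> t)) = p (\<gamma> t) * \<gamma> t ^ n" for t
    proof -
      have "\<gamma> t ^ n = \<gamma> t ^ (n - 1) * \<gamma> t"
        using n by (metis Suc_diff_1 less_le_trans zero_less_one power_Suc2)
      then show ?thesis by (simp add: field_simps)
    qed
    ultimately have "((\<lambda>t. p (\<gamma> t) * \<gamma> t ^ n) has_integral 0) {0..1}" by (simp only: mult_zero_right)
    then have "((\<lambda>t. cnj (p (\<gamma> t) * \<gamma> t ^ n)) has_integral cnj 0) {0..1}"
      using has_integral_linear[OF _ bounded_linear_cnj] unfolding o_def by blast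
    \<comment> \<open>On the circle of radius r the conjugate of \<open>\<gamma> t ^ n\<close>
      divided by r^(2n) is 1 / \<open>\<gamma> t ^ n\<close>, which brings the vanishing integral
      into the shape of the Cauchy formula.\<close>
    then have "((\<lambda>t. 1 / (of_real r ^ (2 * n)) * cnj (p (\<gamma> t) * \<gamma> t ^ n)) has_integral
        1 / (of_real r ^ (2 * n)) * cnj 0) {0..1}"
      by (rule has_integral_mult_right)
    moreover have "1 / (of_real r ^ (2 * n)) * cnj (p (\<gamma> t) * \<gamma> t ^ n) = cnj (p (\<gamma> t)) / \<gamma> t ^ n" for t
    proof -
      have "cnj (\<gamma> t ^ n) * \<gamma> t ^ n = (\<gamma> t * cnj (\<gamma> t)) ^ n" by (simp add: power_mult_distrib mult.commute)
      also have "\<gamma> t * cnj (\<gamma> t) = of_real r ^ 2" using complex_norm_square[of "\<gamma> t"] n\<gamma>[of t] by simp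
      finally have "cnj (\<gamma> t ^ n) * \<gamma> t ^ n = of_real r ^ (2 * n)" by (simp add: power_mult)
      then show ?thesis using \<gamma>0[of t] r by (simp add: field_simps)
    qed
    ultimately have "((\<lambda>t. cnj (p (\<gamma> t)) / \<gamma> t ^ n) has_integral 0) {0..1}" by simp
    from has_integral_add[OF coeff[of n] this]
    have I: "((\<lambda>t. of_real (2 * Re (p (\<gamma> t))) / \<gamma> t ^ n) has_integral taylor p n) {0..1}"
      by (simp add: complex_add_cnj flip: add_divide_distrib)
    have "((\<lambda>t. Re (p (\<gamma> t))) has_integral Re (p 0)) {0..1}"
      using has_integral_Re[OF coeff[of 0]] by simp
    from has_integral_mult_right[OF this, of "2 / r ^ n"]
    have R: "((\<lambda>t. 2 / r ^ n * Re (p (\<gamma> t))) has_integral 2 / r ^ n * Re (p 0)) {0..1}" .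
    have "norm (integral {0..1} (\<lambda>t. of_real (2 * Re (p (\<gamma> t))) / \<gamma> t ^ n))
        \<le> integral {0..1} (\<lambda>t. 2 / r ^ n * Re (p (\<gamma> t)))"
    proof (rule integral_norm_bound_integral)
      fix t :: real
      have "Re (p (\<gamma> t)) \<ge> 0" using pos n\<gamma>[of t] r by simp
      then show "norm (of_real (2 * Re (p (\<gamma> t))) / \<gamma> t ^ n) \<le> 2 / r ^ n * Re (p (\<gamma> t))"
        by (simp add: norm_divide norm_power n\<gamma> norm_mult)
    qed (use I R in \<open>auto simp: has_integral_integrable\<close>)
    then have "norm (taylor p n) \<le> 2 / r ^ n * Re (p 0)"
      unfolding integral_unique[OF I] integral_unique[OF R] .
    then show ?thesis using r by (simp add: field_simps)
  qed
  have "((\<lambda>r. norm (taylor p n) * r ^ n) \<longlongrightarrow> norm (taylor p n) * 1 ^ n) (at_left (1::real))"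
    by (intro tendsto_intros)
  moreover have "\<forall>\<^sub>F r in at_left (1::real). norm (taylor p n) * r ^ n \<le> 2 * Re (p 0)"
    unfolding eventually_at_left_field using key by (intro exI[of _ 0]) auto
  ultimately have "norm (taylor p n) * 1 ^ n \<le> 2 * Re (p 0)"
    by (rule tendsto_upperbound) simp
  then show ?thesis by simp
qed

text \<open>The function 2k - 1 has nonnegative real part and value 1 at 0, and its coefficients of
  positive index are twice those of k.\<close>

lemma taylor_bound_Re_ge_half:
  assumes hol: "k holomorphic_on ball 0 1" and k0: "k 0 = 1"
    and pos: "\<And>z. z \<in> ball 0 1 \<Longrightarrow> 1 / 2 \<le> Re (k z)"
  shows "norm (taylor k n) \<le> 1"
proof (cases "n = 0")
  case False
  have "2 * taylor k n = taylor (\<lambda>z. 2 * k z - 1) n"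
  proof -
    have "taylor (\<lambda>z. 2 * k z - 1) n = ((deriv ^^ n) (\<lambda>z. 2 * k z) 0 - (deriv ^^ n) (\<lambda>z. 1) 0) / fact n"
      unfolding taylor_def
      by (subst higher_deriv_diff[OF _ _ open_ball, of _ 0 1]) (auto intro!: holomorphic_intros hol)
    also have "\<dots> = taylor (\<lambda>z. 2 * k z) n" using False by (simp add: taylor_def)
    finally show ?thesis using taylor_cmult[OF hol] by simp
  qed
  moreover have "norm (taylor (\<lambda>z. 2 * k z - 1) n) \<le> 2 * Re (2 * k 0 - 1)"
  proof (intro taylor_bound_Re_nonneg holomorphic_intros hol)
    show "0 \<le> Re (2 * k z - 1)" if "z \<in> ball 0 1" for z using pos[OF that] by simp
  qed (use False in simp)
  ultimately have "norm (2 * taylor k n) \<le> 2" using k0 by simp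
  then show ?thesis by (simp add: norm_mult)
qed (simp add: k0)

lemma Re_inverse_one_plus_ge_half:
  assumes "norm w < 1"
  shows "1 / 2 \<le> Re (1 / (1 + w))"
proof -
  have "norm w ^ 2 \<le> 1" using assms by (simp add: power_le_one)
  then have n: "(Re w)\<^sup>2 + (Im w)\<^sup>2 \<le> 1" by (simp add: cmod_power2)
  have "1 + Re w > 0" using assms abs_Re_le_cmod[of w] by linarith
  then have pos: "(1 + Re w)\<^sup>2 + (Im w)\<^sup>2 > 0" by (simp add: add_pos_nonneg)
  have "Re (1 / (1 + w)) = (1 + Re w) / ((1 + Re w)\<^sup>2 + (Im w)\<^sup>2)" by (simp add: Re_divide)
  also have "\<dots> \<ge> 1 / 2" using pos n by (simp add: field_simps power2_eq_square)
  finally show ?thesis .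
qed

text \<open>The quantity is the right derivative at s = 0 of Re (a f) along the flow line through z,
  which is a limit of nonnegative difference quotients.\<close>

lemma flow_generator_nonneg:
  assumes h: "h holomorphic_on ball 0 1" "g holomorphic_on ball 0 1"
    and f: "\<And>z. z \<in> ball 0 1 \<Longrightarrow> f z = h z + cnj (g z)" and b: "norm b = 1"
    and mono: "\<And>s. 0 < s \<Longrightarrow> s < 1 \<Longrightarrow> Re (a * f (b * z)) \<le> Re (a * f (b * hyperbolic_flow s z))"
    and z: "z \<in> ball 0 1"
  shows "0 \<le> Re (b * (a * deriv h (b * z) + cnj a * deriv g (b * z)) * (1 - z\<^sup>2))"
proof -
  define \<Phi> where "\<Phi> w = a * h w + cnj a * g w" for w
  have Re\<Phi>: "Re (\<Phi> w) = Re (a * f w)" if "w \<in> ball 0 1" for w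
    using f[OF that] by (simp add: \<Phi>_def algebra_simps)
  have bz: "b * w \<in> ball 0 1" if "w \<in> ball 0 1" for w using that b by (simp add: norm_mult)
  define \<Phi>' where "\<Phi>' = a * deriv h (b * z) + cnj a * deriv g (b * z)"
  have d\<Phi>: "(\<Phi> has_field_derivative \<Phi>') (at (b * z))"
    unfolding \<Phi>_def \<Phi>'_def
    by (intro DERIV_add DERIV_cmult holomorphic_derivI[OF h(1) open_ball] holomorphic_derivI[OF h(2) open_ball] bz z)
  \<comment> \<open>A complex flow parameter lets the holomorphic chain rule apply; real positive
    values are substituted only in the limit.\<close>
  define T where "T u = (z + u) / (1 + u * z)" for u
  have dT: "(T has_field_derivative 1 - z\<^sup>2) (at 0)"
    unfolding T_def by (auto intro!: derivative_eq_intros simp: power2_eq_square)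
  have "((\<lambda>u. \<Phi> (b * T u)) has_field_derivative \<Phi>' * (b * (1 - z\<^sup>2))) (at 0)"
    by (rule DERIV_chain2[of \<Phi>]) (use d\<Phi> DERIV_cmult[OF dT, of b] in \<open>simp_all add: T_def\<close>)
  then have lim: "((\<lambda>u. (\<Phi> (b * T u) - \<Phi> (b * T 0)) / u) \<longlongrightarrow> \<Phi>' * (b * (1 - z\<^sup>2))) (at 0)"
    by (simp add: has_field_derivative_iff)
  \<comment> \<open>The sequence is 1 / (n + 2), so that already its first term is below 1.\<close>
  define s where "s n = inverse (real (Suc (Suc n)))" for n
  have s: "0 < s n" "s n < 1" for n by (auto simp: s_def divide_simps)
  have s0: "s \<longlonglongrightarrow> 0"
    unfolding s_def[abs_def] using LIMSEQ_Suc[OF LIMSEQ_inverse_real_of_nat] by simp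
  have "filterlim (\<lambda>n. of_real (s n) :: complex) (at 0) sequentially"
    unfolding filterlim_at using tendsto_of_real[OF s0, where 'a = complex] s
    by (auto intro!: always_eventually simp: less_imp_neq[symmetric])
  from filterlim_compose[OF lim this]
  have "(\<lambda>n. Re ((\<Phi> (b * T (of_real (s n))) - \<Phi> (b * T 0)) / of_real (s n))) \<longlonglongrightarrow> Re (\<Phi>' * (b * (1 - z\<^sup>2)))"
    by (rule tendsto_Re)
  moreover have "0 \<le> Re ((\<Phi> (b * T (of_real (s n))) - \<Phi> (b * T 0)) / of_real (s n))" for n
  proof -
    have T: "T (of_real (s n)) = hyperbolic_flow (s n) z" by (simp add: T_def hyperbolic_flow_def)
    have "Re (\<Phi> (b * T (of_real (s n))) - \<Phi> (b * T 0)) \<ge> 0"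
      unfolding minus_complex.sel T
      using mono[OF s[of n]] Re\<Phi>[OF bz[OF z]] Re\<Phi>[OF bz[OF hyperbolic_flow_in_ball[OF s[of n] z]]]
      by (simp add: T_def)
    then show ?thesis unfolding Re_divide_of_real using s[of n] by simp
  qed
  ultimately have "0 \<le> Re (\<Phi>' * (b * (1 - z\<^sup>2)))"
    by (intro LIMSEQ_le_const) (auto intro: exI[of _ 0])
  then show ?thesis by (simp add: \<Phi>'_def mult_ac)
qed

lemma taylor_diff:
  assumes "f holomorphic_on ball 0 1" "g holomorphic_on ball 0 1"
  shows "taylor (\<lambda>z. f z - g z) n = taylor f n - taylor g n"
  using higher_deriv_diff[OF assms open_ball, of 0 n] by (simp add: taylor_def diff_divide_distrib)

lemma taylor_times_z:
  assumes "f holomorphic_on ball 0 1"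
  shows "taylor (\<lambda>z. z * f z) (Suc n) = taylor f n"
proof -
  have id: "taylor (\<lambda>z. z) i = (if i = 1 then 1 else 0)" for i
    by (simp add: taylor_def)
  have "taylor (\<lambda>z. z * f z) (Suc n) =
      (\<Sum>i=0..Suc n. if i = 1 then taylor f (Suc n - 1) else 0)"
    unfolding taylor_mult[OF holomorphic_on_ident assms] id by (rule sum.cong) auto
  then show ?thesis by simp
qed

lemma sum_staircase: "(\<Sum>i=0..n. real (n - i) + 1) = (real n + 1) * (real n + 2) / 2"
proof (induction n)
  case (Suc n)
  then show ?case
    by (subst sum.atLeast0_atMost_Suc_shift) (simp add: o_def field_simps)
qed simp

text \<open>The function q = b(aH + cnj a G) becomes p of nonnegative real part after multiplication
  by 1 - z^2, while H and G are recovered from q by the factors k = 1 / (1 + w) and 1 - k. The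
  powers of b have modulus 1, and division by n + 1 undoes the differentiation.\<close>

theorem convex_harmonic_coefficients:
  assumes decomp: "harmonic_decomp (ball 0 1) f h g"
    and inj: "inj_on f (ball 0 1)" and conv: "convex (f ` ball 0 1)"
    and h1: "deriv h 0 = 1" and g1: "deriv g 0 = 0"
    and dil: "\<And>z. z \<in> ball 0 1 \<Longrightarrow> norm (deriv g z) < norm (deriv h z)"
  shows "norm (taylor h (Suc n)) \<le> (real n + 2) / 2" "norm (taylor g (Suc n)) \<le> real n / 2"
proof -
  have hol: "h holomorphic_on ball 0 1" "g holomorphic_on ball 0 1"
    and fhg: "\<And>z. z \<in> ball 0 1 \<Longrightarrow> f z = h z + cnj (g z)"
    using decomp by (auto simp: harmonic_decomp_def)
  obtain a b where a: "norm a = 1" and b: "norm b = 1"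
    and mono: "\<And>s z. 0 < s \<Longrightarrow> s < 1 \<Longrightarrow> z \<in> ball 0 1 \<Longrightarrow>
      Re (a * f (b * z)) \<le> Re (a * f (b * hyperbolic_flow s z))"
    using convex_harmonic_flow[OF decomp inj conv] by blast
  have ab: "a \<noteq> 0" "b \<noteq> 0" using a b by auto
  have bz: "b * z \<in> ball 0 1" if "z \<in> ball 0 1" for z using that b by (simp add: norm_mult)
  define H where "H z = deriv h (b * z)" for z
  define G where "G z = deriv g (b * z)" for z
  have holHG: "H holomorphic_on ball 0 1" "G holomorphic_on ball 0 1"
  proof -
    have "(\<lambda>z. b * z) holomorphic_on ball 0 1" by (intro holomorphic_intros)
    moreover have "(\<lambda>z. b * z) ` ball 0 1 \<subseteq> ball 0 1" using bz by blast
    ultimately show "H holomorphic_on ball 0 1" "G holomorphic_on ball 0 1"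
      using holomorphic_on_compose_gen[OF _ holomorphic_deriv[OF hol(1) open_ball]]
        holomorphic_on_compose_gen[OF _ holomorphic_deriv[OF hol(2) open_ball]]
      unfolding H_def[abs_def] G_def[abs_def] o_def by blast+
  qed
  have taylor_shift: "norm (taylor (\<lambda>z. deriv k (b * z)) n) = real (Suc n) * norm (taylor k (Suc n))"
    if k: "k holomorphic_on ball 0 1" for k n
  proof -
    have "(deriv ^^ n) (\<lambda>z. deriv k (b * z)) 0 = b ^ n * (deriv ^^ n) (deriv k) (b * 0)"
      by (rule higher_deriv_compose_linear[of _ "ball 0 1" "ball 0 1"])
        (use bz holomorphic_deriv[OF k] in auto)
    then have "norm (taylor (\<lambda>z. deriv k (b * z)) n) = norm ((deriv ^^ Suc n) k 0) / fact n"
      by (simp add: taylor_def norm_mult norm_power norm_divide b funpow_swap1)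
    also have "\<dots> = real (Suc n) * norm (taylor k (Suc n))"
      unfolding taylor_def norm_divide norm_fact fact_Suc by (simp add: norm_mult del: funpow.simps of_nat_Suc)
    finally show ?thesis .
  qed
  have H0: "H z \<noteq> 0" if "z \<in> ball 0 1" for z
    using dil[OF bz[OF that]] norm_ge_zero[of "deriv g (b * z)"] unfolding H_def by force
  \<comment> \<open>This unimodular constant makes q equal to a b H (1 + w), with |w| < 1 by the
    condition on the dilatation.\<close>
  define c where "c = cnj a / a"
  have c: "norm c = 1" using a by (simp add: c_def norm_divide)
  define w where "w z = c * (G z / H z)" for z
  have w1: "norm (w z) < 1" if "z \<in> ball 0 1" for z
    using dil[OF bz[OF that]] H0[OF that] by (simp add: w_def norm_mult norm_divide c H_def G_def)
  have w0: "1 + w z \<noteq> 0" if "z \<in> ball 0 1" for z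
    using w1[OF that] by (metis add_eq_0_iff less_irrefl norm_minus_cancel norm_one)
  define k where "k z = 1 / (1 + w z)" for z
  have holk: "k holomorphic_on ball 0 1"
    unfolding k_def[abs_def] w_def[abs_def]
    by (intro holomorphic_intros holHG) (use H0 w0 in \<open>auto simp: w_def\<close>)
  have k0: "k 0 = 1" by (simp add: k_def w_def G_def g1)
  have k_le: "norm (taylor k n) \<le> 1" for n
    using Re_inverse_one_plus_ge_half[OF w1] by (intro taylor_bound_Re_ge_half holk k0) (simp add: k_def)
  define q where "q z = b * (a * H z + cnj a * G z)" for z
  have holq: "q holomorphic_on ball 0 1"
    unfolding q_def[abs_def] by (intro holomorphic_intros holHG)
  have qeq: "q z = a * b * (H z * (1 + w z))" if "z \<in> ball 0 1" for z
    using H0[OF that] ab by (simp add: q_def w_def c_def field_simps)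
  define p where "p z = q z * (1 - z\<^sup>2)" for z
  have holp: "p holomorphic_on ball 0 1"
    unfolding p_def[abs_def] by (intro holomorphic_intros holq)
  have p_nonneg: "0 \<le> Re (p z)" if "z \<in> ball 0 1" for z
    using flow_generator_nonneg[OF hol fhg b mono[OF _ _ that] that]
    by (simp add: p_def q_def H_def G_def del: times_complex.sel)
  have p0: "p 0 = a * b" by (simp add: p_def q_def H_def G_def h1 g1)
  have p_le: "norm (taylor p n) \<le> 2" if "n \<ge> 1" for n
    using taylor_bound_Re_nonneg[OF holp p_nonneg that] p0 complex_Re_le_cmod[of "a * b"] a b
    by (simp add: norm_mult del: times_complex.sel)
  have holzq: "(\<lambda>z. z * q z) holomorphic_on ball 0 1" by (intro holomorphic_intros holq)
  have pq: "taylor p n = taylor q n - taylor (\<lambda>z. z * (z * q z)) n" for n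
  proof -
    have "p = (\<lambda>z. q z - z * (z * q z))" by (simp add: p_def fun_eq_iff power2_eq_square algebra_simps)
    then show ?thesis
      using taylor_diff[OF holq, of "\<lambda>z. z * (z * q z)" n] holzq by (simp add: holomorphic_intros)
  qed
  \<comment> \<open>Dividing by 1 - z^2 adds the coefficient two places earlier, so the bound grows
    by 2 every second step, from 1 at index 0 and 2 at index 1.\<close>
  have q_rec: "taylor q 0 = taylor p 0" "taylor q 1 = taylor p 1"
    "taylor q (Suc (Suc n)) = taylor p (Suc (Suc n)) + taylor q n" for n
    using pq[of 0] pq[of 1] pq[of "Suc (Suc n)"] taylor_times_z[OF holzq, of 0]
      taylor_times_z[OF holzq, of "Suc n"] taylor_times_z[OF holq, of n]
    by simp_all
  have q_le: "norm (taylor q n) \<le> real n + 1" for n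
  proof (induction n rule: induct_nat_012)
    case 0
    then show ?case using p0 by (simp add: p_def norm_mult a b)
  next
    case 1
    then show ?case using p_le[of 1] q_rec(2) by simp
  next
    case (ge2 n)
    have "norm (taylor q (Suc (Suc n))) \<le> norm (taylor p (Suc (Suc n))) + norm (taylor q n)"
      unfolding q_rec by (rule norm_triangle_ineq)
    then show ?case using ge2 p_le[of "Suc (Suc n)"] by simp
  qed
  have nab: "norm (inverse (a * b)) = 1" by (simp add: norm_inverse norm_mult a b)
  have holkq: "(\<lambda>z. k z * q z) holomorphic_on ball 0 1" by (intro holomorphic_intros holk holq)
  have "H z = inverse (a * b) * (k z * q z)" if "z \<in> ball 0 1" for z
  proof -
    have "k z * q z = a * b * H z" using w0[OF that] by (simp add: qeq[OF that] k_def)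
    then show ?thesis using ab by (simp add: field_simps)
  qed
  then have "norm (taylor H n) = norm (taylor (\<lambda>z. inverse (a * b) * (k z * q z)) n)"
    using taylor_cong[of H] by simp
  also have "\<dots> = norm (\<Sum>i=0..n. taylor k i * taylor q (n - i))"
    unfolding taylor_cmult[OF holkq] taylor_mult[OF holk holq] norm_mult nab by simp
  also have "\<dots> \<le> (\<Sum>i=0..n. real (n - i) + 1)"
  proof (rule sum_norm_le)
    fix i
    show "norm (taylor k i * taylor q (n - i)) \<le> real (n - i) + 1"
      using mult_mono[OF k_le[of i] q_le[of "n - i"]] by (simp add: norm_mult)
  qed
  finally have "norm (taylor H n) \<le> (real n + 1) * (real n + 2) / 2" unfolding sum_staircase .
  moreover have "norm (taylor H n) = (real n + 1) * norm (taylor h (Suc n))"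
    using taylor_shift[OF hol(1), of n] by (simp add: H_def[abs_def])
  ultimately have "(real n + 1) * norm (taylor h (Suc n)) \<le> (real n + 1) * ((real n + 2) / 2)"
    by simp
  then show "norm (taylor h (Suc n)) \<le> (real n + 2) / 2"
    by (rule mult_left_le_imp_le) simp
  \<comment> \<open>Since w vanishes at 0, so does l = w k. The sum for G therefore lacks the term n
    + 1 at i = 0, which lowers the bound from (n + 2) / 2 to n / 2.\<close>
  define l where "l z = 1 - k z" for z
  have holl: "l holomorphic_on ball 0 1" unfolding l_def[abs_def] by (intro holomorphic_intros holk)
  have l: "norm (taylor l i) \<le> (if i = 0 then 0 else 1)" for i
  proof -
    have "taylor l i = taylor (\<lambda>z. 1) i - taylor k i"
      unfolding l_def[abs_def] by (intro taylor_diff holk) auto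
    then show ?thesis using k_le[of i] k0 by (auto simp: taylor_def)
  qed
  have hollq: "(\<lambda>z. l z * q z) holomorphic_on ball 0 1" by (intro holomorphic_intros holl holq)
  have "G z = inverse (a * b) * inverse c * (l z * q z)" if z: "z \<in> ball 0 1" for z
  proof -
    have "l z = w z * k z" using w0[OF z] by (simp add: l_def k_def field_simps)
    moreover have "q z * k z = a * b * H z" using w0[OF z] by (simp add: qeq[OF z] k_def)
    moreover have "w z * H z = c * G z" using H0[OF z] by (simp add: w_def)
    ultimately have "l z * q z = a * b * (c * G z)" by (metis mult.assoc mult.commute)
    moreover have "c \<noteq> 0" using c by auto
    ultimately show ?thesis using ab by (simp add: field_simps)
  qed
  then have "norm (taylor G n) = norm (taylor (\<lambda>z. inverse (a * b) * inverse c * (l z * q z)) n)"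
    using taylor_cong[of G] by simp
  also have "\<dots> = norm (\<Sum>i=0..n. taylor l i * taylor q (n - i))"
    unfolding taylor_cmult[OF hollq] taylor_mult[OF holl holq] norm_mult nab by (simp add: norm_inverse c)
  also have "\<dots> \<le> (\<Sum>i=0..n. (real (n - i) + 1) - (if i = 0 then real n + 1 else 0))"
  proof (rule sum_norm_le)
    fix i
    have "norm (taylor l i * taylor q (n - i)) \<le> (if i = 0 then 0 else 1) * (real (n - i) + 1)"
      unfolding norm_mult by (rule mult_mono[OF l q_le]) auto
    then show "norm (taylor l i * taylor q (n - i)) \<le> (real (n - i) + 1) - (if i = 0 then real n + 1 else 0)"
      by (auto split: if_splits)
  qed
  finally have "norm (taylor G n) \<le> (real n + 1) * (real n + 2) / 2 - (real n + 1)"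
    unfolding sum_subtractf sum_staircase by simp
  moreover have "norm (taylor G n) = (real n + 1) * norm (taylor g (Suc n))"
    using taylor_shift[OF hol(2), of n] by (simp add: G_def[abs_def])
  ultimately have "(real n + 1) * norm (taylor g (Suc n)) \<le> (real n + 1) * (real n / 2)"
    by (simp add: field_simps)
  then show "norm (taylor g (Suc n)) \<le> real n / 2"
    by (rule mult_left_le_imp_le) simp
qed

section \<open>A sufficient condition for full starlikeness\<close>

text \<open>Index n stands for the power n + 2: the constant and linear terms are normalized and
  kept outside.\<close>

definition tail_series :: "(nat \<Rightarrow> complex) \<Rightarrow> complex \<Rightarrow> complex" where
  "tail_series c z = (\<Sum>n. c n * z ^ (n + 2))"

definition tail_deriv :: "(nat \<Rightarrow> complex) \<Rightarrow> complex \<Rightarrow> complex" where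
  "tail_deriv c z = (\<Sum>n. of_nat (n + 2) * c n * z ^ (n + 1))"

text \<open>The sum of moduli on the circle of radius r, divided by r; this puts it on the same
  scale as \<open>majorant_deriv\<close>.\<close>

definition majorant :: "(nat \<Rightarrow> complex) \<Rightarrow> real \<Rightarrow> real" where
  "majorant c r = (\<Sum>n. norm (c n) * r ^ (n + 1))"

definition majorant_deriv :: "(nat \<Rightarrow> complex) \<Rightarrow> real \<Rightarrow> real" where
  "majorant_deriv c r = (\<Sum>n. real (n + 2) * norm (c n) * r ^ (n + 1))"

locale tail =
  fixes c :: "nat \<Rightarrow> complex" and \<rho> :: real
  assumes summable_deriv: "\<And>r. 0 < r \<Longrightarrow> r < \<rho> \<Longrightarrow> summable (\<lambda>n. real (n + 2) * norm (c n) * r ^ (n + 1))"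
begin

lemma summable_majorant:
  assumes "0 < r" "r < \<rho>"
  shows "summable (\<lambda>n. norm (c n) * r ^ (n + 1))"
proof (rule summable_comparison_test'[OF summable_deriv[OF assms]])
  fix n
  have "1 * (norm (c n) * r ^ (n + 1)) \<le> real (n + 2) * (norm (c n) * r ^ (n + 1))"
    using assms by (intro mult_right_mono) auto
  then show "norm (norm (c n) * r ^ (n + 1)) \<le> real (n + 2) * norm (c n) * r ^ (n + 1)"
    using assms by (simp add: mult.assoc)
qed

lemma majorant_nonneg: "0 < r \<Longrightarrow> r < \<rho> \<Longrightarrow> 0 \<le> majorant c r"
  unfolding majorant_def by (intro suminf_nonneg summable_majorant) auto

lemma majorant_deriv_ge:
  assumes "0 < r" "r < \<rho>"
  shows "2 * majorant c r \<le> majorant_deriv c r"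
proof -
  have "2 * majorant c r = (\<Sum>n. 2 * (norm (c n) * r ^ (n + 1)))"
    unfolding majorant_def by (rule suminf_mult[OF summable_majorant[OF assms], symmetric])
  also have "\<dots> \<le> majorant_deriv c r"
    unfolding majorant_deriv_def mult.assoc
  proof (rule suminf_le)
    fix n show "2 * (norm (c n) * r ^ (n + 1)) \<le> real (n + 2) * (norm (c n) * r ^ (n + 1))"
      using assms by (intro mult_right_mono) auto
  qed (use summable_majorant[OF assms] summable_deriv[OF assms] in \<open>auto intro: summable_mult simp: mult.assoc\<close>)
  finally show ?thesis .
qed

lemma summable_tail:
  assumes "0 < r" "r < \<rho>" "norm z \<le> r"
  shows "summable (\<lambda>n. c n * z ^ (n + 2))" "summable (\<lambda>n. of_nat (n + 2) * c n * z ^ (n + 1))"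
proof -
  have z: "norm z ^ k \<le> r ^ k" for k using assms by (intro power_mono) auto
  show "summable (\<lambda>n. c n * z ^ (n + 2))"
  proof (rule summable_comparison_test'[OF summable_mult[OF summable_majorant[OF assms(1,2)], of r]])
    fix n
    have "norm (c n) * norm z ^ (n + 2) \<le> norm (c n) * r ^ (n + 2)"
      by (rule mult_left_mono[OF z]) simp
    then show "norm (c n * z ^ (n + 2)) \<le> r * (norm (c n) * r ^ (n + 1))"
      by (simp add: norm_mult norm_power mult_ac)
  qed
  show "summable (\<lambda>n. of_nat (n + 2) * c n * z ^ (n + 1))"
  proof (rule summable_comparison_test'[OF summable_deriv[OF assms(1,2)]])
    fix n
    show "norm (of_nat (n + 2) * c n * z ^ (n + 1)) \<le> real (n + 2) * norm (c n) * r ^ (n + 1)"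
      unfolding norm_mult norm_power norm_of_nat by (rule mult_left_mono[OF z]) simp
  qed
qed

lemma tail_series_has_derivative:
  assumes z: "z \<in> ball 0 \<rho>"
  shows "(tail_series c has_field_derivative tail_deriv c z) (at z)"
proof -
  define r where "r = (norm z + \<rho>) / 2"
  have r: "0 < r" "r < \<rho>" "norm z < r"
    using z norm_ge_zero[of z] by (auto simp: r_def simp del: norm_ge_zero)
  define c' where "c' n = (if n < 2 then 0 else c (n - 2))" for n
  have c': "c' (n + 2) = c n" "c' 0 = 0" "c' 1 = 0" for n by (auto simp: c'_def)
  have "summable (\<lambda>n. c' (n + 2) * of_real r ^ (n + 2))"
    unfolding c' using summable_tail(1)[of r "of_real r"] r by simp
  then have s: "summable (\<lambda>n. c' n * of_real r ^ n)" by (subst (asm) summable_iff_shift)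
  have "((\<lambda>x. \<Sum>n. c' n * x ^ n) has_field_derivative (\<Sum>n. diffs c' n * z ^ n)) (at z)"
    by (rule termdiffs_strong[OF s]) (use r in auto)
  moreover have "(\<Sum>n. diffs c' n * z ^ n) = tail_deriv c z"
  proof -
    have "summable (\<lambda>n. diffs c' n * z ^ n)"
      by (rule termdiff_converges[of z r]) (use r in \<open>auto intro!: powser_inside[OF s]\<close>)
    from suminf_split_head[OF this] show ?thesis
      using c'(3) by (simp add: diffs_def tail_deriv_def c'_def)
  qed
  moreover have "\<forall>\<^sub>F x in nhds z. (\<Sum>n. c' n * x ^ n) = tail_series c x"
  proof -
    have "\<forall>\<^sub>F x in nhds z. x \<in> ball 0 r" using r by (intro eventually_nhds_in_open) auto
    then show ?thesis
    proof eventually_elim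
      case (elim x)
      have "summable (\<lambda>n. c' n * x ^ n)" by (rule powser_inside[OF s]) (use elim r in auto)
      from suminf_split_initial_segment[OF this, of 2]
      show ?case using c'(2,3) by (simp add: tail_series_def c'_def numeral_2_eq_2)
    qed
  qed
  ultimately show ?thesis by (simp add: DERIV_cong_ev)
qed

lemma tail_deriv_bound:
  assumes "0 < r" "r < \<rho>" "norm z \<le> r"
  shows "norm (tail_deriv c z) \<le> majorant_deriv c r"
  unfolding tail_deriv_def majorant_deriv_def
proof (rule norm_suminf_le)
  fix n
  show "norm (of_nat (n + 2) * c n * z ^ (n + 1)) \<le> real (n + 2) * norm (c n) * r ^ (n + 1)"
    unfolding norm_mult norm_power norm_of_nat using assms by (intro mult_left_mono power_mono) auto
qed (rule summable_deriv[OF assms(1,2)])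

text \<open>For t at least -2 all factors n + 2 + t are nonnegative, so taking moduli term by term
  keeps the sign of t. This is what allows the weights n - \<alpha> as well as n + \<alpha> to
  appear later.\<close>

lemma tail_combination_bound:
  assumes r: "0 < r" "r < \<rho>" "norm z = r" and t: "-2 \<le> t"
  shows "norm (z * tail_deriv c z + of_real t * tail_series c z) \<le> r * (majorant_deriv c r + t * majorant c r)"
proof -
  have z: "norm z \<le> r" using r by simp
  note s = summable_tail[OF r(1,2) z]
  have "z * tail_deriv c z + of_real t * tail_series c z =
      (\<Sum>n. z * (of_nat (n + 2) * c n * z ^ (n + 1)) + of_real t * (c n * z ^ (n + 2)))"
    unfolding tail_deriv_def tail_series_def
    by (simp only: suminf_mult[OF s(2), symmetric] suminf_mult[OF s(1), symmetric]
        suminf_add[OF summable_mult[OF s(2)] summable_mult[OF s(1)]])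
  also have "\<dots> = (\<Sum>n. of_real (real (n + 2) + t) * c n * z ^ (n + 2))"
    by (rule suminf_cong) (simp add: algebra_simps)
  also have "norm \<dots> \<le> (\<Sum>n. r * (real (n + 2) * norm (c n) * r ^ (n + 1)) + r * t * (norm (c n) * r ^ (n + 1)))"
  proof (rule norm_suminf_le)
    fix n
    have "norm (of_real (real (n + 2) + t) * c n * z ^ (n + 2)) = (real (n + 2) + t) * norm (c n) * r ^ (n + 2)"
      unfolding norm_mult norm_power norm_of_real r(3) using t by simp
    also have "\<dots> = r * (real (n + 2) * norm (c n) * r ^ (n + 1)) + r * t * (norm (c n) * r ^ (n + 1))"
      by (simp add: algebra_simps)
    finally show "norm (of_real (real (n + 2) + t) * c n * z ^ (n + 2)) \<le>
      r * (real (n + 2) * norm (c n) * r ^ (n + 1)) + r * t * (norm (c n) * r ^ (n + 1))" by simp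
  qed (intro summable_add summable_mult summable_deriv summable_majorant r)
  also have "\<dots> = r * majorant_deriv c r + r * t * majorant c r"
    unfolding majorant_deriv_def majorant_def
    by (simp only: suminf_mult[OF summable_deriv[OF r(1,2)], symmetric]
        suminf_mult[OF summable_majorant[OF r(1,2)], symmetric]
        suminf_add[OF summable_mult[OF summable_deriv[OF r(1,2)]] summable_mult[OF summable_majorant[OF r(1,2)]]])
  finally show ?thesis by (simp add: algebra_simps)
qed

lemma tail_series_bound:
  assumes r: "0 < r" "r < \<rho>" "norm z = r"
  shows "norm (tail_series c z) \<le> r * majorant c r"
proof -
  have "norm (tail_series c z) \<le> (\<Sum>n. r * (norm (c n) * r ^ (n + 1)))"
    unfolding tail_series_def
    by (rule norm_suminf_le)
      (use summable_mult[OF summable_majorant[OF r(1,2)], of r] in \<open>simp_all add: norm_mult norm_power r mult_ac\<close>)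
  then show ?thesis unfolding majorant_def suminf_mult[OF summable_majorant[OF r(1,2)]] .
qed

lemma holomorphic_tail_series: "tail_series c holomorphic_on ball 0 \<rho>"
  by (auto simp: holomorphic_on_open intro!: exI tail_series_has_derivative)

end

text \<open>Because of the shift of index, \<open>majorant_deriv\<close> carries the exponent of z
  as a weight and \<open>majorant\<close> the weight 1; \<open>less\<close> is thus the coefficient
  inequality with weights n - \<alpha> and n + \<alpha>.\<close>

locale starlike_series = a: tail a \<rho> + b: tail b \<rho> for a b \<rho> +
  fixes \<alpha> :: real and F :: "complex \<Rightarrow> complex"
  assumes \<alpha>: "0 \<le> \<alpha>" "\<alpha> < 1" and \<rho>: "0 < \<rho>"
    and F: "\<And>z. z \<in> ball 0 \<rho> \<Longrightarrow> F z = z + tail_series a z + cnj (tail_series b z)"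
    and less: "\<And>r. 0 < r \<Longrightarrow> r < \<rho> \<Longrightarrow>
      majorant_deriv a r - \<alpha> * majorant a r + majorant_deriv b r + \<alpha> * majorant b r < 1 - \<alpha>"
begin

text \<open>As \<open>majorant\<close> is at most \<open>majorant_deriv\<close>, the left side of
  \<open>less\<close> is at least 1 - \<alpha> times the sum here, and 1 - \<alpha> cancels.\<close>

lemma majorant_deriv_less_1:
  assumes r: "0 < r" "r < \<rho>"
  shows "majorant_deriv a r + majorant_deriv b r < 1"
proof -
  have "\<alpha> * majorant a r \<le> \<alpha> * majorant_deriv a r"
    using a.majorant_nonneg[OF r] a.majorant_deriv_ge[OF r] \<alpha> by (intro mult_left_mono) linarith+
  moreover have "0 \<le> majorant_deriv b r" "0 \<le> \<alpha> * majorant b r"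
    using b.majorant_nonneg[OF r] b.majorant_deriv_ge[OF r] \<alpha> by auto
  moreover have "0 \<le> \<alpha> * majorant_deriv b r" using calculation \<alpha> by simp
  ultimately have "(1 - \<alpha>) * (majorant_deriv a r + majorant_deriv b r) < (1 - \<alpha>) * 1"
    using less[OF r] by (simp add: algebra_simps)
  then show ?thesis using \<alpha> by (simp only: mult_less_cancel_left_pos)
qed

text \<open>On the convex set \<open>cball 0 r\<close> the two tails have Lipschitz constants with
  sum below 1, so they cannot cancel the difference x - y of the leading terms.\<close>

lemma inj_F: "inj_on F (ball 0 \<rho>)"
proof (rule inj_onI, rule ccontr)
  fix x y assume xy: "x \<in> ball 0 \<rho>" "y \<in> ball 0 \<rho>" "F x = F y" "x \<noteq> y"
  define r where "r = max (norm x) (norm y)"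
  have r: "0 < r" "r < \<rho>" using xy by (auto simp: r_def less_max_iff_disj)
  have in_ball: "x \<in> cball 0 r" "y \<in> cball 0 r" by (auto simp: r_def)
  have "norm (tail_series a x - tail_series a y) \<le> majorant_deriv a r * norm (x - y)"
    by (rule field_differentiable_bound[of "cball 0 r"])
      (use r in_ball in \<open>auto intro!: a.tail_deriv_bound has_field_derivative_at_within[OF a.tail_series_has_derivative]\<close>)
  moreover have "norm (tail_series b x - tail_series b y) \<le> majorant_deriv b r * norm (x - y)"
    by (rule field_differentiable_bound[of "cball 0 r"])
      (use r in_ball in \<open>auto intro!: b.tail_deriv_bound has_field_derivative_at_within[OF b.tail_series_has_derivative]\<close>)
  moreover have "x - y = - (tail_series a x - tail_series a y) - cnj (tail_series b x - tail_series b y)"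
    using xy F[of x] F[of y] by (simp add: algebra_simps)
  then have "norm (x - y) \<le> norm (tail_series a x - tail_series a y) + norm (tail_series b x - tail_series b y)"
    using norm_triangle_ineq4[of "- (tail_series a x - tail_series a y)" "cnj (tail_series b x - tail_series b y)"]
    by (simp only: norm_minus_cancel complex_mod_cnj)
  ultimately have "1 * norm (x - y) \<le> (majorant_deriv a r + majorant_deriv b r) * norm (x - y)"
    by (simp add: algebra_simps)
  moreover have "norm (x - y) > 0" using xy by simp
  ultimately show False using majorant_deriv_less_1[OF r] by (simp only: mult_le_cancel_right_pos)
qed

lemma F_0: "F 0 = 0"
  using F[of 0] \<rho> by (simp add: tail_series_def)

lemma F_nonzero: "z \<in> ball 0 \<rho> \<Longrightarrow> z \<noteq> 0 \<Longrightarrow> F z \<noteq> 0"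
  using inj_onD[OF inj_F, of z 0] F_0 \<rho> by auto

text \<open>This is z h' - cnj (z g'); the derivative of F along a circle in the angle is i N, so Re
  (N / F) is the angular derivative of the argument of F.\<close>

definition N :: "complex \<Rightarrow> complex" where
  "N z = z * (1 + tail_deriv a z) - cnj (z * tail_deriv b z)"

text \<open>The line Re = \<alpha> is the perpendicular bisector of 1 + \<alpha> and -(1 -
  \<alpha>), so the claim compares two distances. The lower bound for one minus the upper bound for
  the other is 2r times the slack in \<open>less\<close>.\<close>

lemma Re_quotient_greater:
  assumes z: "z \<in> ball 0 \<rho>" "z \<noteq> 0"
  shows "\<alpha> < Re (N z / F z)"
proof -
  define r where "r = norm z"
  have r: "0 < r" "r < \<rho>" "norm z = r" using z by (auto simp: r_def)
  have F0: "F z \<noteq> 0" using F_nonzero z by blast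
  note Fz = F[OF z(1)]
  have e1: "N z + of_real (1 - \<alpha>) * F z = of_real (2 - \<alpha>) * z
      + (z * tail_deriv a z + of_real (1 - \<alpha>) * tail_series a z)
      - cnj (z * tail_deriv b z + of_real (- (1 - \<alpha>)) * tail_series b z)"
    by (simp add: N_def Fz algebra_simps)
  have "norm (N z + of_real (1 - \<alpha>) * F z) \<ge> norm (of_real (2 - \<alpha>) * z)
      - norm (z * tail_deriv a z + of_real (1 - \<alpha>) * tail_series a z)
      - norm (z * tail_deriv b z + of_real (- (1 - \<alpha>)) * tail_series b z)"
    using norm_diff_ineq[of "of_real (2 - \<alpha>) * z" "z * tail_deriv a z + of_real (1 - \<alpha>) * tail_series a z"]
      norm_triangle_ineq2[of "of_real (2 - \<alpha>) * z + (z * tail_deriv a z + of_real (1 - \<alpha>) * tail_series a z)"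
         "cnj (z * tail_deriv b z + of_real (- (1 - \<alpha>)) * tail_series b z)"]
    unfolding e1 complex_mod_cnj by linarith
  moreover have "norm (of_real (2 - \<alpha>) * z) = (2 - \<alpha>) * r"
    unfolding norm_mult norm_of_real r(3) using \<alpha> by simp
  ultimately have lower: "norm (N z + of_real (1 - \<alpha>) * F z) \<ge> (2 - \<alpha>) * r
      - r * (majorant_deriv a r + (1 - \<alpha>) * majorant a r) - r * (majorant_deriv b r + - (1 - \<alpha>) * majorant b r)"
    using a.tail_combination_bound[OF r, of "1 - \<alpha>"] b.tail_combination_bound[OF r, of "- (1 - \<alpha>)"] \<alpha>
    by linarith
  have e2: "N z - of_real (1 + \<alpha>) * F z = of_real (- \<alpha>) * z
      + (z * tail_deriv a z + of_real (- (1 + \<alpha>)) * tail_series a z)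
      - cnj (z * tail_deriv b z + of_real (1 + \<alpha>) * tail_series b z)"
    by (simp add: N_def Fz algebra_simps)
  have "norm (N z - of_real (1 + \<alpha>) * F z) \<le> norm (of_real (- \<alpha>) * z)
      + norm (z * tail_deriv a z + of_real (- (1 + \<alpha>)) * tail_series a z)
      + norm (z * tail_deriv b z + of_real (1 + \<alpha>) * tail_series b z)"
    using norm_triangle_ineq[of "of_real (- \<alpha>) * z" "z * tail_deriv a z + of_real (- (1 + \<alpha>)) * tail_series a z"]
      norm_triangle_ineq4[of "of_real (- \<alpha>) * z + (z * tail_deriv a z + of_real (- (1 + \<alpha>)) * tail_series a z)"
         "cnj (z * tail_deriv b z + of_real (1 + \<alpha>) * tail_series b z)"]
    unfolding e2 complex_mod_cnj by linarith
  moreover have "norm (of_real (- \<alpha>) * z) = \<alpha> * r"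
    unfolding norm_mult norm_of_real r(3) using \<alpha> by simp
  ultimately have upper: "norm (N z - of_real (1 + \<alpha>) * F z) \<le> \<alpha> * r
      + r * (majorant_deriv a r + - (1 + \<alpha>) * majorant a r) + r * (majorant_deriv b r + (1 + \<alpha>) * majorant b r)"
    using a.tail_combination_bound[OF r, of "- (1 + \<alpha>)"] b.tail_combination_bound[OF r, of "1 + \<alpha>"] \<alpha>
    by linarith
  have "r * (majorant_deriv a r - \<alpha> * majorant a r + majorant_deriv b r + \<alpha> * majorant b r) < r * (1 - \<alpha>)"
    using less[OF r(1,2)] r by (simp only: mult_less_cancel_left_pos)
  then have "norm (N z - of_real (1 + \<alpha>) * F z) < norm (N z + of_real (1 - \<alpha>) * F z)"
    using lower upper by (simp add: algebra_simps)
  then have "norm (N z - of_real (1 + \<alpha>) * F z) / norm (F z) < norm (N z + of_real (1 - \<alpha>) * F z) / norm (F z)"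
    using F0 by (intro divide_strict_right_mono) auto
  moreover have "(N z - of_real (1 + \<alpha>) * F z) / F z = N z / F z - of_real (1 + \<alpha>)"
    "(N z + of_real (1 - \<alpha>) * F z) / F z = N z / F z + of_real (1 - \<alpha>)"
    using F0 by (simp_all add: field_simps)
  ultimately have "norm (N z / F z - of_real (1 + \<alpha>)) < norm (N z / F z + of_real (1 - \<alpha>))"
    by (metis norm_divide)
  then have "(norm (N z / F z - of_real (1 + \<alpha>)))\<^sup>2 < (norm (N z / F z + of_real (1 - \<alpha>)))\<^sup>2"
    by (intro power_strict_mono) auto
  then show ?thesis
    unfolding cmod_power2 by (simp add: power2_eq_square algebra_simps)
qed

end

section \<open>The argument of F along circles and the enclosed domain\<close>

context starlike_series
begin

lemma holomorphic_parts:
  "(\<lambda>z. z + tail_series a z) holomorphic_on ball 0 \<rho>" "tail_series b holomorphic_on ball 0 \<rho>"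
  by (intro holomorphic_intros a.holomorphic_tail_series b.holomorphic_tail_series)+

lemma decomp_F: "harmonic_decomp (ball 0 \<rho>) F (\<lambda>z. z + tail_series a z) (tail_series b)"
  using F holomorphic_parts by (auto simp: harmonic_decomp_def)

lemma continuous_F: "continuous_on (ball 0 \<rho>) F"
proof -
  have "continuous_on (ball 0 \<rho>) (\<lambda>z. z + tail_series a z + cnj (tail_series b z))"
    by (intro continuous_intros holomorphic_on_imp_continuous_on a.holomorphic_tail_series b.holomorphic_tail_series)
  then show ?thesis by (rule continuous_on_eq) (use F in auto)
qed

text \<open>The two tails divided by z have total modulus below 1. This keeps F z / z in the right
  half-plane, so the principal logarithm gives a smooth argument.\<close>

lemma F_near_identity:
  assumes z: "z \<in> ball 0 \<rho>" "z \<noteq> 0"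
  shows "norm (F z / z - 1) < 1"
proof -
  define r where "r = norm z"
  have r: "0 < r" "r < \<rho>" "norm z = r" using z by (auto simp: r_def)
  have "F z / z - 1 = (tail_series a z + cnj (tail_series b z)) / z"
    using z F[OF z(1)] by (simp add: field_simps)
  then have "norm (F z / z - 1) = norm (tail_series a z + cnj (tail_series b z)) / r"
    by (simp add: norm_divide r)
  also have "\<dots> \<le> (r * majorant a r + r * majorant b r) / r"
    using norm_triangle_ineq[of "tail_series a z" "cnj (tail_series b z)"]
      a.tail_series_bound[OF r] b.tail_series_bound[OF r] r
    by (intro divide_right_mono) auto
  also have "\<dots> = majorant a r + majorant b r" using r by (simp add: field_simps)
  also have "\<dots> \<le> majorant_deriv a r + majorant_deriv b r"
    using a.majorant_deriv_ge[OF r(1,2)] b.majorant_deriv_ge[OF r(1,2)]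
      a.majorant_nonneg[OF r(1,2)] b.majorant_nonneg[OF r(1,2)] by linarith
  also have "\<dots> < 1" by (rule majorant_deriv_less_1[OF r(1,2)])
  finally show ?thesis .
qed

lemma circle_vector_derivative:
  "((\<lambda>\<theta>. of_real r * cis \<theta>) has_vector_derivative \<i> * (of_real r * cis \<theta>)) (at \<theta>)"
proof -
  have "((\<lambda>u. of_real r * exp (\<i> * u)) has_field_derivative \<i> * (of_real r * cis \<theta>)) (at (of_real \<theta>))"
    by (auto intro!: derivative_eq_intros simp: cis_conv_exp)
  from has_vector_derivative_real_field[OF this] show ?thesis by (simp add: cis_conv_exp)
qed

lemma F_vector_derivative:
  assumes r: "0 < r" "r < \<rho>"
  shows "((\<lambda>\<theta>. F (of_real r * cis \<theta>)) has_vector_derivative \<i> * N (of_real r * cis \<theta>)) (at \<theta>)"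
proof -
  define z where "z = of_real r * cis \<theta>"
  have in_ball: "of_real r * cis t \<in> ball 0 \<rho>" for t using r by (simp add: norm_mult)
  have z: "z \<in> ball 0 \<rho>" unfolding z_def by (rule in_ball)
  have "(((\<lambda>z. z + tail_series a z) \<circ> (\<lambda>\<theta>. of_real r * cis \<theta>)) has_vector_derivative \<i> * z * (1 + tail_deriv a z)) (at \<theta>)"
    by (rule field_vector_diff_chain_at)
      (use circle_vector_derivative[of r \<theta>] a.tail_series_has_derivative[OF z] in
        \<open>auto intro!: DERIV_add DERIV_ident simp: z_def\<close>)
  moreover have "((tail_series b \<circ> (\<lambda>\<theta>. of_real r * cis \<theta>)) has_vector_derivative \<i> * z * tail_deriv b z) (at \<theta>)"
    by (rule field_vector_diff_chain_at)
      (use circle_vector_derivative[of r \<theta>] b.tail_series_has_derivative[OF z] in \<open>auto simp: z_def\<close>)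
  ultimately have "((\<lambda>\<theta>. of_real r * cis \<theta> + tail_series a (of_real r * cis \<theta>) + cnj (tail_series b (of_real r * cis \<theta>)))
      has_vector_derivative \<i> * z * (1 + tail_deriv a z) + cnj (\<i> * z * tail_deriv b z)) (at \<theta>)"
    by (intro has_vector_derivative_add has_vector_derivative_cnj) (simp_all add: o_def)
  moreover have "\<i> * z * (1 + tail_deriv a z) + cnj (\<i> * z * tail_deriv b z) = \<i> * N z"
    by (simp add: N_def algebra_simps)
  ultimately show ?thesis by (simp only: F[OF in_ball] z_def)
qed

text \<open>The winding of the circle is carried by the summand \<theta>, and the rest is a
  principal argument that never meets the cut. The result is a global differentiable branch on the
  real line.\<close>

definition angle :: "real \<Rightarrow> real \<Rightarrow> real" where
  "angle r \<theta> = \<theta> + Im (Ln (F (of_real r * cis \<theta>) / (of_real r * cis \<theta>)))"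

lemma F_polar:
  assumes r: "0 < r" "r < \<rho>"
  shows "F (of_real r * cis \<theta>) = of_real (norm (F (of_real r * cis \<theta>))) * cis (angle r \<theta>)"
proof -
  define z where "z = of_real r * cis \<theta>"
  have z: "z \<in> ball 0 \<rho>" "z \<noteq> 0" using r by (auto simp: z_def norm_mult)
  define w where "w = F z / z"
  have w: "w \<noteq> 0" using F_nonzero[OF z] z by (simp add: w_def)
  have nw: "norm w * r = norm (F z)" using r z by (simp add: w_def norm_divide z_def norm_mult)
  have "w = of_real (norm w) * cis (Im (Ln w))"
  proof -
    have "w = exp (Ln w)" using w by simp
    also have "\<dots> = of_real (exp (Re (Ln w))) * cis (Im (Ln w))" by (rule exp_eq_polar)
    also have "exp (Re (Ln w)) = norm w" using w by (simp add: Re_Ln)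
    finally show ?thesis .
  qed
  then have "F z = z * (of_real (norm w) * cis (Im (Ln w)))" using z by (simp add: w_def)
  also have "\<dots> = of_real (norm w * r) * cis (\<theta> + Im (Ln w))"
    by (simp add: z_def cis_mult[symmetric])
  finally show ?thesis unfolding nw by (simp add: angle_def z_def w_def)
qed

text \<open>The logarithmic derivative of F z / z in the angle is i(N / F - 1). Its imaginary part
  is Re (N / F) - 1, and the summand \<theta> of \<open>angle\<close> restores the 1.\<close>

lemma angle_derivative:
  assumes r: "0 < r" "r < \<rho>"
  shows "\<exists>d>\<alpha>. (angle r has_real_derivative d) (at \<theta>)"
proof -
  define z where "z = of_real r * cis \<theta>"
  have z: "z \<in> ball 0 \<rho>" "z \<noteq> 0" using r by (auto simp: z_def norm_mult)
  define w where "w t = F (of_real r * cis t) / (of_real r * cis t)" for t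
  have w0: "w \<theta> \<noteq> 0" using F_nonzero[OF z] z by (simp add: w_def z_def)
  have slit: "w \<theta> \<notin> \<real>\<^sub>\<le>\<^sub>0"
  proof
    assume "w \<theta> \<in> \<real>\<^sub>\<le>\<^sub>0"
    then have "Re (w \<theta>) \<le> 0" by (simp add: complex_nonpos_Reals_iff)
    then have "1 \<le> \<bar>Re (w \<theta> - 1)\<bar>" by simp
    then show False using F_near_identity[OF z] abs_Re_le_cmod[of "w \<theta> - 1"] by (simp add: w_def z_def)
  qed
  have w_alt: "w = (\<lambda>t. F (of_real r * cis t) * (cis (- t) / of_real r))"
    by (auto simp: w_def fun_eq_iff cis_inverse[symmetric] field_simps)
  have dcis: "((\<lambda>t. cis (- t) / of_real r) has_vector_derivative - \<i> * (cis (- \<theta>) / of_real r)) (at \<theta>)"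
  proof -
    have "((\<lambda>u. exp (- \<i> * u) / of_real r) has_field_derivative - \<i> * (cis (- \<theta>) / of_real r)) (at (of_real \<theta>))"
      using r by (auto intro!: derivative_eq_intros simp: cis_conv_exp)
    from has_vector_derivative_real_field[OF this] show ?thesis by (simp add: cis_conv_exp)
  qed
  have "(w has_vector_derivative F z * (- \<i> * (cis (- \<theta>) / of_real r)) + \<i> * N z * (cis (- \<theta>) / of_real r)) (at \<theta>)"
    unfolding w_alt z_def by (rule has_vector_derivative_mult[OF F_vector_derivative[OF r] dcis])
  moreover have "F z * (- \<i> * (cis (- \<theta>) / of_real r)) + \<i> * N z * (cis (- \<theta>) / of_real r)
      = \<i> * (N z / F z - 1) * w \<theta>"
  proof -
    have "F z * (- \<i> * e) + \<i> * (q * F z) * e = \<i> * (q - 1) * (F z * e)" for q e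
      by (simp add: algebra_simps)
    from this[of "cis (- \<theta>) / of_real r" "N z / F z"] show ?thesis
      using F_nonzero[OF z] by (simp add: w_alt z_def[symmetric])
  qed
  ultimately have dw: "(w has_vector_derivative \<i> * (N z / F z - 1) * w \<theta>) (at \<theta>)" by simp
  have "((Ln \<circ> w) has_vector_derivative (\<i> * (N z / F z - 1) * w \<theta>) * inverse (w \<theta>)) (at \<theta>)"
    by (rule field_vector_diff_chain_at[OF dw has_field_derivative_Ln[OF slit]])
  then have "((\<lambda>t. Ln (w t)) has_vector_derivative \<i> * (N z / F z - 1)) (at \<theta>)"
    using w0 by (simp add: o_def mult.assoc)
  from bounded_linear.has_vector_derivative[OF bounded_linear_Im this]
  have "((\<lambda>t. Im (Ln (w t))) has_real_derivative Re (N z / F z) - 1) (at \<theta>)"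
    by (simp add: has_real_derivative_iff_has_vector_derivative)
  then have "((\<lambda>t. t + Im (Ln (w t))) has_real_derivative 1 + (Re (N z / F z) - 1)) (at \<theta>)"
    by (intro DERIV_add DERIV_ident)
  then show ?thesis
    using Re_quotient_greater[OF z] by (intro exI[of _ "Re (N z / F z)"]) (simp add: angle_def[abs_def] w_def)
qed

lemma angle_strict_mono:
  assumes r: "0 < r" "r < \<rho>" and "x < y"
  shows "angle r x < angle r y"
  using \<open>x < y\<close>
proof (rule DERIV_pos_imp_increasing)
  fix t
  show "\<exists>d. (angle r has_real_derivative d) (at t) \<and> 0 < d"
    using angle_derivative[OF r, of t] \<alpha> by (meson le_less_trans)
qed

lemma angle_shift: "angle r (\<theta> + 2 * pi * of_int k) = angle r \<theta> + 2 * pi * of_int k"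
proof -
  have "cis (\<theta> + 2 * pi * of_int k) = cis \<theta>" by (simp add: cis_mult[symmetric] cis_multiple_2pi)
  then show ?thesis by (simp add: angle_def)
qed

text \<open>The angle increases strictly and grows by 2 pi per turn, so the image curve meets every
  ray from the origin at most once.\<close>

lemma same_direction:
  assumes r: "0 < r" "r < \<rho>" and s: "0 < s" "0 < s'"
    and eq: "of_real s * F (of_real r * cis \<theta>) = of_real s' * F (of_real r * cis \<theta>')"
  shows "s = s'" "cis \<theta> = cis \<theta>'"
proof -
  have z: "of_real r * cis t \<in> ball 0 \<rho>" "of_real r * cis t \<noteq> 0" for t using r by (auto simp: norm_mult)
  have pos: "norm (F (of_real r * cis t)) > 0" for t using F_nonzero[OF z] by simp
  have n: "s * norm (F (of_real r * cis \<theta>)) = s' * norm (F (of_real r * cis \<theta>'))"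
    using arg_cong[OF eq, of norm] s by (simp add: norm_mult)
  have "of_real (s * norm (F (of_real r * cis \<theta>))) * cis (angle r \<theta>) =
      of_real (s' * norm (F (of_real r * cis \<theta>'))) * cis (angle r \<theta>')"
    using eq F_polar[OF r, of \<theta>] F_polar[OF r, of \<theta>'] by (metis mult.assoc of_real_mult)
  then have "cis (angle r \<theta>) = cis (angle r \<theta>')"
    unfolding n using pos[of \<theta>'] s by simp
  then obtain k :: int where "angle r \<theta> = angle r \<theta>' + 2 * pi * of_int k"
    using sin_cos_eq_iff[of "angle r \<theta>" "angle r \<theta>'"] by (auto simp: complex_eq_iff)
  then have "angle r \<theta> = angle r (\<theta>' + 2 * pi * of_int k)" by (simp add: angle_shift)
  then have "\<theta> = \<theta>' + 2 * pi * of_int k"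
    using angle_strict_mono[OF r, of \<theta>] angle_strict_mono[OF r, of "\<theta>' + 2 * pi * of_int k" \<theta>]
    by (metis less_irrefl linorder_neqE_linordered_idom)
  then show c: "cis \<theta> = cis \<theta>'" by (simp add: cis_mult[symmetric] cis_multiple_2pi)
  show "s = s'" using n pos[of \<theta>] unfolding c by simp
qed

text \<open>
  The domain inside the image of \<open>sphere 0 r\<close> is the image of the unit disc under the
  radial extension of \<open>F\<close> from that circle.
\<close>

definition radial :: "real \<Rightarrow> complex \<Rightarrow> complex" where
  "radial r w = of_real (norm w) * F (of_real r * sgn w)"

lemma radial_polar: "0 \<le> s \<Longrightarrow> radial r (of_real s * cis \<theta>) = of_real s * F (of_real r * cis \<theta>)"
proof (cases "s = 0")
  case False
  assume "0 \<le> s"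
  have "sgn (cis \<theta>) = cis \<theta>" by (simp add: sgn_div_norm)
  then have "sgn (of_real s * cis \<theta>) = cis \<theta>" using False \<open>0 \<le> s\<close> by (simp add: sgn_mult sgn_of_real)
  then show ?thesis using \<open>0 \<le> s\<close> by (simp add: radial_def norm_mult)
qed (simp add: radial_def)

lemma polar_form:
  obtains s \<theta> where "0 \<le> s" "(w::complex) = of_real s * cis \<theta>" "s = norm w"
  by (metis norm_ge_zero rcis_def rcis_cmod_Arg)

lemma inj_radial:
  assumes r: "0 < r" "r < \<rho>"
  shows "inj (radial r)"
proof (rule injI)
  fix w w' assume eq: "radial r w = radial r w'"
  obtain s \<theta> where w: "0 \<le> s" "w = of_real s * cis \<theta>" "s = norm w" by (rule polar_form)
  obtain s' \<theta>' where w': "0 \<le> s'" "w' = of_real s' * cis \<theta>'" "s' = norm w'" by (rule polar_form)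
  have eq': "of_real s * F (of_real r * cis \<theta>) = of_real s' * F (of_real r * cis \<theta>')"
    using eq unfolding w(2) w'(2) radial_polar[OF w(1)] radial_polar[OF w'(1)] .
  have nz: "F (of_real r * cis t) \<noteq> 0" for t using r by (intro F_nonzero) (auto simp: norm_mult)
  show "w = w'"
  proof (cases "s = 0 \<or> s' = 0")
    case True
    then have "s = 0" "s' = 0" using eq' nz by auto
    then show ?thesis using w(2) w'(2) by simp
  next
    case False
    then have "0 < s" "0 < s'" using w(1) w'(1) by auto
    then have "s = s'" "cis \<theta> = cis \<theta>'" using same_direction[OF r _ _ eq'] by auto
    then show ?thesis unfolding w(2) w'(2) by simp
  qed
qed

text \<open>At the origin \<open>sgn\<close> is discontinuous, but F is bounded on the circle and
  the factor |w| tends to 0.\<close>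

lemma continuous_radial:
  assumes r: "0 < r" "r < \<rho>"
  shows "continuous_on UNIV (radial r)"
proof -
  have "isCont (radial r) w" for w
  proof (cases "w = 0")
    case True
    have "compact (F ` cball 0 r)"
      using r by (intro compact_continuous_image continuous_on_subset[OF continuous_F]) auto
    then obtain M where M: "\<And>z. z \<in> cball 0 r \<Longrightarrow> norm (F z) \<le> M"
      using compact_imp_bounded bounded_iff by (metis imageI)
    have "(radial r \<longlongrightarrow> 0) (at 0)"
    proof (rule Lim_null_comparison[of _ "\<lambda>w. norm w * M"])
      have "norm (radial r w) \<le> norm w * M" for w
        unfolding radial_def norm_mult norm_of_real abs_norm_cancel
        using r by (intro mult_left_mono M) (auto simp: norm_mult norm_sgn)
      then show "\<forall>\<^sub>F w in at 0. norm (radial r w) \<le> norm w * M" by simp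
      have "((\<lambda>w::complex. norm w * M) \<longlongrightarrow> norm (0::complex) * M) (at 0)"
        by (rule tendsto_mult[OF tendsto_norm[OF tendsto_ident_at] tendsto_const])
      then show "((\<lambda>w::complex. norm w * M) \<longlongrightarrow> 0) (at 0)" by simp
    qed
    then show ?thesis using True by (simp add: isCont_def radial_def)
  next
    case False
    have "of_real r * sgn w \<in> ball 0 \<rho>" using r False by (simp add: norm_mult norm_sgn)
    then have "isCont F (of_real r * sgn w)"
      using continuous_F continuous_on_eq_continuous_at[OF open_ball] by blast
    moreover have "isCont (\<lambda>w. of_real r * sgn w) w" using False by (intro continuous_intros) auto
    ultimately have "isCont (\<lambda>w. F (of_real r * sgn w)) w" by (rule isCont_o2[rotated])
    then show ?thesis unfolding radial_def[abs_def] by (intro continuous_intros)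
  qed
  then show ?thesis by (simp add: continuous_at_imp_continuous_on)
qed

text \<open>The radial extension is injective and continuous on the plane, so invariance of domain
  makes the image of the disc open, and by compactness its frontier is the image of the circle.
  Starlikeness holds because the extension is linear along rays from 0.\<close>

lemma starlike_domain:
  assumes r: "0 < r" "r < \<rho>"
  shows "\<exists>D. bounds_domain (F ` sphere 0 r) D \<and> starlike_origin D"
proof (intro exI conjI)
  define E where "E = radial r"
  define D where "D = E ` ball 0 1"
  have cont: "continuous_on S E" for S
    using continuous_radial[OF r] continuous_on_subset unfolding E_def by blast
  have inj: "inj_on E S" for S using inj_radial[OF r] unfolding E_def by (rule inj_on_subset) simp
  have oD: "open D" unfolding D_def by (rule invariance_of_domain[OF cont open_ball inj])
  have comp: "compact (E ` cball 0 1)" by (intro compact_continuous_image cont compact_cball)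
  have DE: "D \<subseteq> E ` cball 0 1" by (auto simp: D_def)
  have clD: "closure D = E ` cball 0 1"
  proof
    show "closure D \<subseteq> E ` cball 0 1"
      using DE compact_imp_closed[OF comp] by (rule closure_minimal)
    have "E ` closure (ball 0 1) \<subseteq> closure D"
      unfolding D_def by (rule image_closure_subset[OF cont]) (auto simp: closure_subset)
    then show "E ` cball 0 1 \<subseteq> closure D" by simp
  qed
  have "frontier D = E ` cball 0 1 - E ` ball 0 1"
    using oD clD by (simp add: frontier_def interior_open D_def)
  also have "\<dots> = E ` (cball 0 1 - ball 0 1)"
    by (rule inj_on_image_set_diff[symmetric, OF inj[of UNIV]]) auto
  also have "cball 0 1 - ball 0 1 = sphere (0::complex) 1" by auto
  also have "E ` sphere 0 1 = F ` sphere 0 r"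
  proof -
    have "E w = F (of_real r * w)" if "w \<in> sphere 0 1" for w
      using that by (simp add: E_def radial_def sgn_div_norm)
    then have "E ` sphere 0 1 = F ` (\<lambda>w. of_real r * w) ` sphere 0 1" by (simp add: image_image)
    also have "(\<lambda>w. of_real r * w) ` sphere 0 1 = sphere (0::complex) r"
    proof (intro equalityI subsetI)
      fix z :: complex assume "z \<in> sphere 0 r"
      then show "z \<in> (\<lambda>w. of_real r * w) ` sphere 0 1"
        using r by (intro image_eqI[of _ _ "z / of_real r"]) (auto simp: norm_divide)
    qed (use r in \<open>auto simp: norm_mult\<close>)
    finally show ?thesis .
  qed
  finally have fr: "frontier D = F ` sphere 0 r" .
  have E0: "E 0 = 0" by (simp add: E_def radial_def)
  then have D0: "0 \<in> D" unfolding D_def by (intro image_eqI[of _ _ 0]) auto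
  have "bounded D" using DE compact_imp_bounded[OF comp] bounded_subset by blast
  moreover have "connected D" unfolding D_def by (intro connected_continuous_image cont connected_ball)
  ultimately show "bounds_domain (F ` sphere 0 r) D"
    using oD D0 fr by (auto simp: bounds_domain_def)
  show "starlike_origin D"
    unfolding starlike_origin_def
  proof (intro conjI ballI subsetI)
    show "0 \<in> D" by fact
    fix w x assume "w \<in> D" "x \<in> closed_segment 0 w"
    then obtain v u where v: "v \<in> ball 0 1" "w = E v" and u: "0 \<le> u" "u \<le> 1" "x = of_real u * w"
      by (auto simp: D_def closed_segment_def scaleR_conv_of_real)
    have "x = E (of_real u * v)"
    proof (cases "u = 0")
      case False
      then have "sgn (of_real u * v) = sgn v" using u by (simp add: sgn_mult sgn_of_real)
      then show ?thesis using u by (simp add: v E_def radial_def norm_mult)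
    qed (simp add: u E0)
    moreover have "norm (of_real u * v) < 1"
      using v u mult_le_one[of u "norm v"] mult_left_le_one_le[of "norm v" u] by (simp add: norm_mult)
    ultimately show "x \<in> D" unfolding D_def by auto
  qed
qed

theorem fully_starlike_F: "fully_starlike \<alpha> \<rho> F"
  unfolding fully_starlike_def
proof (intro conjI allI impI)
  show "harmonic_in_disk \<rho> F" using decomp_F unfolding harmonic_in_disk_def by blast
  show "F 0 = 0" by (rule F_0)
  fix r assume r: "0 < r \<and> r < \<rho>"
  then have r': "0 < r" "r < \<rho>" by auto
  show "inj_on F (sphere 0 r)" using r by (intro inj_on_subset[OF inj_F]) auto
  show "\<exists>D. bounds_domain (F ` sphere 0 r) D \<and> starlike_origin D" by (rule starlike_domain[OF r'])
  show "arg_deriv_gt (\<lambda>\<theta>. F (of_real r * cis \<theta>)) \<alpha>"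
    unfolding arg_deriv_gt_def
  proof (intro conjI allI exI[of _ "angle r"])
    fix \<theta>
    show "F (of_real r * cis \<theta>) \<noteq> 0" using r by (intro F_nonzero) (auto simp: norm_mult)
    show "F (of_real r * cis \<theta>) = of_real (norm (F (of_real r * cis \<theta>))) * cis (angle r \<theta>)"
      by (rule F_polar[OF r'])
    show "\<exists>d>\<alpha>. (angle r has_real_derivative d) (at \<theta>)" by (rule angle_derivative[OF r'])
  qed
qed

end

section \<open>The radius\<close>

text \<open>Cauchy product with the geometric series.\<close>

lemma partial_sums_times_power_sums:
  fixes d :: "nat \<Rightarrow> real"
  assumes r: "0 \<le> r" "r < 1" and d: "\<And>n. 0 \<le> d n" and s: "(\<lambda>n. d n * r ^ n) sums s"
  shows "(\<lambda>n. (\<Sum>i\<le>n. d i) * r ^ n) sums (s / (1 - r))"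
proof -
  have "(\<lambda>k. \<Sum>i\<le>k. d i * r ^ i * r ^ (k - i)) sums ((\<Sum>n. d n * r ^ n) * (\<Sum>n. r ^ n))"
    by (rule Cauchy_product_sums)
      (use r d sums_summable[OF s] in \<open>auto simp: abs_mult\<close>)
  moreover have "(\<Sum>i\<le>k. d i * r ^ i * r ^ (k - i)) = (\<Sum>i\<le>k. d i) * r ^ k" for k
    unfolding sum_distrib_right by (rule sum.cong) (auto simp: mult.assoc simp flip: power_add)
  moreover have "(\<Sum>n. d n * r ^ n) * (\<Sum>n. r ^ n) = s / (1 - r)"
    using sums_unique[OF s] suminf_geometric[of r] r by simp
  ultimately show ?thesis by simp
qed

text \<open>
  The numerator \<open>1 + r + r\<^sup>2\<close> is the generating function of the fourth differences of the cubic
  coefficients; each summation below divides by \<open>1 - r\<close>.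
\<close>

lemma cubic_power_sums:
  fixes r :: real
  assumes r: "0 \<le> r" "r < 1"
  shows "(\<lambda>n. (real n + 1) * ((real n + 1)\<^sup>2 + 1) / 2 * r ^ n) sums ((1 + r + r\<^sup>2) / (1 - r) ^ 4)"
proof -
  define d0 :: "nat \<Rightarrow> real" where "d0 n = (if n < 3 then 1 else 0)" for n
  define d1 :: "nat \<Rightarrow> real" where "d1 n = (if n = 0 then 1 else if n = 1 then 2 else 3)" for n
  define d2 :: "nat \<Rightarrow> real" where "d2 n = (if n = 0 then 1 else 3 * real n)" for n
  define d3 :: "nat \<Rightarrow> real" where "d3 n = 1 + 3 * real n * (real n + 1) / 2" for n
  define d4 :: "nat \<Rightarrow> real" where "d4 n = (real n + 1) * ((real n + 1)\<^sup>2 + 1) / 2" for n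
  have 1: "(\<Sum>i\<le>n. d0 i) = d1 n" for n
    by (induction n) (auto simp: d0_def d1_def)
  have 2: "(\<Sum>i\<le>n. d1 i) = d2 n" for n
    by (induction n) (auto simp: d1_def d2_def)
  have 3: "(\<Sum>i\<le>n. d2 i) = d3 n" for n
    by (induction n) (auto simp: d2_def d3_def field_simps)
  have 4: "(\<Sum>i\<le>n. d3 i) = d4 n" for n
    by (induction n) (auto simp: d3_def d4_def field_simps power2_eq_square)
  have "(\<lambda>n. d0 n * r ^ n) sums (\<Sum>n<3. d0 n * r ^ n)"
    by (rule sums_finite) (auto simp: d0_def)
  moreover have "(\<Sum>n<3. d0 n * r ^ n) = 1 + r + r\<^sup>2"
    by (simp add: d0_def eval_nat_numeral)
  ultimately have s0: "(\<lambda>n. d0 n * r ^ n) sums (1 + r + r\<^sup>2)" by simp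
  have s1: "(\<lambda>n. d1 n * r ^ n) sums ((1 + r + r\<^sup>2) / (1 - r))"
    using partial_sums_times_power_sums[OF r _ s0] unfolding 1 by (simp add: d0_def)
  have s2: "(\<lambda>n. d2 n * r ^ n) sums ((1 + r + r\<^sup>2) / (1 - r) / (1 - r))"
    using partial_sums_times_power_sums[OF r _ s1] unfolding 2 by (simp add: d1_def)
  have s3: "(\<lambda>n. d3 n * r ^ n) sums ((1 + r + r\<^sup>2) / (1 - r) / (1 - r) / (1 - r))"
    using partial_sums_times_power_sums[OF r _ s2] unfolding 3 by (simp add: d2_def)
  have s4: "(\<lambda>n. d4 n * r ^ n) sums ((1 + r + r\<^sup>2) / (1 - r) / (1 - r) / (1 - r) / (1 - r))"
    using partial_sums_times_power_sums[OF r _ s3] unfolding 4 by (simp add: d3_def)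
  have "(1 + r + r\<^sup>2) / (1 - r) / (1 - r) / (1 - r) / (1 - r) = (1 + r + r\<^sup>2) / (1 - r) ^ 4"
    by (simp add: eval_nat_numeral)
  with s4 show ?thesis unfolding d4_def by (simp only:)
qed

text \<open>With N = n + 2 the bound is ((N + 1) / 2)^2, and (N^2 + 1) / 2 exceeds it by (N - 1)^2 /
  4; the series from \<open>cubic_power_sums\<close> therefore dominates.\<close>

lemma tail_polynomial_bound:
  assumes "\<And>n. norm (c n) \<le> (real n + 3)\<^sup>2 / 4" and "\<rho> \<le> 1"
  shows "tail c \<rho>"
proof
  fix r :: real assume r: "0 < r" "r < \<rho>"
  have "summable (\<lambda>n. (real n + 1) * ((real n + 1)\<^sup>2 + 1) / 2 * r ^ n)"
    by (rule sums_summable[OF cubic_power_sums]) (use r assms(2) in auto)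
  then have "summable (\<lambda>n. (real (n + 1) + 1) * ((real (n + 1) + 1)\<^sup>2 + 1) / 2 * r ^ (n + 1))"
    by (subst summable_iff_shift)
  then show "summable (\<lambda>n. real (n + 2) * norm (c n) * r ^ (n + 1))"
  proof (rule summable_comparison_test')
    fix n
    have "norm (c n) \<le> ((real (n + 1) + 1)\<^sup>2 + 1) / 2"
    proof -
      have "((real (n + 1) + 1)\<^sup>2 + 1) / 2 - (real n + 3)\<^sup>2 / 4 = (real n + 1)\<^sup>2 / 4"
        by (simp add: power2_eq_square field_simps)
      moreover have "0 \<le> (real n + 1)\<^sup>2 / 4" by simp
      ultimately show ?thesis using assms(1)[of n] by linarith
    qed
    then have "real (n + 2) * norm (c n) \<le> real (n + 2) * (((real (n + 1) + 1)\<^sup>2 + 1) / 2)"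
      by (rule mult_left_mono) simp
    then have "real (n + 2) * norm (c n) * r ^ (n + 1) \<le>
        (real (n + 1) + 1) * ((real (n + 1) + 1)\<^sup>2 + 1) / 2 * r ^ (n + 1)"
      using r by (intro mult_right_mono) (auto simp: add_ac)
    then show "norm (real (n + 2) * norm (c n) * r ^ (n + 1)) \<le>
        (real (n + 1) + 1) * ((real (n + 1) + 1)\<^sup>2 + 1) / 2 * r ^ (n + 1)"
      using r by simp
  qed
qed

text \<open>With N = n + 2, the identity (N - \<alpha>)(N + 1)^2 / 4 + (N + \<alpha>)(N - 1)^2 / 4 =
  N(N^2 + 1) / 2 - \<alpha> N reduces both bounds to one cubic and one linear coefficient sequence,
  each with a known generating function.\<close>

lemma majorant_sum_le:
  assumes a: "\<And>n. norm (a n) \<le> (real n + 3)\<^sup>2 / 4" and b: "\<And>n. norm (b n) \<le> (real n + 1)\<^sup>2 / 4"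
    and \<alpha>: "0 \<le> \<alpha>" "\<alpha> < 1" and r: "0 < r" "r < 1"
  shows "majorant_deriv a r - \<alpha> * majorant a r + majorant_deriv b r + \<alpha> * majorant b r
    \<le> (1 + r + r\<^sup>2) / (1 - r) ^ 4 - \<alpha> / (1 - r)\<^sup>2 - (1 - \<alpha>)"
proof -
  have b': "norm (b n) \<le> (real n + 3)\<^sup>2 / 4" for n
    using b[of n] by (rule order_trans) (simp add: power_mono)
  interpret a: tail a 1 by (rule tail_polynomial_bound[OF a]) simp
  interpret b: tail b 1 by (rule tail_polynomial_bound[OF b']) simp
  \<comment> \<open>Here index n stands for N = n + 1, so ?C 0 = 1 - \<alpha> is the term of z
    itself; removing it aligns ?C (Suc n) with the tails.\<close>
  let ?C = "\<lambda>n. (real n + 1) * ((real n + 1)\<^sup>2 + 1) / 2 * r ^ n - \<alpha> * (real (Suc n) * r ^ n)"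
  have "?C sums ((1 + r + r\<^sup>2) / (1 - r) ^ 4 - \<alpha> * (1 / (1 - r)\<^sup>2))"
    using r geometric_deriv_sums[of r] by (intro sums_diff sums_mult cubic_power_sums) auto
  then have C: "(\<lambda>n. ?C (Suc n)) sums ((1 + r + r\<^sup>2) / (1 - r) ^ 4 - \<alpha> * (1 / (1 - r)\<^sup>2) - ?C 0)"
    by (subst sums_Suc_iff) simp
  have "majorant_deriv a r - \<alpha> * majorant a r + majorant_deriv b r + \<alpha> * majorant b r =
      (\<Sum>n. real (n + 2) * norm (a n) * r ^ (n + 1) - \<alpha> * (norm (a n) * r ^ (n + 1))
        + real (n + 2) * norm (b n) * r ^ (n + 1) + \<alpha> * (norm (b n) * r ^ (n + 1)))" (is "_ = suminf ?L")
    unfolding majorant_def majorant_deriv_def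
    using a.summable_deriv[OF r] a.summable_majorant[OF r] b.summable_deriv[OF r] b.summable_majorant[OF r]
    by (simp only: suminf_mult[symmetric] suminf_add summable_mult suminf_diff summable_add summable_diff)
  also have "\<dots> \<le> (\<Sum>n. ?C (Suc n))"
  proof (rule suminf_le[OF _ _ sums_summable[OF C]])
    show "summable ?L"
      by (intro summable_add summable_diff summable_mult a.summable_deriv a.summable_majorant
          b.summable_deriv b.summable_majorant r)
    fix n
    have "(real n + 2 - \<alpha>) * norm (a n) + (real n + 2 + \<alpha>) * norm (b n)
        \<le> (real n + 2 - \<alpha>) * ((real n + 3)\<^sup>2 / 4) + (real n + 2 + \<alpha>) * ((real n + 1)\<^sup>2 / 4)"
      using \<alpha> by (intro add_mono mult_left_mono a b) auto
    also have "\<dots> = (real (Suc n) + 1) * ((real (Suc n) + 1)\<^sup>2 + 1) / 2 - \<alpha> * real (Suc (Suc n))"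
      by (simp add: power2_eq_square field_simps)
    finally have "((real n + 2 - \<alpha>) * norm (a n) + (real n + 2 + \<alpha>) * norm (b n)) * r ^ (n + 1) \<le>
        ((real (Suc n) + 1) * ((real (Suc n) + 1)\<^sup>2 + 1) / 2 - \<alpha> * real (Suc (Suc n))) * r ^ (n + 1)"
      using r by (intro mult_right_mono) auto
    then show "?L n \<le> ?C (Suc n)" by (simp add: algebra_simps)
  qed
  also have "\<dots> = (1 + r + r\<^sup>2) / (1 - r) ^ 4 - \<alpha> / (1 - r)\<^sup>2 - (1 - \<alpha>)"
    using sums_unique[OF C] by simp
  finally show ?thesis .
qed

definition radius_poly :: "real \<Rightarrow> real \<Rightarrow> real" where
  "radius_poly \<alpha> r = 2 * (1 - \<alpha>) * (1 - r) ^ 4 + \<alpha> * (1 - r)\<^sup>2 - (r\<^sup>2 + r + 1)"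

lemma radius_eq_iff: "radius_eq \<alpha> r \<longleftrightarrow> radius_poly \<alpha> r = 0"
  by (simp add: radius_eq_def radius_poly_def)

lemma radius_poly_antimono:
  assumes "0 \<le> \<alpha>" "\<alpha> < 1" "0 \<le> x" "x < y" "y \<le> 1"
  shows "radius_poly \<alpha> y < radius_poly \<alpha> x"
proof -
  have "2 * (1 - \<alpha>) * (1 - y) ^ 4 \<le> 2 * (1 - \<alpha>) * (1 - x) ^ 4" "\<alpha> * (1 - y)\<^sup>2 \<le> \<alpha> * (1 - x)\<^sup>2"
    using assms by (intro mult_left_mono power_mono; simp)+
  moreover have "x\<^sup>2 \<le> y\<^sup>2" using assms by (intro power_mono) auto
  ultimately show ?thesis using assms unfolding radius_poly_def by linarith
qed

lemma radius_ex1: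
  assumes \<alpha>: "0 \<le> \<alpha>" "\<alpha> < 1"
  shows "\<exists>!r. 0 < r \<and> r < 1 \<and> radius_eq \<alpha> r"
proof -
  have ends: "radius_poly \<alpha> 0 > 0" "radius_poly \<alpha> 1 < 0" using \<alpha> by (auto simp: radius_poly_def)
  have "\<exists>r\<ge>0. r \<le> 1 \<and> radius_poly \<alpha> r = 0"
    by (rule IVT2) (use ends in \<open>auto simp: radius_poly_def intro!: continuous_intros\<close>)
  then obtain r where r: "0 \<le> r" "r \<le> 1" "radius_poly \<alpha> r = 0" by blast
  then have "0 < r" "r < 1" using ends by (auto simp: less_le)
  moreover have "s = r" if "0 < s" "s < 1" "radius_poly \<alpha> s = 0" for s
    using radius_poly_antimono[OF \<alpha>, of s r] radius_poly_antimono[OF \<alpha>, of r s] that r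
    by (cases s r rule: linorder_cases) auto
  ultimately show ?thesis using r(3) unfolding radius_eq_iff by blast
qed

lemma conv_radius_starlike_root:
  assumes \<alpha>: "0 \<le> \<alpha>" "\<alpha> < 1"
  shows "0 < conv_radius_starlike \<alpha>" "conv_radius_starlike \<alpha> < 1"
    "radius_poly \<alpha> (conv_radius_starlike \<alpha>) = 0"
  using theI'[OF radius_ex1[OF \<alpha>]] unfolding conv_radius_starlike_def radius_eq_iff by auto

lemma conv_radius_starlike_0: "\<bar>conv_radius_starlike 0 - 0.129831\<bar> \<le> 0.0000005"
proof -
  note c = conv_radius_starlike_root[of 0, simplified]
  \<comment> \<open>The test points lie half a unit of the sixth decimal below and above
    0.129831.\<close>
  have "radius_poly 0 0.1298305 > 0" "radius_poly 0 0.1298315 < 0"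
    by (simp_all add: radius_poly_def power4_eq_xxxx power2_eq_square)
  then have "\<not> conv_radius_starlike 0 < 0.1298305" "\<not> 0.1298315 < conv_radius_starlike 0"
    using radius_poly_antimono[of 0 "conv_radius_starlike 0" "0.1298305"]
      radius_poly_antimono[of 0 "0.1298315" "conv_radius_starlike 0"] c by auto
  then show ?thesis by (simp add: abs_if)
qed

text \<open>Below the root the decreasing polynomial is positive. Divided by (1 - r)^4, this says
  that the closed form of the majorant sum is less than 1 - \<alpha>.\<close>

lemma majorant_sum_less:
  assumes a: "\<And>n. norm (a n) \<le> (real n + 3)\<^sup>2 / 4" and b: "\<And>n. norm (b n) \<le> (real n + 1)\<^sup>2 / 4"
    and \<alpha>: "0 \<le> \<alpha>" "\<alpha> < 1" and r: "0 < r" "r < conv_radius_starlike \<alpha>"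
  shows "majorant_deriv a r - \<alpha> * majorant a r + majorant_deriv b r + \<alpha> * majorant b r < 1 - \<alpha>"
proof -
  note c = conv_radius_starlike_root[OF \<alpha>]
  have r1: "r < 1" using r c by simp
  have "0 < radius_poly \<alpha> r"
    using radius_poly_antimono[OF \<alpha>, of r "conv_radius_starlike \<alpha>"] r c by simp
  then have "1 + r + r\<^sup>2 < 2 * (1 - \<alpha>) * (1 - r) ^ 4 + \<alpha> * (1 - r)\<^sup>2"
    by (simp add: radius_poly_def)
  then have "(1 + r + r\<^sup>2) / (1 - r) ^ 4 < (2 * (1 - \<alpha>) * (1 - r) ^ 4 + \<alpha> * (1 - r)\<^sup>2) / (1 - r) ^ 4"
    using r1 by (intro divide_strict_right_mono) auto
  also have "\<dots> = 2 * (1 - \<alpha>) + \<alpha> / (1 - r)\<^sup>2"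
  proof -
    define q where "q = (1 - r)\<^sup>2"
    have "(1 - r) ^ 4 = q * q" by (simp add: q_def flip: power_add)
    moreover have "q \<noteq> 0" using r1 by (simp add: q_def)
    ultimately show ?thesis unfolding q_def[symmetric] by (simp add: add_divide_distrib)
  qed
  finally have lt: "(1 + r + r\<^sup>2) / (1 - r) ^ 4 < 2 * (1 - \<alpha>) + \<alpha> / (1 - r)\<^sup>2" .
  have "M < 1 - \<alpha>" if "T < 2 * (1 - \<alpha>) + Q" "M \<le> T - Q - (1 - \<alpha>)" for M T Q :: real
    using that by (simp add: algebra_simps)
  from this[OF lt majorant_sum_le[OF a b \<alpha> r(1) r1]] show ?thesis .
qed

section \<open>Application to the convolution\<close>

lemma K_H0_decomp:
  assumes "f \<in> K_H0"
  obtains h g where "harmonic_decomp (ball 0 1) f h g"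
    "taylor h 0 = 0" "taylor h 1 = 1" "taylor g 0 = 0" "taylor g 1 = 0"
    "\<And>n. analytic_coeff f n = taylor h n" "\<And>n. coanalytic_coeff f n = taylor g n"
    "\<And>n. norm (taylor h (n + 2)) \<le> (real n + 3) / 2" "\<And>n. norm (taylor g (n + 2)) \<le> (real n + 1) / 2"
proof -
  obtain h g where d: "harmonic_decomp (ball 0 1) f h g" "h 0 = 0" "deriv h 0 = 1" "g 0 = 0"
    "\<And>z. z \<in> ball 0 1 \<Longrightarrow> norm (deriv g z) < norm (deriv h z)"
    and inj: "inj_on f (ball 0 1)"
    using assms by (auto simp: K_H0_def S_H_def)
  have conv: "convex (f ` ball 0 1)" and c1: "coanalytic_coeff f 1 = 0" using assms by (auto simp: K_H0_def)
  have co: "analytic_coeff f n = taylor h n" "coanalytic_coeff f n = taylor g n" for n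
    using analytic_coeff_eq[OF d(1,4)] coanalytic_coeff_eq[OF d(1,4)] by (simp_all add: taylor_def)
  have g1: "deriv g 0 = 0" using c1 co(2)[of 1] by (simp add: taylor_def)
  have bounds: "norm (taylor h (n + 2)) \<le> (real n + 3) / 2" "norm (taylor g (n + 2)) \<le> (real n + 1) / 2" for n
    using convex_harmonic_coefficients[OF d(1) inj conv d(3) g1 d(5), of "n + 1"] by (simp_all add: add_ac)
  show ?thesis
    by (rule that[OF d(1) _ _ _ _ co bounds]) (use d g1 in \<open>simp_all add: taylor_def\<close>)
qed

text \<open>Coefficients multiply under convolution, so their bounds are squared: ((n + 3) / 2)^2
  and ((n + 1) / 2)^2 for the power n + 2. The normalizations leave z as the only term of degree
  below 2.\<close>

lemma harmonic_conv_starlike_series: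
  assumes f: "f \<in> K_H0" and g: "g \<in> K_H0" and \<alpha>: "0 \<le> \<alpha>" "\<alpha> < 1"
  obtains a b where "starlike_series a b (conv_radius_starlike \<alpha>) \<alpha> (harmonic_conv f g)"
proof -
  obtain h1 g1 where 1: "taylor h1 0 = 0" "taylor h1 1 = 1" "taylor g1 0 = 0" "taylor g1 1 = 0"
    "\<And>n. analytic_coeff f n = taylor h1 n" "\<And>n. coanalytic_coeff f n = taylor g1 n"
    "\<And>n. norm (taylor h1 (n + 2)) \<le> (real n + 3) / 2" "\<And>n. norm (taylor g1 (n + 2)) \<le> (real n + 1) / 2"
    using K_H0_decomp[OF f] by metis
  obtain h2 g2 where 2: "taylor h2 0 = 0" "taylor h2 1 = 1" "taylor g2 0 = 0" "taylor g2 1 = 0"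
    "\<And>n. analytic_coeff g n = taylor h2 n" "\<And>n. coanalytic_coeff g n = taylor g2 n"
    "\<And>n. norm (taylor h2 (n + 2)) \<le> (real n + 3) / 2" "\<And>n. norm (taylor g2 (n + 2)) \<le> (real n + 1) / 2"
    using K_H0_decomp[OF g] by metis
  define A where "A n = taylor h1 n * taylor h2 n" for n
  define B where "B n = taylor g1 n * taylor g2 n" for n
  define a where "a n = A (n + 2)" for n
  define b where "b n = B (n + 2)" for n
  have a: "norm (a n) \<le> (real n + 3)\<^sup>2 / 4" for n
    using mult_mono[OF 1(7)[of n] 2(7)[of n]] by (simp add: a_def A_def norm_mult power2_eq_square)
  have b: "norm (b n) \<le> (real n + 1)\<^sup>2 / 4" for n
    using mult_mono[OF 1(8)[of n] 2(8)[of n]] by (simp add: b_def B_def norm_mult power2_eq_square)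
  have b': "norm (b n) \<le> (real n + 3)\<^sup>2 / 4" for n
    using b[of n] by (rule order_trans) (simp add: power_mono)
  note c = conv_radius_starlike_root[OF \<alpha>]
  define \<rho> where "\<rho> = conv_radius_starlike \<alpha>"
  interpret a: tail a \<rho> by (rule tail_polynomial_bound[OF a]) (use c in \<open>simp add: \<rho>_def\<close>)
  interpret b: tail b \<rho> by (rule tail_polynomial_bound[OF b']) (use c in \<open>simp add: \<rho>_def\<close>)
  have conv: "harmonic_conv f g z = z + tail_series a z + cnj (tail_series b z)" if z: "z \<in> ball 0 \<rho>" for z
  proof -
    define r where "r = (norm z + \<rho>) / 2"
    have r: "0 < r" "r < \<rho>" "norm z \<le> r" using z norm_ge_zero[of z] by (auto simp: r_def simp del: norm_ge_zero)
    have "summable (\<lambda>n. A (n + 2) * z ^ (n + 2))" "summable (\<lambda>n. B (n + 2) * z ^ (n + 2))"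
      using a.summable_tail(1)[OF r] b.summable_tail(1)[OF r] by (simp_all add: a_def b_def)
    then have "summable (\<lambda>n. A n * z ^ n)" "summable (\<lambda>n. B n * z ^ n)"
      using summable_iff_shift[of "\<lambda>n. A n * z ^ n" 2] summable_iff_shift[of "\<lambda>n. B n * z ^ n" 2] by blast+
    from this[THEN suminf_split_initial_segment, of 2]
    have "(\<Sum>n. A n * z ^ n) = tail_series a z + (\<Sum>n<2. A n * z ^ n)"
      "(\<Sum>n. B n * z ^ n) = tail_series b z + (\<Sum>n<2. B n * z ^ n)"
      by (simp_all add: tail_series_def a_def b_def)
    then show ?thesis
      using 1 2 by (simp add: harmonic_conv_def A_def B_def numeral_2_eq_2)
  qed
  have "starlike_series a b \<rho> \<alpha> (harmonic_conv f g)"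
  proof
    show "0 < \<rho>" using c by (simp add: \<rho>_def)
    show "majorant_deriv a r - \<alpha> * majorant a r + majorant_deriv b r + \<alpha> * majorant b r < 1 - \<alpha>"
      if "0 < r" "r < \<rho>" for r
      using majorant_sum_less[OF a b \<alpha>] that by (simp add: \<rho>_def)
  qed (use \<alpha> conv in auto)
  then show ?thesis using that by (simp add: \<rho>_def)
qed

theorem corollary4p3:
  fixes f g :: "complex \<Rightarrow> complex" and \<alpha> :: real
  assumes "f \<in> K_H0" and "g \<in> K_H0" and "0 \<le> \<alpha>" and "\<alpha> < 1"
  shows "(\<exists>!r. 0 < r \<and> r < 1 \<and> radius_eq \<alpha> r) \<and>
         inj_on (harmonic_conv f g) (ball 0 (conv_radius_starlike \<alpha>)) \<and>
         fully_starlike \<alpha> (conv_radius_starlike \<alpha>) (harmonic_conv f g) \<and>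
         inj_on (harmonic_conv f g) (ball 0 (conv_radius_starlike 0)) \<and>
         fully_starlike 0 (conv_radius_starlike 0) (harmonic_conv f g) \<and>
         \<bar>conv_radius_starlike 0 - 0.129831\<bar> \<le> 0.0000005"
proof -
  \<comment> \<open>The order is left general as \<beta> because both \<alpha> and 0 are
    needed.\<close>
  have "inj_on (harmonic_conv f g) (ball 0 (conv_radius_starlike \<beta>)) \<and>
      fully_starlike \<beta> (conv_radius_starlike \<beta>) (harmonic_conv f g)" if "0 \<le> \<beta>" "\<beta> < 1" for \<beta>
    using harmonic_conv_starlike_series[OF assms(1,2) that]
      starlike_series.inj_F starlike_series.fully_starlike_F by metis
  then show ?thesis
    using radius_ex1[OF assms(3,4)] conv_radius_starlike_0 assms(3,4) by simp
qed

end
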